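(* Consider the system $$\partial_t u+\partial_x f(u)=0,\qquad \partial_t v+\partial_x\big(a(u)v\big)=0\qquad (t>0,\ x\in\mathbb{R}),$$ with the Burgers flux $f(u)=u^2/2$ and the velocity $a(u)=u-1$. There exist $u_0\in BV^{1/3-0}(\mathbb{R})$ and $v_0\in L^\infty(\mathbb{R})$ such that - the system is uniformly strictly hyperbolic, that is, with $M=\|u_0\|_\infty$, $\inf_{|u|\le M} f'(u)>\sup_{|u|\le M}a(u)$; and - there does not exist any bounded entropy solution (that is, entropy solution $(u,v)$ with $u,v\in L^\infty(\mathbb{R}\times(0,+\infty))$) of the system with the initial data $(u_0,v_0)$.
   Context: **Space $BV^s$.** For $0<s\le1$ and $u:\mathbb{R}\to\mathbb{R}$, let $TV^s u=\sup\sum_{i=1}^{n-1}|u(x_{i+1})-u(x_i)|^{1/s}$, the supremum being over all $n$ and all $x_1<\dots<x_n$ in $\mathbb{R}$. $BV^s(\mathbb{R})$ is the set of $u$ with $TV^s u<+\infty$, and $BV^{1/3-0}:=\bigcap_{0<s<1/3}BV^s$. **Weak solution.** A pair $(u,v)$ is a weak solution with initial data $(u_0,v_0)$ if for all compactly supported $\varphi,\psi\in C^1_c(\mathbb{R}\times[0,+\infty),\mathbb{R})$, $$\int_0^{\infty}\!\int_{\mathbb{R}}\big(u\,\partial_t\varphi+f(u)\,\partial_x\varphi\big)dx\,dt+\int_{\mathbb{R}}u_0(x)\varphi(x,0)\,dx=0,$$ $$\int_0^{\infty}\!\int_{\mathbb{R}}\big(v\,\partial_t\psi+a(u)v\,\partial_x\psi\big)dx\,dt+\int_{\mathbb{R}}v_0(x)\psi(x,0)\,dx=0.$$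 **Entropy solution.** $(u,v)$ is an entropy solution if it is a weak solution and, for every convex function $\eta$, with $q'=\eta' f'$, and every non-negative $\varphi\in C^1_c(\mathbb{R}\times[0,+\infty),\mathbb{R})$, $$\int_0^{\infty}\!\int_{\mathbb{R}}\big(\eta(u)\,\partial_t\varphi+q(u)\,\partial_x\varphi\big)dx\,dt+\int_{\mathbb{R}}\eta(u_0(x))\varphi(x,0)\,dx\ge0.$$ *)

theory Defs
  imports "HOL-Analysis.Analysis" "HOL-Probability.Essential_Supremum"
begin

definition TV :: "real \<Rightarrow> (real \<Rightarrow> real) \<Rightarrow> ennreal" where
  "TV s u = (SUP (n, x) \<in> {(n :: nat, x :: nat \<Rightarrow> real). strict_mono_on {1..n} x}.
     \<Sum>i = 1..<n. ennreal (\<bar>u (x (i + 1)) - u (x i)\<bar> powr (1 / s)))"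

definition BV :: "real \<Rightarrow> (real \<Rightarrow> real) set" where
  "BV s = {u. TV s u < \<infinity>}"

definition BV_minus :: "real \<Rightarrow> (real \<Rightarrow> real) set" where
  "BV_minus p = (\<Inter>s\<in>{0<..<p}. BV s)"

definition Linf_norm :: "'a measure \<Rightarrow> ('a \<Rightarrow> real) \<Rightarrow> ereal" where
  "Linf_norm M u = esssup M (\<lambda>x. ereal \<bar>u x\<bar>)"

text \<open>Over \<open>lborel\<close>, elements of \<open>L\<^sup>\<infinity>\<close> are given by Borel representatives, which every
  class of Lebesgue measurable functions possesses.\<close>

definition Linf :: "'a measure \<Rightarrow> ('a \<Rightarrow> real) set" where
  "Linf M = {u \<in> borel_measurable M. Linf_norm M u < \<infinity>}"

text \<open>Points of the half plane are pairs \<open>(x, t)\<close>: space first, time second.\<close>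

definition half_plane :: "(real \<times> real) set" where
  "half_plane = UNIV \<times> {0..}"

definition open_half_plane :: "(real \<times> real) set" where
  "open_half_plane = UNIV \<times> {0<..}"

text \<open>\<open>C\<^sup>1\<close> up to the boundary \<open>t = 0\<close>, with support compact in the closed half plane (a test
  function need not vanish at \<open>t = 0\<close>). Values outside the half plane are irrelevant.\<close>

definition test_functions :: "(real \<times> real \<Rightarrow> real) set" where
  "test_functions = {\<phi>.
     (\<exists>\<phi>' :: real \<times> real \<Rightarrow> (real \<times> real) \<Rightarrow>\<^sub>L real.
        (\<forall>p\<in>half_plane. (\<phi> has_derivative blinfun_apply (\<phi>' p)) (at p within half_plane)) \<and>
        continuous_on half_plane \<phi>') \<and>
     compact (closure (support_on half_plane \<phi>))}"

definition dx :: "(real \<times> real \<Rightarrow> real) \<Rightarrow> real \<Rightarrow> real \<Rightarrow> real" where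
  "dx \<phi> x t = deriv (\<lambda>y. \<phi> (y, t)) x"

definition dt :: "(real \<times> real \<Rightarrow> real) \<Rightarrow> real \<Rightarrow> real \<Rightarrow> real" where
  "dt \<phi> x t = deriv (\<lambda>r. \<phi> (x, r)) t"

text \<open>The predicates below are meant for bounded measurable \<open>u\<close>, \<open>v\<close>, \<open>u0\<close>, \<open>v0\<close> and
  continuous \<open>f\<close>, \<open>a\<close>, for which all the integrals converge absolutely.\<close>

definition weak_solution ::
  "(real \<Rightarrow> real) \<Rightarrow> (real \<Rightarrow> real) \<Rightarrow> (real \<Rightarrow> real) \<Rightarrow> (real \<Rightarrow> real) \<Rightarrow>
   (real \<times> real \<Rightarrow> real) \<Rightarrow> (real \<times> real \<Rightarrow> real) \<Rightarrow> bool" where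
  "weak_solution f a u0 v0 u v \<longleftrightarrow>
     (\<forall>\<phi>\<in>test_functions.
        (LBINT t:{0<..}. LBINT x. u (x, t) * dt \<phi> x t + f (u (x, t)) * dx \<phi> x t)
          + (LBINT x. u0 x * \<phi> (x, 0)) = 0) \<and>
     (\<forall>\<psi>\<in>test_functions.
        (LBINT t:{0<..}. LBINT x. v (x, t) * dt \<psi> x t + a (u (x, t)) * v (x, t) * dx \<psi> x t)
          + (LBINT x. v0 x * \<psi> (x, 0)) = 0)"

text \<open>A convex \<open>\<eta>\<close> may fail to be differentiable at countably many points, so \<open>q' = \<eta>' f'\<close> is
  required where \<open>\<eta>'\<close> exists. Together with continuity of \<open>q\<close> this determines \<open>q\<close> up to an
  additive constant, as the indefinite integral of \<open>\<eta>' f'\<close>.\<close>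

definition entropy_flux :: "(real \<Rightarrow> real) \<Rightarrow> (real \<Rightarrow> real) \<Rightarrow> (real \<Rightarrow> real) \<Rightarrow> bool" where
  "entropy_flux f \<eta> q \<longleftrightarrow> continuous_on UNIV q \<and>
     (\<forall>w. \<eta> differentiable (at w) \<longrightarrow>
        (q has_real_derivative deriv \<eta> w * deriv f w) (at w))"

definition entropy_solution ::
  "(real \<Rightarrow> real) \<Rightarrow> (real \<Rightarrow> real) \<Rightarrow> (real \<Rightarrow> real) \<Rightarrow> (real \<Rightarrow> real) \<Rightarrow>
   (real \<times> real \<Rightarrow> real) \<Rightarrow> (real \<times> real \<Rightarrow> real) \<Rightarrow> bool" where
  "entropy_solution f a u0 v0 u v \<longleftrightarrow> weak_solution f a u0 v0 u v \<and>
     (\<forall>\<eta> q \<phi>. convex_on UNIV \<eta> \<longrightarrow> entropy_flux f \<eta> q \<longrightarrow>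
        \<phi> \<in> test_functions \<longrightarrow> (\<forall>p\<in>half_plane. 0 \<le> \<phi> p) \<longrightarrow>
        0 \<le> (LBINT t:{0<..}. LBINT x. \<eta> (u (x, t)) * dt \<phi> x t + q (u (x, t)) * dx \<phi> x t)
          + (LBINT x. \<eta> (u0 x) * \<phi> (x, 0)))"

text \<open>The bounds are taken in \<open>ereal\<close>, so that they are meaningful for every \<open>M\<close>.\<close>

definition uniformly_strictly_hyperbolic ::
  "(real \<Rightarrow> real) \<Rightarrow> (real \<Rightarrow> real) \<Rightarrow> ereal \<Rightarrow> bool" where
  "uniformly_strictly_hyperbolic f a M \<longleftrightarrow>
     (INF w\<in>{w. ereal \<bar>w\<bar> \<le> M}. ereal (deriv f w)) > (SUP w\<in>{w. ereal \<bar>w\<bar> \<le> M}. ereal (a w))"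

end

theory Submission
  imports Defs
begin

text \<open>The datum \<open>u\<^sub>0\<close> is a sawtooth on \<open>x < 0\<close> whose \<open>n\<close>-th tooth has height
  of order \<open>n^(-1/3)\<close>, and \<open>v\<^sub>0 = 1\<close>. All edges and shocks of the entropy solution are
  stationary, and on the \<open>n\<close>-th tooth it is a sawtooth of slope \<open>1 / (t + \<tau>\<^sub>n)\<close>. The characteristics of the second
  equation run to the left and cross the teeth one after the other; crossing a shock of
  strength \<open>k\<close> contracts the time between two neighbouring characteristics by
  \<open>exp (2 k) (1 - k) / (1 + k) \<le> exp (- 2 k^3 / 3)\<close>, while the mass of \<open>v\<close> between them is conserved. As the \<open>\<tau>\<^sub>n\<close> grow
  geometrically, a tooth is met before it has decayed, so that the \<open>k^3\<close> sum up like the harmonic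
  series and \<open>v\<close> cannot be bounded.

  Both equations are integrated once. For \<open>u\<close> this gives a Lipschitz function with
  \<open>U\<^sub>t + U\<^sub>x\<^sup>2 / 2 = 0\<close>. Convexity of the flux bounds \<open>U\<close> from above, and one quadratic entropy makes \<open>U\<close> a viscosity
  supersolution (De Lellis, Otto, Westdickenberg), which bounds it from below; this identifies \<open>u\<close> without
  doubling of variables. The potential of \<open>v\<close> is constant along characteristics.\<close>

section \<open>A smooth step function\<close>

text \<open>The exponent 1/3 results from a cancellation. At a stationary shock with the states k
  and -k the density v is compressed by (1 + k) / (1 - k) = exp (2 k + 2 k^3 / 3 + ...), while the
  two rarefactions of the same tooth dilute it by exp (-2 k). The linear terms cancel, quadratic
  ones are absent, and a cubic gain per tooth remains. So the cubes of the strengths have to sum to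
  infinity, and n^(-1/3) achieves this while all sums of p-th powers with p > 3 converge. The
  obstacle is that only boundedness is known of a candidate (u, v), so that v need not have traces
  on a shock. The potential of v is Lipschitz, hence continuous across shocks and edges:
  characteristics have to be followed only inside open rarefactions, where the velocity is
  Lipschitz, and can be joined at their end points. A bound on v is a Lipschitz bound in time for
  the potential, to be refuted by a fixed increment over ever shorter time intervals.\<close>

definition clip :: "real \<Rightarrow> real" where "clip s = min 1 (max 0 s)"
text \<open>The quintic smoothstep, of least degree among the polynomials that climb from 0 to 1
  with vanishing first and second derivatives at both ends. Its derivative \<open>bump\<close>, the
  mollifying kernel, is therefore C^1 with Lipschitz derivative \<open>dbump\<close>, as needed for
  a kernel that is itself differentiated.\<close>

definition step :: "real \<Rightarrow> real" where "step s = (let c = clip s in c^3 * (10 - 15 * c + 6 * c^2))"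
definition bump :: "real \<Rightarrow> real" where "bump s = (let c = clip s in 30 * c^2 * (1 - c)^2)"
definition dbump :: "real \<Rightarrow> real" where "dbump s = (let c = clip s in 60 * c * (1 - c) * (1 - 2 * c))"

lemma clip_range: "0 \<le> clip s" "clip s \<le> 1" and clip_0: "s \<le> 0 \<Longrightarrow> clip s = 0"
  and clip_1: "1 \<le> s \<Longrightarrow> clip s = 1" and clip_id: "0 \<le> s \<Longrightarrow> s \<le> 1 \<Longrightarrow> clip s = s"
  and clip_lipschitz: "\<bar>clip r - clip s\<bar> \<le> \<bar>r - s\<bar>"
  unfolding clip_def by auto

lemma continuous_clip [continuous_intros]:
  "continuous_on S f \<Longrightarrow> continuous_on S (\<lambda>x. clip (f x))"
  unfolding clip_def by (intro continuous_intros)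

text \<open>\<open>clip\<close> has kinks at 0 and 1; as \<open>P'\<close> vanishes there, the
  difference quotients from both sides tend to 0 and the kinks disappear.\<close>

lemma DERIV_compose_clip:
  assumes "\<And>s. (P has_real_derivative P' s) (at s)" "P' 0 = 0" "P' 1 = 0"
  shows "((\<lambda>s. P (clip s)) has_real_derivative P' (clip s)) (at s)"
proof -
  consider "s < 0" | "s > 1" | "0 < s" "s < 1" | "s = 0" | "s = 1" by linarith
  then show ?thesis
  proof cases
    case 1
    have "((\<lambda>s. P 0) has_real_derivative 0) (at s)" by simp
    then have "((\<lambda>s. P (clip s)) has_real_derivative 0) (at s)"
      by (rule has_field_derivative_transform_within_open[of _ _ _ "{..<0}"]) (use 1 in \<open>auto simp: clip_0\<close>)
    then show ?thesis using 1 assms by (simp add: clip_0)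
  next
    case 2
    have "((\<lambda>s. P 1) has_real_derivative 0) (at s)" by simp
    then have "((\<lambda>s. P (clip s)) has_real_derivative 0) (at s)"
      by (rule has_field_derivative_transform_within_open[of _ _ _ "{1<..}"]) (use 2 in \<open>auto simp: clip_1\<close>)
    then show ?thesis using 2 assms by (simp add: clip_1)
  next
    case 3
    have "(P has_real_derivative P' s) (at s)" by (rule assms)
    then have "((\<lambda>s. P (clip s)) has_real_derivative P' s) (at s)"
      by (rule has_field_derivative_transform_within_open[of _ _ _ "{0<..<1}"]) (use 3 in \<open>auto simp: clip_id\<close>)
    then show ?thesis using 3 assms by (simp add: clip_id)
  next
    case 4
    have l: "((\<lambda>s. P 0) has_real_derivative 0) (at 0 within {..0})" by simp
    have r: "(P has_real_derivative 0) (at 0 within {0..1})"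
      using assms(1)[of 0] assms(2) by (metis has_field_derivative_at_within)
    have "((\<lambda>s. P (clip s)) has_real_derivative 0) (at 0 within {..0})"
      by (rule has_derivative_transform[OF _ _ l[unfolded has_field_derivative_def], folded has_field_derivative_def]) (auto simp: clip_0)
    moreover have "((\<lambda>s. P (clip s)) has_real_derivative 0) (at 0 within {0..1})"
      by (rule has_derivative_transform[OF _ _ r[unfolded has_field_derivative_def], folded has_field_derivative_def]) (auto simp: clip_id)
    ultimately have "((\<lambda>s. P (clip s)) has_real_derivative 0) (at 0 within {..0} \<union> {0..1})"
      unfolding has_field_derivative_iff by (rule Lim_Un)
    moreover have "{..0} \<union> {0..1} = {..(1::real)}" by auto
    moreover have "at (0::real) within {..1} = at 0" by (rule at_within_interior) (simp add: interior_real_atMost)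
    ultimately show ?thesis using 4 assms by (simp add: clip_0)
  next
    case 5
    have l: "((\<lambda>s. P 1) has_real_derivative 0) (at 1 within {1..})" by simp
    have r: "(P has_real_derivative 0) (at 1 within {0..1})"
      using assms(1)[of 1] assms(3) by (metis has_field_derivative_at_within)
    have "((\<lambda>s. P (clip s)) has_real_derivative 0) (at 1 within {1..})"
      by (rule has_derivative_transform[OF _ _ l[unfolded has_field_derivative_def], folded has_field_derivative_def]) (auto simp: clip_1)
    moreover have "((\<lambda>s. P (clip s)) has_real_derivative 0) (at 1 within {0..1})"
      by (rule has_derivative_transform[OF _ _ r[unfolded has_field_derivative_def], folded has_field_derivative_def]) (auto simp: clip_id)
    ultimately have "((\<lambda>s. P (clip s)) has_real_derivative 0) (at 1 within {1..} \<union> {0..1})"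
      unfolding has_field_derivative_iff by (rule Lim_Un)
    moreover have "{1..} \<union> {0..1} = {(0::real)..}" by auto
    moreover have "at (1::real) within {0..} = at 1" by (rule at_within_interior) (simp add: interior_real_atLeast)
    ultimately show ?thesis using 5 assms by (simp add: clip_1)
  qed
qed

lemma DERIV_step: "(step has_real_derivative bump s) (at s)"
proof -
  have *: "((\<lambda>s. s^3 * (10 - 15 * s + 6 * s^2)) has_real_derivative 30 * s^2 * (1 - s)^2) (at s)" for s :: real
    by (rule derivative_eq_intros refl | simp)+ (simp add: algebra_simps power2_eq_square power3_eq_cube)
  show ?thesis using DERIV_compose_clip[of "\<lambda>s. s^3 * (10 - 15 * s + 6 * s^2)" "\<lambda>s. 30 * s^2 * (1 - s)^2", OF *]
    unfolding step_def[abs_def] bump_def Let_def by simp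
qed

lemma DERIV_bump: "(bump has_real_derivative dbump s) (at s)"
proof -
  have *: "((\<lambda>s. 30 * s^2 * (1 - s)^2) has_real_derivative 60 * s * (1 - s) * (1 - 2 * s)) (at s)" for s :: real
    by (rule derivative_eq_intros refl | simp)+ (simp add: algebra_simps power2_eq_square)
  show ?thesis using DERIV_compose_clip[of "\<lambda>s. 30 * s^2 * (1 - s)^2" "\<lambda>s. 60 * s * (1 - s) * (1 - 2 * s)", OF *]
    unfolding bump_def[abs_def] dbump_def Let_def by simp
qed

lemma lipschitz_if_DERIV_bounded:
  fixes f :: "real \<Rightarrow> real"
  assumes "\<And>s. (f has_real_derivative f' s) (at s)" "\<And>s. \<bar>f' s\<bar> \<le> L"
  shows "\<bar>f r - f s\<bar> \<le> L * \<bar>r - s\<bar>"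
  using field_differentiable_bound[of UNIV f f' L r s] assms by simp

text \<open>Subtracting the tangent leaves a function whose derivative is at most L |d| on the
  segment, so the mean value bound yields a quadratic remainder without a second derivative. This
  suits \<open>bump\<close>, whose second derivative jumps at 0 and 1.\<close>

lemma taylor_if_DERIV_lipschitz:
  fixes f :: "real \<Rightarrow> real"
  assumes "\<And>s. (f has_real_derivative f' s) (at s)" "\<And>r s. \<bar>f' r - f' s\<bar> \<le> L * \<bar>r - s\<bar>"
  shows "\<bar>f (s + d) - f s - d * f' s\<bar> \<le> L * d\<^sup>2"
proof -
  have "\<bar>(f (s + d) - f' s * (s + d)) - (f s - f' s * s)\<bar> \<le> (L * \<bar>d\<bar>) * \<bar>(s + d) - s\<bar>"
  proof -
    have "\<bar>f' x - f' s\<bar> \<le> L * \<bar>d\<bar>" if "x \<in> closed_segment s (s + d)" for x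
    proof -
      have "\<bar>x - s\<bar> \<le> \<bar>d\<bar>" using that by (auto simp: closed_segment_eq_real_ivl split: if_splits)
      moreover have "0 \<le> L" using assms(2)[of 1 0] by simp
      ultimately show ?thesis using assms(2)[of x s] by (meson mult_left_mono order_trans)
    qed
    moreover have "((\<lambda>x. f x - f' s * x) has_field_derivative (f' x - f' s)) (at x within closed_segment s (s + d))" for x
      using DERIV_diff[OF assms(1)[of x] DERIV_cmult[OF DERIV_ident, of "f' s" x]]
      by (simp add: has_field_derivative_at_within)
    ultimately have "norm ((\<lambda>x. f x - f' s * x) (s + d) - (\<lambda>x. f x - f' s * x) s) \<le> (L * \<bar>d\<bar>) * norm ((s + d) - s)"
      using field_differentiable_bound[of "closed_segment s (s + d)" "\<lambda>x. f x - f' s * x" "\<lambda>x. f' x - f' s" "L * \<bar>d\<bar>" "s + d" s]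
      by simp
    then show ?thesis by simp
  qed
  then show ?thesis by (simp add: algebra_simps power2_eq_square abs_mult)
qed

lemma bump_nonneg: "0 \<le> bump s" unfolding bump_def Let_def by simp

lemma clip_mult_le: "clip s * (1 - clip s) \<le> 1/4"
proof -
  have "0 \<le> (1 - 2 * clip s)^2" by simp
  then show ?thesis by (simp add: power2_eq_square algebra_simps)
qed

lemma bump_le: "bump s \<le> 2"
proof -
  have "(clip s * (1 - clip s))^2 \<le> (1/4)^2"
    by (rule power_mono[OF clip_mult_le]) (use clip_range[of s] in auto)
  moreover have "bump s = 30 * (clip s * (1 - clip s))^2"
    unfolding bump_def Let_def by (simp add: power_mult_distrib)
  ultimately show ?thesis unfolding power_divide by simp
qed

lemma bump_abs_le: "\<bar>bump s\<bar> \<le> 2" using bump_nonneg[of s] bump_le[of s] by simp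

lemma dbump_abs_le: "\<bar>dbump s\<bar> \<le> 60"
proof -
  have "\<bar>clip s * (1 - clip s)\<bar> \<le> 1" "\<bar>1 - 2 * clip s\<bar> \<le> 1"
    using clip_mult_le[of s] clip_range[of s] by auto
  then have "\<bar>clip s * (1 - clip s)\<bar> * \<bar>1 - 2 * clip s\<bar> \<le> 1 * 1" by (intro mult_mono) auto
  then show ?thesis unfolding dbump_def Let_def by (simp add: abs_mult mult.assoc)
qed

lemma dbump_lipschitz: "\<bar>dbump r - dbump s\<bar> \<le> 420 * \<bar>r - s\<bar>"
proof -
  define a b where "a = clip r" and "b = clip s"
  have ab: "0 \<le> a" "a \<le> 1" "0 \<le> b" "b \<le> 1" "\<bar>a - b\<bar> \<le> \<bar>r - s\<bar>"
    unfolding a_def b_def using clip_range clip_lipschitz by auto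
  have eq: "dbump r - dbump s = (a - b) * (60 - 180 * (a + b) + 120 * (a*a + a*b + b*b))"
    unfolding dbump_def Let_def a_def b_def by (simp add: algebra_simps)
  have "a*a \<le> 1" "a*b \<le> 1" "b*b \<le> 1" using ab by (auto simp: mult_le_one)
  moreover have "0 \<le> a*a" "0 \<le> a*b" "0 \<le> b*b" using ab by auto
  \<comment> \<open>The constant 420 = 60 + 3 * 120 results from treating the three products as
    independent numbers in [0, 1].\<close>
  moreover have "\<bar>60 - 180 * (a + b) + 120 * (u + v + w)\<bar> \<le> 420"
    if "u \<le> 1" "v \<le> 1" "w \<le> 1" "0 \<le> u" "0 \<le> v" "0 \<le> w" for u v w :: real
    using ab that unfolding abs_le_iff by auto
  ultimately have "\<bar>60 - 180 * (a + b) + 120 * (a*a + a*b + b*b)\<bar> \<le> 420" by blast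
  then have "\<bar>dbump r - dbump s\<bar> \<le> \<bar>r - s\<bar> * 420" unfolding eq abs_mult using ab by (intro mult_mono) auto
  then show ?thesis by simp
qed

lemma bump_lipschitz: "\<bar>bump r - bump s\<bar> \<le> 60 * \<bar>r - s\<bar>"
  by (rule lipschitz_if_DERIV_bounded[OF DERIV_bump dbump_abs_le])

lemma step_taylor: "\<bar>step (s + d) - step s - d * bump s\<bar> \<le> 60 * d\<^sup>2"
  by (rule taylor_if_DERIV_lipschitz[OF DERIV_step bump_lipschitz])

lemma bump_taylor: "\<bar>bump (s + d) - bump s - d * dbump s\<bar> \<le> 420 * d\<^sup>2"
  by (rule taylor_if_DERIV_lipschitz[OF DERIV_bump dbump_lipschitz])

lemma step_0: "s \<le> 0 \<Longrightarrow> step s = 0" and step_1: "1 \<le> s \<Longrightarrow> step s = 1"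
  and bump_0: "s \<le> 0 \<or> 1 \<le> s \<Longrightarrow> bump s = 0" and dbump_0: "s \<le> 0 \<or> 1 \<le> s \<Longrightarrow> dbump s = 0"
  unfolding step_def bump_def dbump_def by (auto simp: clip_0 clip_1)

lemma step_range: "0 \<le> step s" "step s \<le> 1"
proof -
  have mono: "step r \<le> step s" if "r \<le> s" for r s
    by (rule DERIV_nonneg_imp_nondecreasing[OF that]) (use DERIV_step bump_nonneg in blast)
  show "0 \<le> step s" using mono[of "min s 0" s] by (simp add: step_0)
  show "step s \<le> 1" using mono[of s "max s 1"] by (simp add: step_1)
qed

lemma continuous_step [continuous_intros]: "continuous_on S f \<Longrightarrow> continuous_on S (\<lambda>x. step (f x))"
  and continuous_bump [continuous_intros]: "continuous_on S f \<Longrightarrow> continuous_on S (\<lambda>x. bump (f x))"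
  and continuous_dbump [continuous_intros]: "continuous_on S f \<Longrightarrow> continuous_on S (\<lambda>x. dbump (f x))"
  unfolding step_def bump_def dbump_def Let_def by (intro continuous_intros; simp)+

lemma borel_step [measurable]: "step \<in> borel_measurable borel"
  and borel_bump [measurable]: "bump \<in> borel_measurable borel"
  and borel_dbump [measurable]: "dbump \<in> borel_measurable borel"
  by (intro borel_measurable_continuous_onI continuous_intros)+

lemma integral_bump: "(LBINT s. bump s) = 1" "integrable lborel bump"
proof -
  have "has_bochner_integral lborel (\<lambda>s. bump s * indicator {0..1} s) (step 1 - step 0)"
  proof (rule has_bochner_integral_FTC_Icc_real)
    show "isCont bump x" for x using DERIV_bump DERIV_isCont by blast
  qed (use DERIV_step bump_nonneg in simp_all)
  moreover have "(\<lambda>s. bump s * indicator {0..1} s) = bump"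
    proof
    show "bump s * indicator {0..1} s = bump s" for s using bump_0[of s] by (cases "s \<in> {0..1}") auto
  qed
  ultimately have "has_bochner_integral lborel bump 1" by (simp add: step_0 step_1)
  then show "(LBINT s. bump s) = 1" "integrable lborel bump"
    by (auto simp: has_bochner_integral_iff)
qed

section \<open>Local averages\<close>

lemma borel_fst_plane [measurable]: "fst \<in> borel_measurable (borel :: (real \<times> real) measure)"
  and borel_snd_plane [measurable]: "snd \<in> borel_measurable (borel :: (real \<times> real) measure)"
  by (intro borel_measurable_continuous_onI continuous_intros)+

lemma emeasure_rect:
  assumes "a \<le> b" "c \<le> d"
  shows "emeasure (lborel :: (real \<times> real) measure) ({a..b} \<times> {c..d}) = ennreal ((b - a) * (d - c))"
  using assms unfolding lborel_prod[symmetric]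
  by (simp add: lborel.emeasure_pair_measure_Times ennreal_mult)

lemma rect_borel [measurable]: "({a..b} \<times> {c..d} :: (real \<times> real) set) \<in> sets borel"
  by (intro borel_closed closed_Times) auto

lemma integrable_rect:
  fixes f :: "real \<times> real \<Rightarrow> real"
  assumes [measurable]: "f \<in> borel_measurable borel"
    and "\<And>P. \<bar>f P\<bar> \<le> C" and "\<And>P. P \<notin> {a..b} \<times> {c..d} \<Longrightarrow> f P = 0"
  shows "integrable lborel f"
proof (rule integrableI_bounded_set[of "{a..b} \<times> {c..d}" _ _ C])
  have "bounded ({a..b} \<times> {c..d} :: (real \<times> real) set)" by (intro bounded_Times) auto
  then show "emeasure lborel ({a..b} \<times> {c..d} :: (real \<times> real) set) < \<infinity>" by (rule emeasure_bounded_finite)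
qed (use assms in auto)

lemma abs_integral_rect:
  fixes f :: "real \<times> real \<Rightarrow> real"
  assumes f: "f \<in> borel_measurable borel"
    and C: "\<And>P. \<bar>f P\<bar> \<le> C" and 0: "\<And>P. P \<notin> {a..b} \<times> {c..d} \<Longrightarrow> f P = 0" and "a \<le> b" "c \<le> d"
  shows "\<bar>\<integral>P. f P \<partial>lborel\<bar> \<le> C * ((b - a) * (d - c))"
proof -
  let ?R = "{a..b} \<times> {c..d} :: (real \<times> real) set"
  have "\<bar>\<integral>P. f P \<partial>lborel\<bar> \<le> (\<integral>P. \<bar>f P\<bar> \<partial>lborel)" by (rule integral_abs_bound)
  also have "\<dots> \<le> (\<integral>P. C * indicator ?R P \<partial>lborel)"
  proof (rule integral_mono)
    show "integrable lborel (\<lambda>P. \<bar>f P\<bar>)" using integrable_rect[OF f C 0] by simp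
    have "emeasure lborel ?R < \<infinity>" using assms by (simp add: emeasure_rect)
    then show "integrable lborel (\<lambda>P. C * indicator ?R P)"
      using integrable_real_indicator[of ?R lborel] by simp
    show "\<bar>f P\<bar> \<le> C * indicator ?R P" for P
      using C[of P] 0[of P] by (cases "P \<in> ?R") (simp_all del: mem_Times_iff)
  qed
  also have "\<dots> = C * ((b - a) * (d - c))"
    using assms by (simp add: measure_def emeasure_rect)
  finally show ?thesis .
qed

lemma integrable_Icc:
  fixes f :: "real \<Rightarrow> real"
  assumes [measurable]: "f \<in> borel_measurable borel"
    and "\<And>x. \<bar>f x\<bar> \<le> C" and "\<And>x. x \<notin> {a..b} \<Longrightarrow> f x = 0"
  shows "integrable lborel f"
  by (rule integrableI_bounded_set[of "{a..b}" _ _ C]) (use assms in \<open>auto simp: emeasure_lborel_Icc_eq\<close>)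

lemma abs_integral_Icc:
  fixes f :: "real \<Rightarrow> real"
  assumes f: "f \<in> borel_measurable borel"
    and C: "\<And>x. \<bar>f x\<bar> \<le> C" and 0: "\<And>x. x \<notin> {a..b} \<Longrightarrow> f x = 0" and "a \<le> b"
  shows "\<bar>\<integral>x. f x \<partial>lborel\<bar> \<le> C * (b - a)"
proof -
  have "\<bar>\<integral>x. f x \<partial>lborel\<bar> \<le> (\<integral>x. \<bar>f x\<bar> \<partial>lborel)" by (rule integral_abs_bound)
  also have "\<dots> \<le> (\<integral>x. C * indicator {a..b} x \<partial>lborel)"
  proof (rule integral_mono)
    show "integrable lborel (\<lambda>x. \<bar>f x\<bar>)" using integrable_Icc[OF f C 0] by simp
    show "integrable lborel (\<lambda>P. C * indicator {a..b} P)"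
      by (intro integrable_mult_right integrable_real_indicator) (simp_all add: emeasure_lborel_Icc_eq)
    show "\<bar>f x\<bar> \<le> C * indicator {a..b} x" for x
      using C[of x] 0[of x] by (cases "x \<in> {a..b}") simp_all
  qed
  also have "\<dots> = C * (b - a)" using assms by simp
  finally show ?thesis .
qed

definition kernel :: "real \<times> real \<Rightarrow> real" where "kernel A = bump (fst A) * bump (snd A)"

lemma borel_kernel [measurable]: "kernel \<in> borel_measurable borel"
  unfolding kernel_def[abs_def] by (intro borel_measurable_continuous_onI continuous_intros)

lemma kernel_nonneg: "0 \<le> kernel A" and kernel_le: "kernel A \<le> 4" and kernel_0: "A \<notin> {0..1} \<times> {0..1} \<Longrightarrow> kernel A = 0"
proof -
  show "0 \<le> kernel A" by (simp add: kernel_def bump_nonneg)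
  have "kernel A \<le> 2 * 2" unfolding kernel_def by (intro mult_mono bump_le bump_nonneg) auto
  then show "kernel A \<le> 4" by simp
  show "A \<notin> {0..1} \<times> {0..1} \<Longrightarrow> kernel A = 0"
    by (cases A) (auto simp: kernel_def bump_0)
qed

lemma integrable_kernel: "integrable lborel kernel"
proof (rule integrable_rect[OF _ _ kernel_0])
  show "\<bar>kernel A\<bar> \<le> 4" for A using kernel_nonneg[of A] kernel_le[of A] by simp
qed simp_all

lemma integral_kernel: "(\<integral>A. kernel A \<partial>lborel) = 1"
proof -
  have "integrable (lborel \<Otimes>\<^sub>M lborel) (\<lambda>(x, y). bump x * bump y)"
    using integrable_kernel unfolding lborel_prod kernel_def by (simp add: case_prod_unfold)
  from lborel_pair.integral_fst[OF this, symmetric]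
  have "(\<integral>A. kernel A \<partial>lborel) = (LBINT x. LBINT y. bump x * bump y)"
    unfolding lborel_prod kernel_def by (simp add: case_prod_unfold)
  also have "\<dots> = 1" by (simp add: integral_bump)
  finally show ?thesis .
qed

text \<open>Averages over the square to the upper right of a point, so that no values from \<open>t < 0\<close> enter
  at points of the half plane.\<close>

definition avg :: "real \<Rightarrow> (real \<times> real \<Rightarrow> real) \<Rightarrow> real \<times> real \<Rightarrow> real" where
  "avg h w P = (\<integral>A. w (P + h *\<^sub>R A) * kernel A \<partial>lborel)"

lemma integral_affine_plane:
  fixes f :: "real \<times> real \<Rightarrow> real"
  assumes [measurable]: "f \<in> borel_measurable borel" and "h \<noteq> 0"
  shows "(\<integral>Q. f Q \<partial>lborel) = h\<^sup>2 * (\<integral>A. f (P + h *\<^sub>R A) \<partial>lborel)"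
proof -
  have "(\<integral>Q. f Q \<partial>lborel) = (\<integral>Q. f Q \<partial>(density (distr lborel borel (\<lambda>A. P + h *\<^sub>R A)) (\<lambda>_. ennreal (h\<^sup>2))))"
    using lborel_affine[OF \<open>h \<noteq> 0\<close>, of P] by (simp add: ennreal_power flip: power2_eq_square)
  also have "\<dots> = (\<integral>A. h\<^sup>2 *\<^sub>R f (P + h *\<^sub>R A) \<partial>lborel)"
    by (subst integral_density) (simp_all add: integral_distr)
  finally show ?thesis by simp
qed

lemma integral_shift_plane:
  fixes f :: "real \<times> real \<Rightarrow> real"
  assumes "f \<in> borel_measurable borel"
  shows "(\<integral>Q. f (Q + z) \<partial>lborel) = (\<integral>Q. f Q \<partial>lborel)"
  using integral_affine_plane[OF assms, of 1 z] by (simp add: add.commute)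

text \<open>The substitution Q = P + h A moves the base point from the merely measurable
  \<open>w\<close> into the smooth kernel. In this form averages appear as derivatives of the
  mollified potential, and their continuity becomes visible.\<close>

lemma avg_kernel:
  assumes [measurable]: "w \<in> borel_measurable borel" and "h > 0"
  shows "avg h w (x, t) = (\<integral>Q. w Q * (bump ((fst Q - x) / h) / h * (bump ((snd Q - t) / h) / h)) \<partial>lborel)"
proof -
  have "(\<integral>Q. w Q * (bump ((fst Q - x) / h) / h * (bump ((snd Q - t) / h) / h)) \<partial>lborel) =
      h\<^sup>2 * (\<integral>A. w ((x, t) + h *\<^sub>R A) * (bump (fst A) / h * (bump (snd A) / h)) \<partial>lborel)"
    using assms(2) by (subst integral_affine_plane[of _ h "(x, t)"]) simp_all
  also have "\<dots> = h\<^sup>2 * ((\<integral>A. w ((x, t) + h *\<^sub>R A) * kernel A \<partial>lborel) / h\<^sup>2)"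
    unfolding kernel_def by (simp add: power2_eq_square flip: integral_divide_zero)
  finally show ?thesis using assms(2) by (simp add: avg_def)
qed

lemma integrable_avg:
  assumes [measurable]: "w \<in> borel_measurable borel" and "\<And>P. \<bar>w P\<bar> \<le> B"
  shows "integrable lborel (\<lambda>A. w (P + h *\<^sub>R A) * kernel A)"
proof (rule integrable_rect[of _ "B * 4" 0 1 0 1])
  have "0 \<le> B" using assms(2) abs_ge_zero order_trans by blast
  then show "\<bar>w (P + h *\<^sub>R A) * kernel A\<bar> \<le> B * 4" for A
    unfolding abs_mult by (intro mult_mono assms) (use kernel_nonneg kernel_le in auto)
qed (auto simp: kernel_0 simp del: mem_Times_iff)

lemma avg_mono:
  assumes "w \<in> borel_measurable borel" "\<And>P. \<bar>w P\<bar> \<le> B"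
    "w' \<in> borel_measurable borel" "\<And>P. \<bar>w' P\<bar> \<le> B'"
    and "\<And>A. A \<in> {0..1} \<times> {0..1} \<Longrightarrow> w (P + h *\<^sub>R A) \<le> w' (P + h *\<^sub>R A)"
  shows "avg h w P \<le> avg h w' P"
  unfolding avg_def
proof (rule integral_mono[OF integrable_avg[OF assms(1,2)] integrable_avg[OF assms(3,4)]])
  show "w (P + h *\<^sub>R A) * kernel A \<le> w' (P + h *\<^sub>R A) * kernel A" for A
    using assms(5)[of A] kernel_nonneg[of A] kernel_0[of A] by (cases "A \<in> {0..1} \<times> {0..1}") (auto intro: mult_right_mono simp del: mem_Times_iff)
qed

lemma avg_const: "avg h (\<lambda>_. c) P = c"
  unfolding avg_def by (simp add: integral_kernel)

lemma avg_add:
  assumes "w \<in> borel_measurable borel" "\<And>P. \<bar>w P\<bar> \<le> B"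
    "w' \<in> borel_measurable borel" "\<And>P. \<bar>w' P\<bar> \<le> B'"
  shows "avg h (\<lambda>P. w P + w' P) P = avg h w P + avg h w' P"
  unfolding avg_def using integrable_avg[OF assms(1,2)] integrable_avg[OF assms(3,4)]
  by (simp add: distrib_right)

lemma avg_cmult: "avg h (\<lambda>P. c * w P) P = c * avg h w P"
  unfolding avg_def by (simp add: mult.assoc)

lemma abs_avg_le:
  assumes "w \<in> borel_measurable borel" "\<And>P. \<bar>w P\<bar> \<le> B"
  shows "\<bar>avg h w P\<bar> \<le> B"
proof -
  have "\<bar>c\<bar> = c" if "c = B" for c using assms(2)[of undefined] that by linarith
  then have B: "\<bar>B\<bar> \<le> B" by simp
  have "avg h w P \<le> avg h (\<lambda>_. B) P" by (rule avg_mono[OF assms, of _ B]) (use assms(2) B in \<open>auto simp: abs_le_iff\<close>)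
  moreover have "avg h (\<lambda>_. - B) P \<le> avg h w P" by (rule avg_mono[of _ B, OF _ _ assms]) (use assms(2) B in \<open>auto simp: abs_le_iff minus_le_iff\<close>)
  ultimately show ?thesis by (simp add: avg_const abs_le_iff)
qed

text \<open>A measurable function is an almost everywhere limit of continuous ones. Truncating these
  at \<open>B\<close> makes them uniformly bounded, for dominated convergence, and does not change
  the limit, which obeys the same bound.\<close>

lemma continuous_approximation:
  fixes w :: "real \<times> real \<Rightarrow> real"
  assumes w: "w \<in> borel_measurable borel" and B: "\<And>P. \<bar>w P\<bar> \<le> B"
  obtains G where "\<And>n. continuous_on UNIV (G n)" "\<And>n P. \<bar>G n P\<bar> \<le> B"
    "AE P in lborel. (\<lambda>n. G n P) \<longlonglongrightarrow> w P"
proof -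
  have "w \<in> borel_measurable (lebesgue_on UNIV)" using measurable_completion[of w lborel borel] w by simp
  then have "w measurable_on UNIV" by (simp add: measurable_on_iff_borel_measurable)
  then obtain N g where N: "negligible N" and g: "\<And>n. continuous_on UNIV (g n)"
    and lim: "\<And>P. P \<notin> N \<Longrightarrow> (\<lambda>n. g n P) \<longlonglongrightarrow> w P"
    unfolding measurable_on_def by auto
  have B0: "0 \<le> B" using B abs_ge_zero order_trans by blast
  show thesis
  proof (rule that[of "\<lambda>n P. max (- B) (min B (g n P))"])
    show "continuous_on UNIV (\<lambda>P. max (- B) (min B (g n P)))" for n
      by (intro continuous_intros g)
    show "\<bar>max (- B) (min B (g n P))\<bar> \<le> B" for n P using B0 by auto
    have "AE P in lebesgue. P \<notin> N" using N by (auto simp: negligible_iff_null_sets intro: AE_not_in)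
    then have "AE P in lebesgue. (\<lambda>n. max (- B) (min B (g n P))) \<longlonglongrightarrow> w P"
    proof eventually_elim
      case (elim P)
      have "(\<lambda>n. max (- B) (min B (g n P))) \<longlonglongrightarrow> max (- B) (min B (w P))"
        by (intro tendsto_intros lim elim)
      moreover have "max (- B) (min B (w P)) = w P" using B[of P] by auto
      ultimately show ?case by simp
    qed
    then show "AE P in lborel. (\<lambda>n. max (- B) (min B (g n P))) \<longlonglongrightarrow> w P"
      by (simp add: AE_completion_iff)
  qed
qed

text \<open>An argument with three errors: a continuous \<open>G m\<close> is close to
  \<open>w\<close>, and its own translates converge pointwise. The approximation is measured on the
  rectangle enlarged by 1, which contains the translated points as soon as |z n| < 1; translation
  invariance then gives the shifted error the same size.\<close>

lemma tendsto_L1_translate: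
  fixes w :: "real \<times> real \<Rightarrow> real"
  assumes w[measurable]: "w \<in> borel_measurable borel" and B: "\<And>P. \<bar>w P\<bar> \<le> B" and z: "z \<longlonglongrightarrow> 0"
  shows "(\<lambda>n. \<integral>P. indicator ({a..b} \<times> {c..d}) P * \<bar>w (P + z n) - w P\<bar> \<partial>lborel) \<longlonglongrightarrow> 0"
proof (rule LIMSEQ_I)
  fix e :: real assume "0 < e"
  let ?R = "{a..b} \<times> {c..d} :: (real \<times> real) set" and ?S = "{a-1..b+1} \<times> {c-1..d+1} :: (real \<times> real) set"
  have B0: "0 \<le> B" using B abs_ge_zero order_trans by blast
  have fin: "integrable lborel (\<lambda>P. indicator ?S P * (f P :: real))" "integrable lborel (\<lambda>P. indicator ?R P * (f P :: real))"
    if [measurable]: "f \<in> borel_measurable borel" and "\<And>P. \<bar>f P\<bar> \<le> 2 * B" for f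
  proof -
    show "integrable lborel (\<lambda>P. indicator ?S P * (f P :: real))"
      by (rule integrable_rect[of _ "2 * B" "a-1" "b+1" "c-1" "d+1"])
        (use that B0 in \<open>auto simp: indicator_def simp del: mem_Times_iff\<close>)
    show "integrable lborel (\<lambda>P. indicator ?R P * (f P :: real))"
      by (rule integrable_rect[of _ "2 * B" a b c d])
        (use that B0 in \<open>auto simp: indicator_def simp del: mem_Times_iff\<close>)
  qed
  obtain G where Gc: "\<And>n. continuous_on UNIV (G n)" and GB: "\<And>n P. \<bar>G n P\<bar> \<le> B"
    and Glim: "AE P in lborel. (\<lambda>n. G n P) \<longlonglongrightarrow> w P"
    using continuous_approximation[OF w B] by metis
  have [measurable]: "G n \<in> borel_measurable borel" for n
    by (rule borel_measurable_continuous_onI[OF Gc])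
  have diff: "\<bar>\<bar>f P - g Q\<bar>\<bar> \<le> 2 * B" if "\<And>P. \<bar>f P\<bar> \<le> B" "\<And>P. \<bar>g P\<bar> \<le> B" for f g :: "real \<times> real \<Rightarrow> real" and P Q
    using that(1)[of P] that(2)[of Q] by linarith
  have "(\<lambda>n. \<integral>P. indicator ?S P * \<bar>w P - G n P\<bar> \<partial>lborel) \<longlonglongrightarrow> (\<integral>P. 0 \<partial>(lborel :: (real \<times> real) measure))"
  proof (rule integral_dominated_convergence)
    show "integrable lborel (\<lambda>P. indicator ?S P * (2 * B))" by (rule fin) (use B0 in auto)
    show "AE P in lborel. (\<lambda>n. indicator ?S P * \<bar>w P - G n P\<bar>) \<longlonglongrightarrow> 0" using Glim
    proof eventually_elim
      case (elim P)
      have "(\<lambda>n. indicator ?S P * \<bar>w P - G n P\<bar>) \<longlonglongrightarrow> indicator ?S P * \<bar>w P - w P\<bar>"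
        by (intro tendsto_intros elim)
      then show ?case by simp
    qed
    show "AE P in lborel. norm (indicator ?S P * \<bar>w P - G n P\<bar>) \<le> indicator ?S P * (2 * B)" for n
      using diff[of w "G n", OF B GB] by (auto simp: indicator_def)
  qed simp_all
  then have "eventually (\<lambda>n. (\<integral>P. indicator ?S P * \<bar>w P - G n P\<bar> \<partial>lborel) < e / 3) sequentially"
    using \<open>0 < e\<close> by (intro order_tendstoD(2)[where y = 0]) simp_all
  then obtain m where m: "(\<integral>P. indicator ?S P * \<bar>w P - G m P\<bar> \<partial>lborel) < e / 3"
    by (auto simp: eventually_sequentially)
  have "(\<lambda>n. \<integral>P. indicator ?R P * \<bar>G m (P + z n) - G m P\<bar> \<partial>lborel) \<longlonglongrightarrow> (\<integral>P. 0 \<partial>(lborel :: (real \<times> real) measure))"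
  proof (rule integral_dominated_convergence)
    show "integrable lborel (\<lambda>P. indicator ?R P * (2 * B))" by (rule fin) (use B0 in auto)
    show "AE P in lborel. (\<lambda>n. indicator ?R P * \<bar>G m (P + z n) - G m P\<bar>) \<longlonglongrightarrow> 0"
    proof (rule AE_I2)
      fix P
      have "isCont (G m) P" using Gc[of m] continuous_on_eq_continuous_at[OF open_UNIV] by blast
      moreover have "(\<lambda>n. P + z n) \<longlonglongrightarrow> P" using tendsto_add[OF tendsto_const z, of P] by simp
      ultimately have "(\<lambda>n. G m (P + z n)) \<longlonglongrightarrow> G m P" by (rule isCont_tendsto_compose)
      then have "(\<lambda>n. indicator ?R P * \<bar>G m (P + z n) - G m P\<bar>) \<longlonglongrightarrow> indicator ?R P * \<bar>G m P - G m P\<bar>"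
        by (intro tendsto_intros)
      then show "(\<lambda>n. indicator ?R P * \<bar>G m (P + z n) - G m P\<bar>) \<longlonglongrightarrow> 0" by simp
    qed
    show "AE P in lborel. norm (indicator ?R P * \<bar>G m (P + z n) - G m P\<bar>) \<le> indicator ?R P * (2 * B)" for n
      using diff[of "G m" "G m", OF GB GB] by (auto simp: indicator_def)
  qed simp_all
  then have "eventually (\<lambda>n. (\<integral>P. indicator ?R P * \<bar>G m (P + z n) - G m P\<bar> \<partial>lborel) < e / 3) sequentially"
    using \<open>0 < e\<close> by (intro order_tendstoD(2)[where y = 0]) simp_all
  moreover have "eventually (\<lambda>n. dist (z n) 0 < 1) sequentially" using z by (rule tendstoD) simp
  ultimately have "eventually (\<lambda>n. norm ((\<integral>P. indicator ?R P * \<bar>w (P + z n) - w P\<bar> \<partial>lborel) - 0) < e) sequentially"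
  proof eventually_elim
    case (elim n)
    let ?D = "\<lambda>P. indicator ?S P * \<bar>w P - G m P\<bar>"
    have D: "integrable lborel ?D" by (rule fin) (use diff[of w "G m", OF B GB] in auto)
    have Dz: "integrable lborel (\<lambda>P. ?D (P + z n))"
    proof (rule integrable_rect[of _ "2 * B" "a-1 - fst (z n)" "b+1 - fst (z n)" "c-1 - snd (z n)" "d+1 - snd (z n)"])
      show "\<bar>?D (P + z n)\<bar> \<le> 2 * B" for P using diff[of w "G m", OF B GB, of "P + z n"] B0 by (auto simp: indicator_def)
      show "?D (P + z n) = 0" if "P \<notin> {a-1 - fst (z n)..b+1 - fst (z n)} \<times> {c-1 - snd (z n)..d+1 - snd (z n)}" for P
        using that by (cases P; cases "z n") (auto simp: indicator_def)
    qed simp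
    have Gd: "integrable lborel (\<lambda>P. indicator ?R P * \<bar>G m (P + z n) - G m P\<bar>)"
      by (rule fin) (use diff[of "G m" "G m", OF GB GB] in auto)
    have wd: "integrable lborel (\<lambda>P. indicator ?R P * \<bar>w (P + z n) - w P\<bar>)"
      by (rule fin) (use diff[of w w, OF B B] in auto)
    have "(\<integral>P. indicator ?R P * \<bar>w (P + z n) - w P\<bar> \<partial>lborel)
        \<le> (\<integral>P. ?D (P + z n) + indicator ?R P * \<bar>G m (P + z n) - G m P\<bar> + ?D P \<partial>lborel)"
    proof (rule integral_mono[OF wd])
      show "integrable lborel (\<lambda>P. ?D (P + z n) + indicator ?R P * \<bar>G m (P + z n) - G m P\<bar> + ?D P)"
        by (intro Bochner_Integration.integrable_add Dz Gd D)
      fix P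
      have "\<bar>fst (z n)\<bar> \<le> 1" "\<bar>snd (z n)\<bar> \<le> 1"
        using elim(2) norm_fst_le[of "fst (z n)" "snd (z n)"] norm_snd_le[of "snd (z n)" "fst (z n)"]
        by (auto simp: dist_norm)
      then have "P \<in> ?S \<and> P + z n \<in> ?S" if "P \<in> ?R" using that by (cases P; cases "z n") (auto simp: abs_le_iff)
      then show "indicator ?R P * \<bar>w (P + z n) - w P\<bar> \<le> ?D (P + z n) + indicator ?R P * \<bar>G m (P + z n) - G m P\<bar> + ?D P"
        unfolding indicator_def by auto
    qed
    also have "\<dots> = (\<integral>P. ?D (P + z n) \<partial>lborel) + (\<integral>P. indicator ?R P * \<bar>G m (P + z n) - G m P\<bar> \<partial>lborel) + (\<integral>P. ?D P \<partial>lborel)"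
      using Dz Gd D by simp
    also have "(\<integral>P. ?D (P + z n) \<partial>lborel) = (\<integral>P. ?D P \<partial>lborel)" by (rule integral_shift_plane) measurable
    finally have "(\<integral>P. indicator ?R P * \<bar>w (P + z n) - w P\<bar> \<partial>lborel) < e" using elim(1) m by linarith
    moreover have "0 \<le> (\<integral>P. indicator ?R P * \<bar>w (P + z n) - w P\<bar> \<partial>lborel)" by (rule integral_nonneg_AE) simp
    ultimately show ?case by simp
  qed
  then show "\<exists>no. \<forall>n\<ge>no. norm ((\<integral>P. indicator ?R P * \<bar>w (P + z n) - w P\<bar> \<partial>lborel) - 0) < e"
    by (simp add: eventually_sequentially)
qed

text \<open>By Fubini the error of the average is at most the kernel-weighted mean over the offsets
  \<open>A\<close> of the translation errors \<open>om n A\<close>. Each of these tends to 0 and all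
  are bounded, so dominated convergence in \<open>A\<close> applies.\<close>

lemma tendsto_L1_avg:
  fixes w :: "real \<times> real \<Rightarrow> real"
  assumes w[measurable]: "w \<in> borel_measurable borel" and B: "\<And>P. \<bar>w P\<bar> \<le> B" and h: "h \<longlonglongrightarrow> 0"
  shows "(\<lambda>n. \<integral>P. indicator ({a..b} \<times> {c..d}) P * \<bar>avg (h n) w P - w P\<bar> \<partial>lborel) \<longlonglongrightarrow> 0"
proof -
  let ?R = "{a..b} \<times> {c..d} :: (real \<times> real) set"
  have B0: "0 \<le> B" using B abs_ge_zero order_trans by blast
  have diff: "\<bar>w P - w Q\<bar> \<le> 2 * B" for P Q using B[of P] B[of Q] by linarith
  define H where "H n = (\<lambda>(P, A). indicator ?R P * \<bar>w (P + h n *\<^sub>R A) - w P\<bar> * kernel A)" for n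
  have [measurable]: "H n \<in> borel_measurable borel" for n
  proof -
    have [measurable]: "(fst :: (real \<times> real) \<times> real \<times> real \<Rightarrow> _) \<in> borel_measurable borel"
      "(snd :: (real \<times> real) \<times> real \<times> real \<Rightarrow> _) \<in> borel_measurable borel"
      by (intro borel_measurable_continuous_onI continuous_intros)+
    show ?thesis unfolding H_def case_prod_unfold by measurable
  qed
  have HB: "\<bar>H n X\<bar> \<le> 2 * B * 4" for n X
  proof -
    have "\<bar>kernel (snd X)\<bar> \<le> 4" using kernel_nonneg[of "snd X"] kernel_le[of "snd X"] by simp
    then have "\<bar>indicator ?R (fst X) * \<bar>w (fst X + h n *\<^sub>R snd X) - w (fst X)\<bar>\<bar> * \<bar>kernel (snd X)\<bar> \<le> 2 * B * 4"
      by (intro mult_mono) (use diff B0 in \<open>auto simp: indicator_def\<close>)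
    then show ?thesis by (simp add: H_def case_prod_unfold abs_mult)
  qed
  have Hint: "integrable (lborel \<Otimes>\<^sub>M lborel) (H n)" for n
    unfolding lborel_prod
  proof (rule integrableI_bounded_set[of "?R \<times> ({0..1} \<times> {0..1})" _ _ "2 * B * 4"])
    show "(?R \<times> ({0..1} \<times> {0..1}) :: ((real \<times> real) \<times> real \<times> real) set) \<in> sets lborel"
      unfolding sets_lborel by (intro borel_closed closed_Times closed_atLeastAtMost)
    have "bounded (?R \<times> ({0..1} \<times> {0..1}) :: ((real \<times> real) \<times> real \<times> real) set)" by (intro bounded_Times) auto
    then show "emeasure lborel (?R \<times> ({0..1} \<times> {0..1}) :: ((real \<times> real) \<times> real \<times> real) set) < \<infinity>" by (rule emeasure_bounded_finite)
    show "AE X in lborel. X \<notin> ?R \<times> ({0..1} \<times> {0..1}) \<longrightarrow> H n X = 0"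
    proof (rule AE_I2, rule impI)
      fix X :: "(real \<times> real) \<times> real \<times> real" assume X: "X \<notin> ?R \<times> ({0..1} \<times> {0..1})"
      obtain P A where PA: "X = (P, A)" by (cases X)
      from X PA have "P \<notin> ?R \<or> A \<notin> {0..1} \<times> {0..1}" by blast
      then show "H n X = 0" 
      proof
        assume "P \<notin> ?R" then show ?thesis unfolding PA H_def by (simp del: mem_Times_iff)
      next
        assume "A \<notin> {0..1} \<times> {0..1}" then show ?thesis unfolding PA H_def using kernel_0 by simp
      qed
    qed
  qed (use HB in auto)
  define om where "om n A = (\<integral>P. indicator ?R P * \<bar>w (P + h n *\<^sub>R A) - w P\<bar> \<partial>lborel)" for n A
  have om_eq: "om n A * kernel A = (\<integral>P. H n (P, A) \<partial>lborel)" for n A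
    unfolding om_def H_def by simp
  have om_le: "\<bar>om n A\<bar> \<le> 2 * B * ((max a b - a) * (max c d - c))" for n A
    unfolding om_def by (rule abs_integral_rect) (use diff B0 in \<open>auto simp: indicator_def simp del: mem_Times_iff\<close>)
  have lim: "(\<lambda>n. \<integral>A. om n A * kernel A \<partial>lborel) \<longlonglongrightarrow> (\<integral>A. 0 \<partial>(lborel :: (real \<times> real) measure))"
  proof (rule integral_dominated_convergence)
    show "(\<lambda>A. om n A * kernel A) \<in> borel_measurable lborel" for n
      unfolding om_eq using Hint[of n, THEN borel_measurable_integrable] by measurable
    show "integrable lborel (\<lambda>A. 2 * B * ((max a b - a) * (max c d - c)) * kernel A)"
      using integrable_kernel by simp
    show "AE A in lborel. (\<lambda>n. om n A * kernel A) \<longlonglongrightarrow> 0"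
    proof (rule AE_I2)
      fix A :: "real \<times> real"
      have "(\<lambda>n. h n *\<^sub>R A) \<longlonglongrightarrow> 0" using tendsto_scaleR[OF h, of "\<lambda>_. A" A] by simp
      from tendsto_L1_translate[OF w B this] have "(\<lambda>n. om n A) \<longlonglongrightarrow> 0" unfolding om_def .
      then show "(\<lambda>n. om n A * kernel A) \<longlonglongrightarrow> 0" by (rule tendsto_mult_left_zero)
    qed
    show "AE A in lborel. norm (om n A * kernel A) \<le> 2 * B * ((max a b - a) * (max c d - c)) * kernel A" for n
      by (rule AE_I2) (use om_le kernel_nonneg in \<open>auto simp: abs_mult intro!: mult_right_mono\<close>)
  qed simp_all
  show ?thesis
  proof (rule Lim_null_comparison[of _ "\<lambda>n. \<integral>A. om n A * kernel A \<partial>lborel"])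
    show "(\<lambda>n. \<integral>A. om n A * kernel A \<partial>lborel) \<longlonglongrightarrow> 0" using lim by simp
    show "eventually (\<lambda>n. norm (\<integral>P. indicator ?R P * \<bar>avg (h n) w P - w P\<bar> \<partial>lborel) \<le> (\<integral>A. om n A * kernel A \<partial>lborel)) sequentially"
    proof (rule always_eventually, rule allI)
      fix n
      have Hfst: "integrable lborel (\<lambda>P. \<integral>A. H n (P, A) \<partial>lborel)"
        using lborel_pair.integrable_fst'[OF Hint[of n]] .
      have "norm (\<integral>P. indicator ?R P * \<bar>avg (h n) w P - w P\<bar> \<partial>lborel) = (\<integral>P. indicator ?R P * \<bar>avg (h n) w P - w P\<bar> \<partial>lborel)"
        by (simp add: integral_nonneg_AE)
      also have "\<dots> \<le> (\<integral>P. (\<integral>A. H n (P, A) \<partial>lborel) \<partial>lborel)"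
      proof (rule integral_mono'[OF Hfst])
        show "0 \<le> (\<integral>A. H n (P, A) \<partial>lborel)" for P
          by (rule integral_nonneg_AE) (simp add: H_def kernel_nonneg)
        show "indicator ?R P * \<bar>avg (h n) w P - w P\<bar> \<le> (\<integral>A. H n (P, A) \<partial>lborel)" for P
        proof -
          have "avg (h n) w P - w P = (\<integral>A. w (P + h n *\<^sub>R A) * kernel A \<partial>lborel) - (\<integral>A. w P * kernel A \<partial>lborel)"
            by (simp add: avg_def integral_kernel)
          also have "\<dots> = (\<integral>A. (w (P + h n *\<^sub>R A) - w P) * kernel A \<partial>lborel)"
            using integrable_avg[OF w B] integrable_kernel by (simp add: left_diff_distrib)
          finally have "\<bar>avg (h n) w P - w P\<bar> \<le> (\<integral>A. \<bar>(w (P + h n *\<^sub>R A) - w P) * kernel A\<bar> \<partial>lborel)"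
            using integral_abs_bound by simp
          also have "\<dots> = (\<integral>A. \<bar>w (P + h n *\<^sub>R A) - w P\<bar> * kernel A \<partial>lborel)"
            by (simp add: abs_mult kernel_nonneg)
          finally have "indicator ?R P * \<bar>avg (h n) w P - w P\<bar> \<le> indicator ?R P * (\<integral>A. \<bar>w (P + h n *\<^sub>R A) - w P\<bar> * kernel A \<partial>lborel)"
            by (rule mult_left_mono) simp
          also have "\<dots> = (\<integral>A. H n (P, A) \<partial>lborel)" by (simp add: H_def mult.assoc)
          finally show ?thesis .
        qed
      qed
      also have "\<dots> = (\<integral>A. (\<integral>P. H n (P, A) \<partial>lborel) \<partial>lborel)"
        using lborel_pair.Fubini_integral[of "\<lambda>P A. H n (P, A)"] Hint[of n] by simp
      finally show "norm (\<integral>P. indicator ?R P * \<bar>avg (h n) w P - w P\<bar> \<partial>lborel) \<le> (\<integral>A. om n A * kernel A \<partial>lborel)"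
        by (simp add: om_eq)
    qed
  qed
qed

section \<open>Potentials of balance laws\<close>

text \<open>The partial derivatives are explicit and live on the whole plane. Vanishing far out is
  demanded only for t \<ge> 0, because the kernels inserted later contain a factor
  \<open>1 - step\<close> in time, which stays equal to 1 in the past.\<close>

definition C1_test :: "(real \<times> real \<Rightarrow> real) \<Rightarrow> (real \<times> real \<Rightarrow> real) \<Rightarrow> (real \<times> real \<Rightarrow> real) \<Rightarrow> bool" where
  "C1_test \<phi> \<phi>x \<phi>t \<longleftrightarrow>
     (\<forall>x t. ((\<lambda>y. \<phi> (y, t)) has_real_derivative \<phi>x (x, t)) (at x)) \<and>
     (\<forall>x t. ((\<lambda>s. \<phi> (x, s)) has_real_derivative \<phi>t (x, t)) (at t)) \<and>
     continuous_on UNIV \<phi>x \<and> continuous_on UNIV \<phi>t \<and>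
     (\<exists>R. \<forall>x t. 0 \<le> t \<longrightarrow> R < \<bar>x\<bar> \<or> R < t \<longrightarrow> \<phi> (x, t) = 0)"

text \<open>Existence of one partial derivative and continuity of the other give the total
  derivative. Writing it as an inner product with the gradient makes its continuity in operator norm
  a matter of bounded linearity.\<close>

lemma C1_test_has_derivative:
  assumes "C1_test \<phi> \<phi>x \<phi>t"
  shows "(\<phi> has_derivative blinfun_apply (blinfun_inner_right (\<phi>x P, \<phi>t P))) (at P within S)"
proof -
  obtain x t where P: "P = (x, t)" by (cases P)
  have "((\<lambda>(x, y). (\<lambda>x y. \<phi> (x, y)) x y) has_derivative (\<lambda>(tx, ty). \<phi>x (x, t) * tx + (\<lambda>x y. blinfun_mult_right (\<phi>t (x, y))) x t ty)) (at (x, t) within UNIV \<times> UNIV)"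
  proof (rule has_derivative_partialsI)
    show "((\<lambda>x. \<phi> (x, t)) has_derivative (*) (\<phi>x (x, t))) (at x within UNIV)"
      using assms unfolding C1_test_def has_field_derivative_def by simp
    show "((\<lambda>y. \<phi> (x, y)) has_derivative blinfun_apply (blinfun_mult_right (\<phi>t (x, y)))) (at y within UNIV)" for x y
      using assms unfolding C1_test_def has_field_derivative_def by simp
    have "continuous_on UNIV (\<lambda>P. blinfun_mult_right (\<phi>t P))"
      using assms unfolding C1_test_def
      by (intro bounded_linear.continuous_on[OF bounded_linear_blinfun_mult_right]) auto
    then have "isCont (\<lambda>P. blinfun_mult_right (\<phi>t P)) (x, t)"
      using continuous_on_eq_continuous_at[OF open_UNIV] by blast
    then show "continuous (at (x, t) within UNIV \<times> UNIV) (\<lambda>(x, y). blinfun_mult_right (\<phi>t (x, y)))"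
      by (simp add: case_prod_unfold)
  qed auto
  then have "(\<phi> has_derivative (\<lambda>(tx, ty). \<phi>x P * tx + \<phi>t P * ty)) (at P)" by (simp add: P case_prod_unfold)
  moreover have "blinfun_apply (blinfun_inner_right (\<phi>x P, \<phi>t P)) = (\<lambda>(tx, ty). \<phi>x P * tx + \<phi>t P * ty)"
    by (auto simp: fun_eq_iff)
  ultimately show ?thesis by (simp add: has_derivative_at_withinI)
qed

lemma C1_test_imp_test_function:
  assumes "C1_test \<phi> \<phi>x \<phi>t"
  shows "\<phi> \<in> test_functions" "dx \<phi> x t = \<phi>x (x, t)" "dt \<phi> x t = \<phi>t (x, t)"
proof -
  have "continuous_on half_plane (\<lambda>P. blinfun_inner_right (\<phi>x P, \<phi>t P))"
    using assms unfolding C1_test_def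
    by (intro bounded_linear.continuous_on[OF bounded_linear_blinfun_inner_right] continuous_intros)
      (auto intro: continuous_on_subset)
  moreover obtain R where R: "\<And>x t. 0 \<le> t \<Longrightarrow> R < \<bar>x\<bar> \<or> R < t \<Longrightarrow> \<phi> (x, t) = 0"
    using assms unfolding C1_test_def by metis
  have "support_on half_plane \<phi> \<subseteq> {- R..R} \<times> {0..R}"
  proof
    fix P assume P: "P \<in> support_on half_plane \<phi>"
    obtain x t where xt: "P = (x, t)" by (cases P)
    with P have "0 \<le> t" "\<phi> (x, t) \<noteq> 0" by (auto simp: support_on_def half_plane_def)
    moreover from this R[of t x] have "\<not> R < \<bar>x\<bar>" "\<not> R < t" by blast+
    ultimately show "P \<in> {- R..R} \<times> {0..R}" by (auto simp: xt not_less abs_le_iff)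
  qed
  then have "bounded (support_on half_plane \<phi>)" by (rule bounded_subset[rotated]) (intro bounded_Times, auto)
  then have "compact (closure (support_on half_plane \<phi>))" by simp
  ultimately show "\<phi> \<in> test_functions"
    using C1_test_has_derivative[OF assms] unfolding test_functions_def mem_Collect_eq
    by (intro conjI exI[of _ "\<lambda>P. blinfun_inner_right (\<phi>x P, \<phi>t P)"]) auto
  show "dx \<phi> x t = \<phi>x (x, t)" "dt \<phi> x t = \<phi>t (x, t)"
    using assms unfolding C1_test_def dx_def dt_def by (auto intro: DERIV_imp_deriv)
qed

text \<open>With a remainder of order d^2 and an integrable weight the error of the difference
  quotient is at most |d| times a fixed integral, which replaces dominated convergence. The
  restriction |d| \<le> 1 allows a weight supported in a fixed bounded set.\<close>

lemma DERIV_integral: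
  fixes f :: "real \<Rightarrow> 'a \<Rightarrow> real"
  assumes int: "\<And>y. integrable M (f y)" "integrable M f'" "integrable M g"
    and bound: "\<And>d \<omega>. \<bar>d\<bar> \<le> 1 \<Longrightarrow> \<bar>f (x + d) \<omega> - f x \<omega> - d * f' \<omega>\<bar> \<le> d\<^sup>2 * g \<omega>"
  shows "((\<lambda>y. \<integral>\<omega>. f y \<omega> \<partial>M) has_real_derivative (\<integral>\<omega>. f' \<omega> \<partial>M)) (at x)"
proof -
  let ?F = "\<lambda>y. \<integral>\<omega>. f y \<omega> \<partial>M" and ?G = "\<integral>\<omega>. g \<omega> \<partial>M"
  have est: "\<bar>(?F (x + d) - ?F x) / d - (\<integral>\<omega>. f' \<omega> \<partial>M)\<bar> \<le> \<bar>d\<bar> * ?G" if "\<bar>d\<bar> \<le> 1" "d \<noteq> 0" for d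
  proof -
    have "?F (x + d) - ?F x - d * (\<integral>\<omega>. f' \<omega> \<partial>M) = (\<integral>\<omega>. f (x + d) \<omega> - f x \<omega> - d * f' \<omega> \<partial>M)"
      using int by simp
    also have "\<bar>\<dots>\<bar> \<le> (\<integral>\<omega>. d\<^sup>2 * g \<omega> \<partial>M)"
      using int bound[OF that(1)] by (intro order_trans[OF integral_abs_bound] integral_mono) auto
    finally have "\<bar>?F (x + d) - ?F x - d * (\<integral>\<omega>. f' \<omega> \<partial>M)\<bar> \<le> \<bar>d\<bar> * (\<bar>d\<bar> * ?G)" using int by (simp add: power2_eq_square)
    moreover have "(?F (x + d) - ?F x) / d - (\<integral>\<omega>. f' \<omega> \<partial>M) = (?F (x + d) - ?F x - d * (\<integral>\<omega>. f' \<omega> \<partial>M)) / d"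
      using that(2) by (simp add: field_simps)
    ultimately show ?thesis using that(2) by (simp add: abs_divide pos_divide_le_eq mult.commute)
  qed
  have "(\<lambda>d. (?F (x + d) - ?F x) / d - (\<integral>\<omega>. f' \<omega> \<partial>M)) \<midarrow>0\<rightarrow> 0"
  proof (rule Lim_null_comparison[of _ "\<lambda>d. \<bar>d\<bar> * ?G"])
    show "\<forall>\<^sub>F d in at 0. norm ((?F (x + d) - ?F x) / d - (\<integral>\<omega>. f' \<omega> \<partial>M)) \<le> \<bar>d\<bar> * ?G"
      unfolding eventually_at by (rule exI[of _ 1]) (use est in auto)
    have "(\<lambda>d. \<bar>d\<bar> * ?G) \<midarrow>0\<rightarrow> \<bar>0\<bar> * ?G" by (intro tendsto_intros)
    then show "(\<lambda>d. \<bar>d\<bar> * ?G) \<midarrow>0\<rightarrow> 0" by simp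
  qed
  then show ?thesis unfolding DERIV_def by (rule LIM_zero_cancel)
qed

lemma bump_scaled_taylor:
  assumes "0 < h"
  shows "\<bar>bump ((y - (x + d)) / h) / h - bump ((y - x) / h) / h - d * (- dbump ((y - x) / h) / h\<^sup>2)\<bar> \<le> d\<^sup>2 * (420 / h^3)"
proof -
  have shift: "(y - (x + d)) / h = (y - x) / h + (- d / h)" by (simp add: add_divide_distrib diff_divide_distrib)
  have "bump ((y - (x + d)) / h) / h - bump ((y - x) / h) / h - d * (- dbump ((y - x) / h) / h\<^sup>2)
     = (bump ((y - x) / h + (- d / h)) - bump ((y - x) / h) - (- d / h) * dbump ((y - x) / h)) / h"
    unfolding shift by (simp add: diff_divide_distrib add_divide_distrib power2_eq_square)
  also have "\<bar>\<dots>\<bar> \<le> (420 * (- d / h)\<^sup>2) / h"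
    unfolding abs_divide using bump_taylor[of "(y - x) / h" "- d / h"] assms by (simp add: divide_right_mono)
  also have "\<dots> = d\<^sup>2 * (420 / h^3)" using assms by (simp add: field_simps power2_eq_square power3_eq_cube)
  finally show ?thesis .
qed

lemma step_scaled_taylor:
  assumes "0 < h"
  shows "\<bar>step ((y - (x + d)) / h) - step ((y - x) / h) - d * (- bump ((y - x) / h) / h)\<bar> \<le> d\<^sup>2 * (60 / h\<^sup>2)"
proof -
  have shift: "(y - (x + d)) / h = (y - x) / h + (- d / h)" by (simp add: add_divide_distrib diff_divide_distrib)
  have "step ((y - (x + d)) / h) - step ((y - x) / h) - d * (- bump ((y - x) / h) / h)
     = step ((y - x) / h + (- d / h)) - step ((y - x) / h) - (- d / h) * bump ((y - x) / h)"
    unfolding shift by simp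
  also have "\<bar>\<dots>\<bar> \<le> 60 * (- d / h)\<^sup>2" by (rule step_taylor)
  also have "\<dots> = d\<^sup>2 * (60 / h\<^sup>2)" by (simp add: power_divide)
  finally show ?thesis .
qed

lemma scaled_0:
  assumes "0 < h" "y \<notin> {x..x + h}"
  shows "bump ((y - x) / h) = 0" "dbump ((y - x) / h) = 0"
  using assms by (auto intro!: bump_0 dbump_0 simp: field_simps)

lemma step_scaled:
  assumes "0 < h"
  shows "y \<le> x \<Longrightarrow> step ((y - x) / h) = 0" "x + h \<le> y \<Longrightarrow> step ((y - x) / h) = 1"
  using assms by (auto intro!: step_0 step_1 simp: field_simps)

lemma DERIV_bump_scaled: "h \<noteq> 0 \<Longrightarrow> ((\<lambda>y. bump ((y - x) / h) / h) has_real_derivative dbump ((y - x) / h) / h\<^sup>2) (at y)"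
  using DERIV_cdivide[OF DERIV_chain2[OF DERIV_bump DERIV_cdivide[OF DERIV_diff[OF DERIV_ident DERIV_const]]], of x h h y]
  by (simp add: power2_eq_square)

lemma DERIV_step_scaled: "((\<lambda>y. step ((y - x) / h)) has_real_derivative bump ((y - x) / h) / h) (at y)"
  using DERIV_chain2[OF DERIV_step DERIV_cdivide[OF DERIV_diff[OF DERIV_ident DERIV_const]], of x h y]
  by simp

text \<open>\<open>w\<close> may jump everywhere, so continuity has to come from the kernel. A
  convergent sequence of base points is bounded, hence one rectangle carries all the kernels and
  supplies the dominating function.\<close>

lemma continuous_avg:
  assumes [measurable]: "w \<in> borel_measurable borel" and B: "\<And>P. \<bar>w P\<bar> \<le> B" and h: "0 < h"
  shows "continuous_on UNIV (avg h w)"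
proof (rule continuous_on_sequentiallyI)
  fix S P assume S: "S \<longlonglongrightarrow> (P :: real \<times> real)"
  have B0: "0 \<le> B" using B abs_ge_zero order_trans by blast
  obtain R where R: "\<And>n. norm (S n) \<le> R" using convergent_imp_bounded[OF S] by (auto simp: bounded_iff)
  define k where "k X Q = bump ((fst Q - fst X) / h) / h * (bump ((snd Q - snd X) / h) / h)" for X Q :: "real \<times> real"
  have [measurable]: "k X \<in> borel_measurable borel" for X unfolding k_def by measurable
  have kb: "\<bar>k X Q\<bar> \<le> 2 / h * (2 / h)" for X Q
    unfolding k_def abs_mult abs_divide
    by (intro mult_mono) (use h bump_abs_le in \<open>auto simp: divide_right_mono\<close>)
  have avg_eq: "avg h w X = (\<integral>Q. w Q * k X Q \<partial>lborel)" for X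
    using avg_kernel[of w h "fst X" "snd X"] h by (simp add: k_def)
  let ?R = "{-R..R+h} \<times> {-R..R+h} :: (real \<times> real) set"
  have dom: "\<bar>w Q * k (S n) Q\<bar> \<le> indicator ?R Q * (B * (2 / h * (2 / h)))" for n Q
  proof (cases "Q \<in> ?R")
    case True
    have "\<bar>w Q\<bar> * \<bar>k (S n) Q\<bar> \<le> B * (2 / h * (2 / h))" by (intro mult_mono B kb B0) simp
    with True show ?thesis by (simp add: abs_mult)
  next
    case False
    have "\<bar>fst (S n)\<bar> \<le> R" "\<bar>snd (S n)\<bar> \<le> R"
      using R[of n] norm_fst_le[of "fst (S n)" "snd (S n)"] norm_snd_le[of "snd (S n)" "fst (S n)"] by auto
    with False have "fst Q \<notin> {fst (S n)..fst (S n) + h} \<or> snd Q \<notin> {snd (S n)..snd (S n) + h}"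
      by (cases Q) (auto simp: abs_le_iff)
    then have "k (S n) Q = 0" unfolding k_def using scaled_0[OF h] by auto
    then show ?thesis using B0 by (simp add: indicator_def)
  qed
  show "(\<lambda>n. avg h w (S n)) \<longlonglongrightarrow> avg h w P"
    unfolding avg_eq
  proof (rule integral_dominated_convergence)
    show "integrable lborel (\<lambda>Q. indicator ?R Q * (B * (2 / h * (2 / h))))"
      by (rule integrable_rect[of _ "B * (2 / h * (2 / h))" "-R" "R+h" "-R" "R+h"])
        (use B0 h in \<open>auto simp: indicator_def simp del: mem_Times_iff\<close>)
    show "AE Q in lborel. (\<lambda>n. w Q * k (S n) Q) \<longlonglongrightarrow> w Q * k P Q"
    proof (rule AE_I2)
      fix Q :: "real \<times> real"
      have "continuous_on UNIV (\<lambda>X. w Q * k X Q)" unfolding k_def by (intro continuous_intros) (use h in auto)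
      then have "isCont (\<lambda>X. w Q * k X Q) P" using continuous_on_eq_continuous_at[OF open_UNIV] by blast
      then show "(\<lambda>n. w Q * k (S n) Q) \<longlonglongrightarrow> w Q * k P Q" using S by (rule isCont_tendsto_compose)
    qed
    show "AE Q in lborel. norm (w Q * k (S n) Q) \<le> indicator ?R Q * (B * (2 / h * (2 / h)))" for n
      using dom by simp
  qed simp_all
qed

text \<open>The weak form of p_t + q_x = 0 with initial value \<open>p0\<close>, as an integral over
  the whole plane. Since \<open>q\<close> vanishes for t \<le> 0, it cuts off those test functions
  that are not compactly supported in the past.\<close>

locale balance_law =
  fixes p q :: "real \<times> real \<Rightarrow> real" and p0 :: "real \<Rightarrow> real" and B :: real
  assumes borel_p [measurable]: "p \<in> borel_measurable borel"
    and borel_q [measurable]: "q \<in> borel_measurable borel"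
    and borel_p0 [measurable]: "p0 \<in> borel_measurable borel"
    and p_le: "\<And>P. \<bar>p P\<bar> \<le> B" and q_le: "\<And>P. \<bar>q P\<bar> \<le> B" and p0_le: "\<And>x. \<bar>p0 x\<bar> \<le> B"
    and q_0: "\<And>x t. t \<le> 0 \<Longrightarrow> q (x, t) = 0"
    and weak: "\<And>\<phi> \<phi>x \<phi>t. C1_test \<phi> \<phi>x \<phi>t \<Longrightarrow>
      (\<integral>P. p P * \<phi>t P + q P * \<phi>x P \<partial>lborel) + (\<integral>x. p0 x * \<phi> (x, 0) \<partial>lborel) = 0"
begin

lemma B_nonneg: "0 \<le> B" using p0_le abs_ge_zero order_trans by blast

text \<open>The mollified potential. Its \<open>x\<close>-derivative is computed by inserting its own kernel as a test
  function into the balance law.\<close>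

definition Upot :: "real \<Rightarrow> real \<times> real \<Rightarrow> real" where
  "Upot h P = (\<integral>y. p0 y * (step (y / h) - step ((y - fst P) / h)) \<partial>lborel)
     - (\<integral>Q. q Q * (bump ((fst Q - fst P) / h) / h * (1 - step ((snd Q - snd P) / h))) \<partial>lborel)"

text \<open>The sides are cut off by \<open>bump\<close>, the future by \<open>step\<close> and the
  past by \<open>q\<close> itself, which makes all products with the flux integrable.\<close>

lemma q_kernel_0:
  assumes "0 < h" "Q \<notin> {x..x + h} \<times> {0..\<bar>t\<bar> + h}"
  shows "q Q * (bump ((fst Q - x) / h) * (1 - step ((snd Q - t) / h))) = 0"
    "q Q * (dbump ((fst Q - x) / h) * (1 - step ((snd Q - t) / h))) = 0"
    "q Q * (bump ((fst Q - x) / h) * bump ((snd Q - t) / h)) = 0"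
proof -
  from assms(2) consider "fst Q \<notin> {x..x + h}" | "snd Q < 0" | "\<bar>t\<bar> + h < snd Q" by (cases Q) (auto simp: not_le)
  then have "bump ((fst Q - x) / h) = 0 \<and> dbump ((fst Q - x) / h) = 0 \<or> q Q = 0
      \<or> step ((snd Q - t) / h) = 1 \<and> bump ((snd Q - t) / h) = 0"
  proof cases
    case 1 then show ?thesis using scaled_0[OF assms(1)] by blast
  next
    case 2 then show ?thesis using q_0[of "snd Q" "fst Q"] by simp
  next
    case 3
    then have "snd Q \<notin> {t..t + h}" "t + h \<le> snd Q" by auto
    then show ?thesis using scaled_0(1)[OF assms(1), of "snd Q" t] step_scaled(2)[OF assms(1), of t "snd Q"] by auto
  qed
  then show "q Q * (bump ((fst Q - x) / h) * (1 - step ((snd Q - t) / h))) = 0"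
    "q Q * (dbump ((fst Q - x) / h) * (1 - step ((snd Q - t) / h))) = 0"
    "q Q * (bump ((fst Q - x) / h) * bump ((snd Q - t) / h)) = 0" by auto
qed

lemma one_minus_step_abs_le: "\<bar>1 - step s\<bar> \<le> 1" using step_range[of s] by simp

lemma integrable_q_kernel:
  assumes h: "0 < h"
  shows "integrable lborel (\<lambda>Q. q Q * (bump ((fst Q - x) / h) / h * (1 - step ((snd Q - t) / h))))"
    "integrable lborel (\<lambda>Q. q Q * (- dbump ((fst Q - x) / h) / h\<^sup>2 * (1 - step ((snd Q - t) / h))))"
    "integrable lborel (\<lambda>Q. q Q * (bump ((fst Q - x) / h) / h * (bump ((snd Q - t) / h) / h)))"
proof -
  note 0 = q_kernel_0[OF h, of _ x t]
  show "integrable lborel (\<lambda>Q. q Q * (bump ((fst Q - x) / h) / h * (1 - step ((snd Q - t) / h))))"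
  proof (rule integrable_rect[of _ "B * (2 / h * 1)" x "x + h" 0 "\<bar>t\<bar> + h"])
    show "\<bar>q Q * (bump ((fst Q - x) / h) / h * (1 - step ((snd Q - t) / h)))\<bar> \<le> B * (2 / h * 1)" for Q
      unfolding abs_mult abs_divide using h B_nonneg
      by (intro mult_mono q_le one_minus_step_abs_le divide_mono bump_abs_le) auto
  qed (use 0(1) in auto)
  show "integrable lborel (\<lambda>Q. q Q * (- dbump ((fst Q - x) / h) / h\<^sup>2 * (1 - step ((snd Q - t) / h))))"
  proof (rule integrable_rect[of _ "B * (60 / h\<^sup>2 * 1)" x "x + h" 0 "\<bar>t\<bar> + h"])
    show "\<bar>q Q * (- dbump ((fst Q - x) / h) / h\<^sup>2 * (1 - step ((snd Q - t) / h)))\<bar> \<le> B * (60 / h\<^sup>2 * 1)" for Q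
      unfolding abs_mult abs_divide using h B_nonneg dbump_abs_le
      by (intro mult_mono q_le one_minus_step_abs_le divide_mono) auto
  qed (use 0(2) in auto)
  show "integrable lborel (\<lambda>Q. q Q * (bump ((fst Q - x) / h) / h * (bump ((snd Q - t) / h) / h)))"
  proof (rule integrable_rect[of _ "B * (2 / h * (2 / h))" x "x + h" 0 "\<bar>t\<bar> + h"])
    show "\<bar>q Q * (bump ((fst Q - x) / h) / h * (bump ((snd Q - t) / h) / h))\<bar> \<le> B * (2 / h * (2 / h))" for Q
      unfolding abs_mult abs_divide using h B_nonneg
      by (intro mult_mono q_le divide_mono bump_abs_le) auto
  qed (use 0(3) in auto)
qed

text \<open>Differentiating the time cutoff \<open>1 - step\<close> produces the time factor of the
  averaging kernel, so the flux term turns into the average of \<open>q\<close>. The dominating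
  weight lives on a rectangle prolonged by 1 in time, to cover all shifts |d| \<le> 1.\<close>

lemma DERIV_Upot_t:
  assumes h: "0 < h"
  shows "((\<lambda>t. Upot h (x, t)) has_real_derivative - avg h q (x, t)) (at t)"
proof -
  let ?g = "\<lambda>Q. B * (2 / h * (60 / h\<^sup>2)) * indicator ({x..x + h} \<times> {0..\<bar>t\<bar> + 1 + h}) Q"
  have "((\<lambda>t. \<integral>Q. q Q * (bump ((fst Q - x) / h) / h * (1 - step ((snd Q - t) / h))) \<partial>lborel)
      has_real_derivative (\<integral>Q. q Q * (bump ((fst Q - x) / h) / h * (bump ((snd Q - t) / h) / h)) \<partial>lborel)) (at t)"
  proof (rule DERIV_integral[where g = ?g])
    show "integrable lborel ?g"
      by (rule integrable_rect[of _ "B * (2 / h * (60 / h\<^sup>2))" x "x + h" 0 "\<bar>t\<bar> + 1 + h"])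
        (use B_nonneg h in \<open>auto simp: indicator_def simp del: mem_Times_iff\<close>)
    fix d :: real and Q assume d: "\<bar>d\<bar> \<le> 1"
    let ?D = "\<lambda>r. q Q * (bump ((fst Q - x) / h) / h * r)"
    let ?e = "(1 - step ((snd Q - (t + d)) / h)) - (1 - step ((snd Q - t) / h)) - d * (bump ((snd Q - t) / h) / h)"
    have eq: "?D (1 - step ((snd Q - (t + d)) / h)) - ?D (1 - step ((snd Q - t) / h)) - d * ?D (bump ((snd Q - t) / h) / h)
      = ?D ?e" by (simp add: algebra_simps diff_divide_distrib)
    show "\<bar>?D (1 - step ((snd Q - (t + d)) / h)) - ?D (1 - step ((snd Q - t) / h)) - d * ?D (bump ((snd Q - t) / h) / h)\<bar>
        \<le> d\<^sup>2 * ?g Q"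
    proof (cases "Q \<in> {x..x + h} \<times> {0..\<bar>t\<bar> + 1 + h}")
      case True
      have "\<bar>?e\<bar> = \<bar>step ((snd Q - (t + d)) / h) - step ((snd Q - t) / h) - d * (- bump ((snd Q - t) / h) / h)\<bar>"
        by (subst abs_minus_cancel[symmetric]) (simp add: algebra_simps)
      also have "\<dots> \<le> d\<^sup>2 * (60 / h\<^sup>2)" by (rule step_scaled_taylor[OF h])
      finally have e: "\<bar>?e\<bar> \<le> d\<^sup>2 * (60 / h\<^sup>2)" .
      have "\<bar>?D ?e\<bar> \<le> B * (2 / h * (d\<^sup>2 * (60 / h\<^sup>2)))"
        unfolding abs_mult[of "q Q"] abs_mult[of "bump _ / h"] abs_divide[of "bump _"] using h B_nonneg
        by (intro mult_mono q_le divide_mono bump_abs_le e) auto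
      then show ?thesis unfolding eq using True by (simp del: mem_Times_iff add: ac_simps)
    next
      case False
      have "Q \<notin> {x..x + h} \<times> {0..\<bar>t + d\<bar> + h}" "Q \<notin> {x..x + h} \<times> {0..\<bar>t\<bar> + h}"
        using False d by (cases Q; auto)+
      note Q = this
      have z1: "?D (1 - step ((snd Q - (t + d)) / h)) = 0" using q_kernel_0(1)[OF h Q(1)] by auto
      have z2: "?D (1 - step ((snd Q - t) / h)) = 0" using q_kernel_0(1)[OF h Q(2)] by auto
      have z3: "?D (bump ((snd Q - t) / h) / h) = 0" using q_kernel_0(3)[OF h Q(2)] by auto
      have "0 \<le> d\<^sup>2 * ?g Q" using B_nonneg h by simp
      then show ?thesis by (simp only: z1 z2 z3 mult_zero_right diff_0_right abs_zero)
    qed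
  qed (use integrable_q_kernel[OF h, of x] in auto)
  from DERIV_diff[OF DERIV_const this]
  show ?thesis unfolding Upot_def avg_kernel[OF borel_q h] by simp
qed

text \<open>The test function behind the x-derivative of \<open>Upot\<close>: its time derivative is
  minus the averaging kernel, and its space derivative is the kernel that results from
  differentiating the flux term of \<open>Upot\<close>.\<close>

lemma C1_test_kernel:
  assumes h: "0 < h"
  shows "C1_test (\<lambda>(y, s). bump ((y - x) / h) / h * (1 - step ((s - t) / h)))
    (\<lambda>(y, s). dbump ((y - x) / h) / h\<^sup>2 * (1 - step ((s - t) / h)))
    (\<lambda>(y, s). - (bump ((y - x) / h) / h * (bump ((s - t) / h) / h)))"
  unfolding C1_test_def case_prod_conv
proof (intro conjI allI)
  show "((\<lambda>y. bump ((y - x) / h) / h * (1 - step ((s - t) / h))) has_real_derivative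
      dbump ((y - x) / h) / h\<^sup>2 * (1 - step ((s - t) / h))) (at y)" for y s
    using DERIV_cmult_right[OF DERIV_bump_scaled[of h x y]] h by simp
  show "((\<lambda>s. bump ((y - x) / h) / h * (1 - step ((s - t) / h))) has_real_derivative
      - (bump ((y - x) / h) / h * (bump ((s - t) / h) / h))) (at s)" for y s
    using DERIV_cmult[OF DERIV_diff[OF DERIV_const[of 1] DERIV_step_scaled[of t h s]], of "bump ((y - x) / h) / h"] by simp
  show "continuous_on UNIV (\<lambda>(y, s). dbump ((y - x) / h) / h\<^sup>2 * (1 - step ((s - t) / h)))"
    "continuous_on UNIV (\<lambda>(y, s). - (bump ((y - x) / h) / h * (bump ((s - t) / h) / h)))"
    unfolding case_prod_unfold using h by (auto intro!: continuous_intros)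
  have "bump ((y - x) / h) / h * (1 - step ((s - t) / h)) = 0" if "\<bar>x\<bar> + \<bar>t\<bar> + h < \<bar>y\<bar> \<or> \<bar>x\<bar> + \<bar>t\<bar> + h < s" for y s
    using that
  proof
    assume "\<bar>x\<bar> + \<bar>t\<bar> + h < \<bar>y\<bar>"
    then have "y \<notin> {x..x + h}" using h by auto
    then show ?thesis using scaled_0[OF h] by simp
  next
    assume "\<bar>x\<bar> + \<bar>t\<bar> + h < s"
    then show ?thesis using step_scaled(2)[OF h, of t s] by simp
  qed
  then show "\<exists>R. \<forall>y s. 0 \<le> s \<longrightarrow> R < \<bar>y\<bar> \<or> R < s \<longrightarrow> bump ((y - x) / h) / h * (1 - step ((s - t) / h)) = 0" by blast
qed

lemma DERIV_Upot_x:
  assumes h: "0 < h" and t: "0 \<le> t"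
  shows "((\<lambda>x. Upot h (x, t)) has_real_derivative avg h p (x, t)) (at x)"
proof -
  let ?g = "\<lambda>Q. B * (420 / h^3 * 1) * indicator ({x - 1..x + 1 + h} \<times> {0..\<bar>t\<bar> + h}) Q"
  have D2: "((\<lambda>x. \<integral>Q. q Q * (bump ((fst Q - x) / h) / h * (1 - step ((snd Q - t) / h))) \<partial>lborel)
      has_real_derivative (\<integral>Q. q Q * (- dbump ((fst Q - x) / h) / h\<^sup>2 * (1 - step ((snd Q - t) / h))) \<partial>lborel)) (at x)"
  proof (rule DERIV_integral[where g = ?g])
    show "integrable lborel ?g"
      by (rule integrable_rect[of _ "B * (420 / h^3 * 1)" "x - 1" "x + 1 + h" 0 "\<bar>t\<bar> + h"])
        (use B_nonneg h in \<open>auto simp: indicator_def simp del: mem_Times_iff\<close>)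
    fix d :: real and Q assume d: "\<bar>d\<bar> \<le> 1"
    let ?D = "\<lambda>r. q Q * (r * (1 - step ((snd Q - t) / h)))"
    let ?e = "bump ((fst Q - (x + d)) / h) / h - bump ((fst Q - x) / h) / h - d * (- dbump ((fst Q - x) / h) / h\<^sup>2)"
    have eq: "?D (bump ((fst Q - (x + d)) / h) / h) - ?D (bump ((fst Q - x) / h) / h) - d * ?D (- dbump ((fst Q - x) / h) / h\<^sup>2) = ?D ?e"
      by (simp add: algebra_simps)
    show "\<bar>?D (bump ((fst Q - (x + d)) / h) / h) - ?D (bump ((fst Q - x) / h) / h) - d * ?D (- dbump ((fst Q - x) / h) / h\<^sup>2)\<bar> \<le> d\<^sup>2 * ?g Q"
    proof (cases "Q \<in> {x - 1..x + 1 + h} \<times> {0..\<bar>t\<bar> + h}")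
      case True
      have "\<bar>?D ?e\<bar> \<le> B * (d\<^sup>2 * (420 / h^3) * 1)"
        unfolding abs_mult[of "q Q"] abs_mult[of ?e] using h B_nonneg
        by (intro mult_mono q_le one_minus_step_abs_le bump_scaled_taylor[OF h]) auto
      then show ?thesis unfolding eq using True by (simp del: mem_Times_iff add: ac_simps)
    next
      case False
      have "Q \<notin> {x + d..x + d + h} \<times> {0..\<bar>t\<bar> + h}" "Q \<notin> {x..x + h} \<times> {0..\<bar>t\<bar> + h}"
        using False d by (cases Q; auto)+
      note Q = this
      have z1: "?D (bump ((fst Q - (x + d)) / h) / h) = 0" using q_kernel_0(1)[OF h Q(1)] by auto
      have z2: "?D (bump ((fst Q - x) / h) / h) = 0" using q_kernel_0(1)[OF h Q(2)] by auto
      have z3: "?D (- dbump ((fst Q - x) / h) / h\<^sup>2) = 0" using q_kernel_0(2)[OF h Q(2)] by auto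
      have "0 \<le> d\<^sup>2 * ?g Q" using B_nonneg h by simp
      then show ?thesis by (simp only: z1 z2 z3 mult_zero_right diff_0_right abs_zero)
    qed
  qed (use integrable_q_kernel[OF h, of _ t] in auto)
  let ?b = "\<lambda>y. B * (60 / h\<^sup>2) * indicator {x - 1..x + 1 + h} y"
  have D1: "((\<lambda>x. \<integral>y. p0 y * (step (y / h) - step ((y - x) / h)) \<partial>lborel)
      has_real_derivative (\<integral>y. p0 y * (bump ((y - x) / h) / h) \<partial>lborel)) (at x)"
  proof (rule DERIV_integral[where g = ?b])
    show "integrable lborel (\<lambda>y. p0 y * (step (y / h) - step ((y - x) / h)))" for x
    proof (rule integrable_Icc[of _ "B * 1" "min 0 x" "max 0 x + h"])
      show "\<bar>p0 y * (step (y / h) - step ((y - x) / h))\<bar> \<le> B * 1" for y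
        unfolding abs_mult using step_range[of "y / h"] step_range[of "(y - x) / h"] B_nonneg
        by (intro mult_mono p0_le) (auto simp: abs_le_iff)
      show "p0 y * (step (y / h) - step ((y - x) / h)) = 0" if "y \<notin> {min 0 x..max 0 x + h}" for y
        using that step_scaled[OF h, of y x] step_scaled[OF h, of y 0] step_scaled(2)[OF h, of x y] step_scaled(2)[OF h, of 0 y] by auto
    qed measurable
    show "integrable lborel (\<lambda>y. p0 y * (bump ((y - x) / h) / h))"
    proof (rule integrable_Icc[of _ "B * (2 / h)" x "x + h"])
      show "\<bar>p0 y * (bump ((y - x) / h) / h)\<bar> \<le> B * (2 / h)" for y
        unfolding abs_mult abs_divide using h B_nonneg by (intro mult_mono p0_le divide_mono bump_abs_le) auto
    qed (use scaled_0[OF h] in auto)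
    show "integrable lborel ?b"
      by (rule integrable_Icc[of _ "B * (60 / h\<^sup>2)" "x - 1" "x + 1 + h"]) (use B_nonneg h in \<open>auto simp: indicator_def\<close>)
    fix d y :: real assume d: "\<bar>d\<bar> \<le> 1"
    let ?e = "step ((y - (x + d)) / h) - step ((y - x) / h) - d * (- bump ((y - x) / h) / h)"
    have eq: "p0 y * (step (y / h) - step ((y - (x + d)) / h)) - p0 y * (step (y / h) - step ((y - x) / h)) - d * (p0 y * (bump ((y - x) / h) / h)) = - (p0 y * ?e)"
      by (simp add: algebra_simps)
    show "\<bar>p0 y * (step (y / h) - step ((y - (x + d)) / h)) - p0 y * (step (y / h) - step ((y - x) / h)) - d * (p0 y * (bump ((y - x) / h) / h))\<bar> \<le> d\<^sup>2 * ?b y"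
    proof (cases "y \<in> {x - 1..x + 1 + h}")
      case True
      have "\<bar>p0 y * ?e\<bar> \<le> B * (d\<^sup>2 * (60 / h\<^sup>2))"
        unfolding abs_mult[of "p0 y"] using B_nonneg by (intro mult_mono p0_le step_scaled_taylor[OF h]) auto
      then show ?thesis unfolding eq using True by (simp add: ac_simps)
    next
      case False
      then have "?e = 0" using d step_scaled[OF h, of y x] step_scaled[OF h, of y "x + d"]
          step_scaled(2)[OF h, of x y] step_scaled(2)[OF h, of "x + d" y] scaled_0[OF h, of y x]
        by auto
      then show ?thesis unfolding eq using B_nonneg by simp
    qed
  qed
  \<comment> \<open>Since 0 \<le> t, the time cutoff equals 1 at time 0, and the initial term of the
    balance law is exactly the derivative found in \<open>D1\<close>.\<close>
  have "(\<integral>P. - (p P * (bump ((fst P - x) / h) / h * (bump ((snd P - t) / h) / h)))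
        + q P * (dbump ((fst P - x) / h) / h\<^sup>2 * (1 - step ((snd P - t) / h))) \<partial>lborel)
      + (\<integral>y. p0 y * (bump ((y - x) / h) / h) \<partial>lborel) = 0"
    using weak[OF C1_test_kernel[OF h, of x t]] step_scaled(1)[OF h, of 0 t] t
    by (simp add: case_prod_unfold)
  moreover have "integrable lborel (\<lambda>P. p P * (bump ((fst P - x) / h) / h * (bump ((snd P - t) / h) / h)))"
  proof (rule integrable_rect[of _ "B * (2 / h * (2 / h))" x "x + h" t "t + h"])
    show "\<bar>p Q * (bump ((fst Q - x) / h) / h * (bump ((snd Q - t) / h) / h))\<bar> \<le> B * (2 / h * (2 / h))" for Q
      unfolding abs_mult abs_divide using h B_nonneg by (intro mult_mono p_le divide_mono bump_abs_le) auto
    show "p Q * (bump ((fst Q - x) / h) / h * (bump ((snd Q - t) / h) / h)) = 0" if "Q \<notin> {x..x + h} \<times> {t..t + h}" for Q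
      using that scaled_0[OF h, of "fst Q" x] scaled_0[OF h, of "snd Q" t] by (cases Q) auto
  qed measurable
  ultimately have "(\<integral>y. p0 y * (bump ((y - x) / h) / h) \<partial>lborel)
      - (\<integral>Q. q Q * (- dbump ((fst Q - x) / h) / h\<^sup>2 * (1 - step ((snd Q - t) / h))) \<partial>lborel) = avg h p (x, t)"
    unfolding avg_kernel[OF borel_p h] using integrable_q_kernel(2)[OF h, of x t] by simp
  with DERIV_diff[OF D1 D2] show ?thesis unfolding Upot_def by simp
qed

end

section \<open>The Lipschitz potential as limit of the mollified ones\<close>

context balance_law
begin

lemma step_diff:
  assumes "0 < h" "0 < g"
  shows "\<bar>step ((y - x) / h) - step ((y - x) / g)\<bar> \<le> 1"
    "y \<notin> {x..x + max h g} \<Longrightarrow> step ((y - x) / h) - step ((y - x) / g) = 0"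
proof -
  show "\<bar>step ((y - x) / h) - step ((y - x) / g)\<bar> \<le> 1"
    using step_range[of "(y - x) / h"] step_range[of "(y - x) / g"] by (auto simp: abs_le_iff)
  show "y \<notin> {x..x + max h g} \<Longrightarrow> step ((y - x) / h) - step ((y - x) / g) = 0"
    using step_scaled[OF assms(1), of y x] step_scaled[OF assms(2), of y x]
      step_scaled(2)[OF assms(1), of x y] step_scaled(2)[OF assms(2), of x y] by auto
qed

lemma integral_step_diff:
  assumes "0 < h" "0 < g"
  shows "integrable lborel (\<lambda>y. p0 y * (step ((y - x) / h) - step ((y - x) / g)))"
    "\<bar>\<integral>y. p0 y * (step ((y - x) / h) - step ((y - x) / g)) \<partial>lborel\<bar> \<le> B * max h g"
proof -
  have b: "\<bar>p0 y * (step ((y - x) / h) - step ((y - x) / g))\<bar> \<le> B" for y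
    using mult_mono[OF p0_le[of y] step_diff(1)[OF assms, of y x]] B_nonneg by (simp add: abs_mult)
  have 0: "p0 y * (step ((y - x) / h) - step ((y - x) / g)) = 0" if "y \<notin> {x..x + max h g}" for y
    using step_diff(2)[OF assms that] by simp
  have m: "(\<lambda>y. p0 y * (step ((y - x) / h) - step ((y - x) / g))) \<in> borel_measurable borel" by measurable
  show "integrable lborel (\<lambda>y. p0 y * (step ((y - x) / h) - step ((y - x) / g)))"
    by (rule integrable_Icc[OF m b 0])
  show "\<bar>\<integral>y. p0 y * (step ((y - x) / h) - step ((y - x) / g)) \<partial>lborel\<bar> \<le> B * max h g"
  proof -
    have "\<bar>\<integral>y. p0 y * (step ((y - x) / h) - step ((y - x) / g)) \<partial>lborel\<bar> \<le> B * (x + max h g - x)"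
      by (rule abs_integral_Icc[OF m b 0]) (use assms in auto)
    then show ?thesis by simp
  qed
qed

lemma integrable_p0_steps:
  assumes h: "0 < h"
  shows "integrable lborel (\<lambda>y. p0 y * (step ((y - x') / h) - step ((y - x) / h)))"
proof (rule integrable_Icc[of _ "B * 1" "min x x'" "max x x' + h"])
  show "\<bar>p0 y * (step ((y - x') / h) - step ((y - x) / h))\<bar> \<le> B * 1" for y
    unfolding abs_mult using step_range[of "(y - x') / h"] step_range[of "(y - x) / h"] B_nonneg
    by (intro mult_mono p0_le) (auto simp: abs_le_iff)
  show "p0 y * (step ((y - x') / h) - step ((y - x) / h)) = 0" if "y \<notin> {min x x'..max x x' + h}" for y
    using that step_scaled[OF h, of y x] step_scaled[OF h, of y x'] step_scaled(2)[OF h, of x y] step_scaled(2)[OF h, of x' y] by auto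
qed measurable

text \<open>Two steps of different widths at the same place differ only in a strip of width
  \<open>max h g\<close>, so their difference is an admissible spatial profile although a single
  step is not.\<close>

lemma C1_test_step_diff:
  assumes h: "0 < h" and g: "0 < g"
  shows "C1_test (\<lambda>(y, s). (step ((y - x) / h) - step ((y - x) / g)) * (1 - step ((s - t) / h)))
    (\<lambda>(y, s). (bump ((y - x) / h) / h - bump ((y - x) / g) / g) * (1 - step ((s - t) / h)))
    (\<lambda>(y, s). - ((step ((y - x) / h) - step ((y - x) / g)) * (bump ((s - t) / h) / h)))"
  unfolding C1_test_def case_prod_conv
proof (intro conjI allI)
  show "((\<lambda>y. (step ((y - x) / h) - step ((y - x) / g)) * (1 - step ((s - t) / h))) has_real_derivative
      (bump ((y - x) / h) / h - bump ((y - x) / g) / g) * (1 - step ((s - t) / h))) (at y)" for y s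
    by (intro DERIV_cmult_right DERIV_diff DERIV_step_scaled)
  show "((\<lambda>s. (step ((y - x) / h) - step ((y - x) / g)) * (1 - step ((s - t) / h))) has_real_derivative
      - ((step ((y - x) / h) - step ((y - x) / g)) * (bump ((s - t) / h) / h))) (at s)" for y s
    using DERIV_cmult[OF DERIV_diff[OF DERIV_const[of 1] DERIV_step_scaled[of t h s]], of "step ((y - x) / h) - step ((y - x) / g)"] by simp
  show "continuous_on UNIV (\<lambda>(y, s). (bump ((y - x) / h) / h - bump ((y - x) / g) / g) * (1 - step ((s - t) / h)))"
    "continuous_on UNIV (\<lambda>(y, s). - ((step ((y - x) / h) - step ((y - x) / g)) * (bump ((s - t) / h) / h)))"
    unfolding case_prod_unfold using h g by (auto intro!: continuous_intros)
  have "(step ((y - x) / h) - step ((y - x) / g)) * (1 - step ((s - t) / h)) = 0"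
    if "\<bar>x\<bar> + \<bar>t\<bar> + h + g < \<bar>y\<bar> \<or> \<bar>x\<bar> + \<bar>t\<bar> + h + g < s" for y s
    using that
  proof
    assume "\<bar>x\<bar> + \<bar>t\<bar> + h + g < \<bar>y\<bar>"
    then have "y \<notin> {x..x + max h g}" using h g by auto
    then show ?thesis using step_diff(2)[OF h g] by simp
  next
    assume "\<bar>x\<bar> + \<bar>t\<bar> + h + g < s"
    then show ?thesis using step_scaled(2)[OF h, of t s] g by simp
  qed
  then show "\<exists>R. \<forall>y s. 0 \<le> s \<longrightarrow> R < \<bar>y\<bar> \<or> R < s \<longrightarrow> (step ((y - x) / h) - step ((y - x) / g)) * (1 - step ((s - t) / h)) = 0" by blast
qed

text \<open>The difference of two mollified potentials is again expressed by the balance law, with a test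
  function that is concentrated near the vertical line through \<open>(x, t)\<close>.\<close>

lemma Upot_cauchy:
  assumes h: "0 < h" and g: "0 < g" and t: "0 \<le> t"
  shows "\<bar>Upot h (x, t) - Upot g (x, t)\<bar> \<le> 5 * B * max h g"
proof -
  define E where "E y = step ((y - x) / h) - step ((y - x) / g)" for y
  define F where "F y = bump ((y - x) / h) / h - bump ((y - x) / g) / g" for y
  define T where "T s = 1 - step ((s - t) / h)" for s
  define S where "S s = step ((s - t) / g) - step ((s - t) / h)" for s
  define m where "m = max h g"
  have m: "0 < m" "h \<le> m" "g \<le> m" using h g by (auto simp: m_def)
  have [measurable]: "E \<in> borel_measurable borel" "F \<in> borel_measurable borel" "T \<in> borel_measurable borel" "S \<in> borel_measurable borel"
    unfolding E_def[abs_def] F_def[abs_def] T_def[abs_def] S_def[abs_def] by measurable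
  have E: "\<bar>E y\<bar> \<le> 1" "y \<notin> {x..x + m} \<Longrightarrow> E y = 0" for y
    unfolding E_def m_def using step_diff[OF h g] by auto
  have S: "\<bar>S s\<bar> \<le> 1" "s \<notin> {t..t + m} \<Longrightarrow> S s = 0" for s
    unfolding S_def m_def using step_diff[OF g h, of s t] by (auto simp: max.commute)
  have J: "(\<integral>P. - (p P * (E (fst P) * (bump ((snd P - t) / h) / h))) + q P * (F (fst P) * T (snd P)) \<partial>lborel)
      + (\<integral>y. p0 y * E y \<partial>lborel) = 0"
    using weak[OF C1_test_step_diff[OF h g, of x t]] step_scaled(1)[OF h, of 0 t] t
    by (simp add: case_prod_unfold E_def F_def T_def)
  have pb: "\<bar>p P * (E (fst P) * (bump ((snd P - t) / h) / h))\<bar> \<le> B * (1 * (2 / h))" for P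
    unfolding abs_mult abs_divide using h B_nonneg by (intro mult_mono p_le E divide_mono bump_abs_le) auto
  have p0: "p P * (E (fst P) * (bump ((snd P - t) / h) / h)) = 0" if "P \<notin> {x..x + m} \<times> {t..t + h}" for P
    using that E(2)[of "fst P"] scaled_0[OF h, of "snd P" t] by (cases P) auto
  have pm: "(\<lambda>P. p P * (E (fst P) * (bump ((snd P - t) / h) / h))) \<in> borel_measurable borel" by measurable
  have pI: "integrable lborel (\<lambda>P. p P * (E (fst P) * (bump ((snd P - t) / h) / h)))" by (rule integrable_rect[OF pm pb p0])
  have "\<bar>\<integral>P. p P * (E (fst P) * (bump ((snd P - t) / h) / h)) \<partial>lborel\<bar> \<le> B * (1 * (2 / h)) * ((x + m - x) * (t + h - t))"
    by (rule abs_integral_rect[OF pm pb p0]) (use m h in auto)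
  then have pe: "\<bar>\<integral>P. p P * (E (fst P) * (bump ((snd P - t) / h) / h)) \<partial>lborel\<bar> \<le> 2 * B * m" using h by simp
  have Q1: "integrable lborel (\<lambda>Q. q Q * (bump ((fst Q - x) / h) / h * T (snd Q)))"
    "integrable lborel (\<lambda>Q. q Q * (bump ((fst Q - x) / g) / g * (1 - step ((snd Q - t) / g))))"
    unfolding T_def by (rule integrable_q_kernel(1)[OF h]) (rule integrable_q_kernel(1)[OF g])
  have qb: "\<bar>q P * (bump ((fst P - x) / g) / g * S (snd P))\<bar> \<le> B * (2 / g * 1)" for P
    unfolding abs_mult abs_divide using g B_nonneg by (intro mult_mono q_le S divide_mono bump_abs_le) auto
  have q0: "q P * (bump ((fst P - x) / g) / g * S (snd P)) = 0" if "P \<notin> {x..x + g} \<times> {t..t + m}" for P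
    using that S(2)[of "snd P"] scaled_0[OF g, of "fst P" x] by (cases P) auto
  have qm: "(\<lambda>P. q P * (bump ((fst P - x) / g) / g * S (snd P))) \<in> borel_measurable borel" by measurable
  have qI: "integrable lborel (\<lambda>P. q P * (bump ((fst P - x) / g) / g * S (snd P)))" by (rule integrable_rect[OF qm qb q0])
  have "\<bar>\<integral>P. q P * (bump ((fst P - x) / g) / g * S (snd P)) \<partial>lborel\<bar> \<le> B * (2 / g * 1) * ((x + g - x) * (t + m - t))"
    by (rule abs_integral_rect[OF qm qb q0]) (use m g in auto)
  then have qe: "\<bar>\<integral>P. q P * (bump ((fst P - x) / g) / g * S (snd P)) \<partial>lborel\<bar> \<le> 2 * B * m" using g by simp
  have Ieq: "(\<integral>y. p0 y * (step (y / h) - step ((y - x) / h)) \<partial>lborel) - (\<integral>y. p0 y * (step (y / g) - step ((y - x) / g)) \<partial>lborel)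
    = (\<integral>y. p0 y * (step (y / h) - step (y / g)) \<partial>lborel) - (\<integral>y. p0 y * E y \<partial>lborel)"
  proof -
    have "(\<integral>y. p0 y * (step (y / h) - step ((y - x) / h)) \<partial>lborel) - (\<integral>y. p0 y * (step (y / g) - step ((y - x) / g)) \<partial>lborel)
       = (\<integral>y. p0 y * (step (y / h) - step ((y - x) / h)) - p0 y * (step (y / g) - step ((y - x) / g)) \<partial>lborel)"
      using integrable_p0_steps[OF h, of 0 x] integrable_p0_steps[OF g, of 0 x] by simp
    also have "\<dots> = (\<integral>y. p0 y * (step (y / h) - step (y / g)) - p0 y * E y \<partial>lborel)"
      by (rule Bochner_Integration.integral_cong) (auto simp: E_def algebra_simps)
    also have "\<dots> = (\<integral>y. p0 y * (step (y / h) - step (y / g)) \<partial>lborel) - (\<integral>y. p0 y * E y \<partial>lborel)"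
      using integral_step_diff(1)[OF h g, of 0] integral_step_diff(1)[OF h g, of x] by (simp add: E_def)
    finally show ?thesis .
  qed
  have qF: "integrable lborel (\<lambda>Q. q Q * (F (fst Q) * T (snd Q)))"
  proof -
    have "(\<lambda>Q. q Q * (F (fst Q) * T (snd Q))) = (\<lambda>Q. q Q * (bump ((fst Q - x) / h) / h * T (snd Q))
        - q Q * (bump ((fst Q - x) / g) / g * (1 - step ((snd Q - t) / g))) - q Q * (bump ((fst Q - x) / g) / g * S (snd Q)))"
      by (auto simp: fun_eq_iff F_def T_def S_def algebra_simps diff_divide_distrib)
    then show ?thesis using Q1 qI by simp
  qed
  \<comment> \<open>The passage from scale \<open>h\<close> to scale \<open>g\<close> is split: the
    space kernel is exchanged with the time cutoff kept at scale \<open>h\<close>, which the balance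
    law controls, then the time cutoff is exchanged, which only affects a layer of height
    \<open>m\<close>.\<close>
  have "(\<integral>Q. q Q * (bump ((fst Q - x) / h) / h * (1 - step ((snd Q - t) / h))) \<partial>lborel)
      - (\<integral>Q. q Q * (bump ((fst Q - x) / g) / g * (1 - step ((snd Q - t) / g))) \<partial>lborel)
     = (\<integral>Q. q Q * (F (fst Q) * T (snd Q)) + q Q * (bump ((fst Q - x) / g) / g * S (snd Q)) \<partial>lborel)"
    unfolding Bochner_Integration.integral_diff[OF integrable_q_kernel(1)[OF h] Q1(2), symmetric]
    by (rule Bochner_Integration.integral_cong) (auto simp: F_def T_def S_def algebra_simps diff_divide_distrib)
  also have "\<dots> = (\<integral>Q. q Q * (F (fst Q) * T (snd Q)) \<partial>lborel) + (\<integral>Q. q Q * (bump ((fst Q - x) / g) / g * S (snd Q)) \<partial>lborel)"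
    using qF qI by simp
  finally have "Upot h (x, t) - Upot g (x, t) = (\<integral>y. p0 y * (step (y / h) - step (y / g)) \<partial>lborel)
      - (\<integral>y. p0 y * E y \<partial>lborel) - (\<integral>Q. q Q * (F (fst Q) * T (snd Q)) \<partial>lborel)
      - (\<integral>Q. q Q * (bump ((fst Q - x) / g) / g * S (snd Q)) \<partial>lborel)"
    using Ieq unfolding Upot_def fst_conv snd_conv by linarith
  moreover have "- (\<integral>y. p0 y * E y \<partial>lborel) - (\<integral>Q. q Q * (F (fst Q) * T (snd Q)) \<partial>lborel)
      = - (\<integral>P. p P * (E (fst P) * (bump ((snd P - t) / h) / h)) \<partial>lborel)"
    using J pI qF by (simp del: minus_mult_right)
  moreover have "\<bar>\<integral>y. p0 y * (step (y / h) - step (y / g)) \<partial>lborel\<bar> \<le> B * m"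
    using integral_step_diff(2)[OF h g, of 0] by (simp add: m_def)
  \<comment> \<open>The constant 5 is 2 + 2 + 1: the term with \<open>p\<close>, the layer in time,
    and the change of the base step at 0.\<close>
  ultimately show ?thesis using pe qe unfolding m_def[symmetric] by linarith
qed

text \<open>Only the values at t \<ge> 0 carry meaning; there the limit is shown to exist, with a
  rate.\<close>

definition U :: "real \<times> real \<Rightarrow> real" where "U P = lim (\<lambda>n. Upot (1 / real (Suc n)) P)"

lemma U_tendsto:
  assumes t: "0 \<le> t"
  shows "(\<lambda>n. Upot (1 / real (Suc n)) (x, t)) \<longlonglongrightarrow> U (x, t)"
proof -
  have "Cauchy (\<lambda>n. Upot (1 / real (Suc n)) (x, t))"
  proof (rule metric_CauchyI)
    fix e :: real assume "0 < e"
    have "(\<lambda>n. 5 * B * (1 / real (Suc n))) \<longlonglongrightarrow> 5 * B * 0"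
      by (intro tendsto_intros LIMSEQ_inverse_real_of_nat[unfolded inverse_eq_divide])
    then have "eventually (\<lambda>n. 5 * B * (1 / real (Suc n)) < e) sequentially"
      using \<open>0 < e\<close> by (intro order_tendstoD(2)[where y = "5 * B * 0"]) simp_all
    then obtain N where N: "5 * B * (1 / real (Suc N)) < e" by (auto simp: eventually_sequentially)
    show "\<exists>M. \<forall>m\<ge>M. \<forall>n\<ge>M. dist (Upot (1 / real (Suc m)) (x, t)) (Upot (1 / real (Suc n)) (x, t)) < e"
    proof (intro exI[of _ N] allI impI)
      fix m n assume mn: "N \<le> m" "N \<le> n"
      have "1 / real (Suc m) \<le> 1 / real (Suc N)" "1 / real (Suc n) \<le> 1 / real (Suc N)"
        using mn by (auto intro!: divide_left_mono)
      then have "5 * B * max (1 / real (Suc m)) (1 / real (Suc n)) \<le> 5 * B * (1 / real (Suc N))"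
        using B_nonneg by (intro mult_left_mono) auto
      moreover have "\<bar>Upot (1 / real (Suc m)) (x, t) - Upot (1 / real (Suc n)) (x, t)\<bar>
          \<le> 5 * B * max (1 / real (Suc m)) (1 / real (Suc n))"
        by (rule Upot_cauchy) (use t in auto)
      ultimately show "dist (Upot (1 / real (Suc m)) (x, t)) (Upot (1 / real (Suc n)) (x, t)) < e"
        unfolding dist_real_def using N by linarith
    qed
  qed
  then show ?thesis unfolding U_def using Cauchy_convergent convergent_LIMSEQ_iff by blast
qed

text \<open>The Cauchy estimate with one scale sent to 0. The explicit rate lets later arguments fix
  how small \<open>h\<close> must be, uniformly in the point.\<close>

lemma Upot_U:
  assumes h: "0 < h" and t: "0 \<le> t"
  shows "\<bar>Upot h (x, t) - U (x, t)\<bar> \<le> 5 * B * h"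
proof (rule LIMSEQ_le_const2)
  show "(\<lambda>n. \<bar>Upot h (x, t) - Upot (1 / real (Suc n)) (x, t)\<bar>) \<longlonglongrightarrow> \<bar>Upot h (x, t) - U (x, t)\<bar>"
    by (intro tendsto_intros U_tendsto t)
  obtain N where N: "1 / real (Suc N) < h" using reals_Archimedean[OF h] by (auto simp: inverse_eq_divide)
  show "\<exists>N. \<forall>n\<ge>N. \<bar>Upot h (x, t) - Upot (1 / real (Suc n)) (x, t)\<bar> \<le> 5 * B * h"
  proof (intro exI[of _ N] allI impI)
    fix n assume n: "N \<le> n"
    have "1 / real (Suc n) \<le> 1 / real (Suc N)" using n by (auto intro!: divide_left_mono)
    then have "max h (1 / real (Suc n)) = h" using N by auto
    then show "\<bar>Upot h (x, t) - Upot (1 / real (Suc n)) (x, t)\<bar> \<le> 5 * B * h"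
      using Upot_cauchy[OF h, of "1 / real (Suc n)" t x] t by simp
  qed
qed

lemma Upot_lipschitz_x:
  assumes h: "0 < h" and t: "0 \<le> t"
  shows "\<bar>Upot h (x, t) - Upot h (x', t)\<bar> \<le> B * \<bar>x - x'\<bar>"
  using lipschitz_if_DERIV_bounded[of "\<lambda>x. Upot h (x, t)" "\<lambda>x. avg h p (x, t)" B x x']
    DERIV_Upot_x[OF h t] abs_avg_le[OF borel_p p_le] by simp

lemma Upot_lipschitz_t:
  assumes h: "0 < h"
  shows "\<bar>Upot h (x, t) - Upot h (x, t')\<bar> \<le> B * \<bar>t - t'\<bar>"
  using lipschitz_if_DERIV_bounded[of "\<lambda>t. Upot h (x, t)" "\<lambda>t. - avg h q (x, t)" B t t']
    DERIV_Upot_t[OF h] abs_avg_le[OF borel_q q_le] by simp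

lemma U_lipschitz_x:
  assumes t: "0 \<le> t"
  shows "\<bar>U (x, t) - U (x', t)\<bar> \<le> B * \<bar>x - x'\<bar>"
proof (rule LIMSEQ_le_const2)
  show "(\<lambda>n. \<bar>Upot (1 / real (Suc n)) (x, t) - Upot (1 / real (Suc n)) (x', t)\<bar>) \<longlonglongrightarrow> \<bar>U (x, t) - U (x', t)\<bar>"
    by (intro tendsto_intros U_tendsto t)
qed (use Upot_lipschitz_x t in simp)

lemma U_lipschitz_t:
  assumes t: "0 \<le> t" "0 \<le> t'"
  shows "\<bar>U (x, t) - U (x, t')\<bar> \<le> B * \<bar>t - t'\<bar>"
proof (rule LIMSEQ_le_const2)
  show "(\<lambda>n. \<bar>Upot (1 / real (Suc n)) (x, t) - Upot (1 / real (Suc n)) (x, t')\<bar>) \<longlonglongrightarrow> \<bar>U (x, t) - U (x, t')\<bar>"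
    by (intro tendsto_intros U_tendsto t)
qed (use Upot_lipschitz_t in simp)

text \<open>At t = 0 the flux terms live in a layer of height \<open>h\<close>, and a smooth step
  differs from the sharp one on an interval of length \<open>h\<close>. Two sharp steps cost 2 B h
  and two flux terms 4 B h, whence the constant 6.\<close>

lemma U_initial:
  assumes x: "x \<le> x'"
  shows "U (x', 0) - U (x, 0) = (\<integral>y. p0 y * indicator {x<..x'} y \<partial>lborel)"
proof -
  let ?I = "\<integral>y. p0 y * indicator {x<..x'} y \<partial>lborel"
  have est: "\<bar>Upot h (x', 0) - Upot h (x, 0) - ?I\<bar> \<le> 6 * B * h" if h: "0 < h" for h
  proof -
    have sm: "\<bar>p0 y * (step ((y - z) / h) - indicator {z<..} y)\<bar> \<le> B" for y z
    proof -
      have "\<bar>step ((y - z) / h) - indicator {z<..} y\<bar> \<le> 1"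
        using step_range[of "(y - z) / h"] by (auto simp: indicator_def)
      from mult_mono[OF p0_le[of y] this] show ?thesis using B_nonneg by (simp add: abs_mult)
    qed
    have s0: "p0 y * (step ((y - z) / h) - indicator {z<..} y) = 0" if "y \<notin> {z..z + h}" for y z
    proof (cases "y < z")
      case True then show ?thesis using step_scaled(1)[OF h, of y z] by simp
    next
      case False
      then have "z + h \<le> y" "z < y" using that h by auto
      then show ?thesis using step_scaled(2)[OF h, of z y] by simp
    qed
    have mm: "(\<lambda>y. p0 y * (step ((y - z) / h) - indicator {z<..} y)) \<in> borel_measurable borel" for z by measurable
    note sI = integrable_Icc[OF mm sm s0]
    have se: "\<bar>\<integral>y. p0 y * (step ((y - z) / h) - indicator {z<..} y) \<partial>lborel\<bar> \<le> B * h" for z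
    proof -
      have "\<bar>\<integral>y. p0 y * (step ((y - z) / h) - indicator {z<..} y) \<partial>lborel\<bar> \<le> B * (z + h - z)"
        by (rule abs_integral_Icc[OF mm sm s0]) (use h in auto)
      then show ?thesis by simp
    qed
    have pI: "integrable lborel (\<lambda>y. p0 y * indicator {x<..x'} y)"
      by (rule integrable_Icc[of _ B x x']) (use p0_le B_nonneg in \<open>auto simp: indicator_def\<close>)
    have "(\<integral>y. p0 y * (step (y / h) - step ((y - x') / h)) \<partial>lborel) - (\<integral>y. p0 y * (step (y / h) - step ((y - x) / h)) \<partial>lborel) - ?I
       = (\<integral>y. p0 y * (step (y / h) - step ((y - x') / h)) - p0 y * (step (y / h) - step ((y - x) / h)) - p0 y * indicator {x<..x'} y \<partial>lborel)"
      using integrable_p0_steps[OF h, of 0 x] integrable_p0_steps[OF h, of 0 x'] pI by simp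
    also have "\<dots> = (\<integral>y. p0 y * (step ((y - x) / h) - indicator {x<..} y) - p0 y * (step ((y - x') / h) - indicator {x'<..} y) \<partial>lborel)"
      by (rule Bochner_Integration.integral_cong) (use x in \<open>auto simp: algebra_simps indicator_def\<close>)
    also have "\<dots> = (\<integral>y. p0 y * (step ((y - x) / h) - indicator {x<..} y) \<partial>lborel) - (\<integral>y. p0 y * (step ((y - x') / h) - indicator {x'<..} y) \<partial>lborel)"
      using sI by simp
    finally have P: "\<bar>(\<integral>y. p0 y * (step (y / h) - step ((y - x') / h)) \<partial>lborel) - (\<integral>y. p0 y * (step (y / h) - step ((y - x) / h)) \<partial>lborel) - ?I\<bar> \<le> 2 * B * h"
      using se[of x] se[of x'] by linarith
    have Q: "\<bar>\<integral>Q. q Q * (bump ((fst Q - z) / h) / h * (1 - step (snd Q / h))) \<partial>lborel\<bar> \<le> 2 * B * h" for z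
    proof -
      have "\<bar>\<integral>Q. q Q * (bump ((fst Q - z) / h) / h * (1 - step (snd Q / h))) \<partial>lborel\<bar> \<le> B * (2 / h * 1) * ((z + h - z) * (\<bar>0\<bar> + h - 0))"
      proof (rule abs_integral_rect)
        show "\<bar>q Q * (bump ((fst Q - z) / h) / h * (1 - step (snd Q / h)))\<bar> \<le> B * (2 / h * 1)" for Q
          unfolding abs_mult abs_divide using h B_nonneg
          by (intro mult_mono q_le one_minus_step_abs_le divide_mono bump_abs_le) auto
        show "q Q * (bump ((fst Q - z) / h) / h * (1 - step (snd Q / h))) = 0" if "Q \<notin> {z..z + h} \<times> {0..\<bar>0\<bar> + h}" for Q
          using q_kernel_0(1)[OF h that] by auto
      qed (use h in auto)
      then show ?thesis using h by simp
    qed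
    show ?thesis unfolding Upot_def fst_conv snd_conv diff_0_right using P Q[of x] Q[of x'] by linarith
  qed
  have "\<bar>U (x', 0) - U (x, 0) - ?I\<bar> \<le> 0"
  proof (rule LIMSEQ_le)
    show "(\<lambda>n. \<bar>Upot (1 / real (Suc n)) (x', 0) - Upot (1 / real (Suc n)) (x, 0) - ?I\<bar>) \<longlonglongrightarrow> \<bar>U (x', 0) - U (x, 0) - ?I\<bar>"
      by (intro tendsto_intros U_tendsto) simp_all
    have "(\<lambda>n. 6 * B * (1 / real (Suc n))) \<longlonglongrightarrow> 6 * B * 0"
      by (intro tendsto_intros LIMSEQ_inverse_real_of_nat[unfolded inverse_eq_divide])
    then show "(\<lambda>n. 6 * B * (1 / real (Suc n))) \<longlonglongrightarrow> 0" by simp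
    show "\<exists>N. \<forall>n\<ge>N. \<bar>Upot (1 / real (Suc n)) (x', 0) - Upot (1 / real (Suc n)) (x, 0) - ?I\<bar> \<le> 6 * B * (1 / real (Suc n))"
      by (intro exI[of _ 0] allI impI est) simp
  qed
  then show ?thesis by simp
qed

end

section \<open>Entropy solutions and viscosity supersolutions\<close>

text \<open>Squaring smooths the kink of the positive part, so that the positive part of a C^1
  function becomes an admissible test function.\<close>

lemma DERIV_pos_part_square: "((\<lambda>s. (max 0 s)\<^sup>2) has_real_derivative 2 * max 0 s) (at (s::real))"
proof -
  consider "s < 0" | "s > 0" | "s = 0" by linarith
  then show ?thesis
  proof cases
    case 1
    have "((\<lambda>s. 0) has_real_derivative 0) (at s)" by simp
    then have "((\<lambda>s. (max 0 s)\<^sup>2) has_real_derivative 0) (at s)"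
      by (rule has_field_derivative_transform_within_open[of _ _ _ "{..<0}"]) (use 1 in auto)
    then show ?thesis using 1 by simp
  next
    case 2
    have "((\<lambda>s. s\<^sup>2) has_real_derivative 2 * s) (at s)" by (rule derivative_eq_intros refl | simp)+
    then have "((\<lambda>s. (max 0 s)\<^sup>2) has_real_derivative 2 * s) (at s)"
      by (rule has_field_derivative_transform_within_open[of _ _ _ "{0<..}"]) (use 2 in auto)
    then show ?thesis using 2 by simp
  next
    case 3
    have "(\<lambda>d. ((max 0 (0 + d))\<^sup>2 - (max 0 0)\<^sup>2) / d) \<midarrow>0\<rightarrow> (0::real)"
    proof (rule Lim_null_comparison[of _ "\<lambda>d. \<bar>d\<bar>"])
      show "\<forall>\<^sub>F d in at 0. norm (((max 0 (0 + d))\<^sup>2 - (max 0 0)\<^sup>2) / d) \<le> \<bar>d\<bar>"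
        by (rule always_eventually) (auto simp: max_def power2_eq_square)
      show "(\<lambda>d::real. \<bar>d\<bar>) \<midarrow>0\<rightarrow> 0" by (rule tendsto_rabs_zero) simp
    qed
    then show ?thesis using 3 by (simp add: DERIV_def)
  qed
qed

text \<open>The cubic terms of the entropy production cancel, and its leading part \<open>- z^4 / 12\<close> has a sign.
  The constant \<open>l\<close> added to the entropy makes the left-hand side negative even at \<open>z = 0\<close>.\<close>

lemma entropy_production_le:
  fixes c b k z Z l w e1 e2 :: real
  assumes c: "0 < c" and b: "b + k\<^sup>2 / 2 = - 2 * c" and z: "\<bar>z\<bar> \<le> Z" and l: "l = 4 * c\<^sup>2 / (2 * c + k\<^sup>2)"
    and e: "\<bar>e1\<bar> \<le> w" "\<bar>e2\<bar> \<le> w"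
  shows "(z\<^sup>2 / 2 + l) * (b + e1 + (k + z)\<^sup>2 / 2) + (z^3 / 3 + k * z\<^sup>2 / 2) * (k + e2 - (k + z))
    \<le> - c * l + w * ((Z\<^sup>2 / 2 + l) + (Z^3 / 3 + \<bar>k\<bar> * Z\<^sup>2 / 2))"
proof -
  have l0: "0 < l" using c by (simp add: l add_pos_nonneg)
  have bb: "b = - 2 * c - k\<^sup>2 / 2" using b by linarith
  have eq: "(z\<^sup>2 / 2 + l) * (b + e1 + (k + z)\<^sup>2 / 2) + (z^3 / 3 + k * z\<^sup>2 / 2) * (k + e2 - (k + z))
    = - (z\<^sup>2)\<^sup>2 / 12 - c * z\<^sup>2 + l * (z\<^sup>2 / 2 + k * z) - 2 * c * l
      + ((z\<^sup>2 / 2 + l) * e1 + (z^3 / 3 + k * z\<^sup>2 / 2) * e2)"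
    unfolding bb by (simp add: field_simps power2_eq_square power3_eq_cube)
  \<comment> \<open>The positive contribution of \<open>l\<close> is absorbed by Young's inequality.
    The value of \<open>l\<close> is tuned to l (2 c + k^2) = 4 c^2, which gives z^2 exactly the
    coefficient c available from the term - c z^2.\<close>
  have lb: "l * (z\<^sup>2 / 2 + k * z) \<le> l * c + c * z\<^sup>2"
  proof -
    have "0 \<le> (2 * c - k * z)\<^sup>2" by simp
    then have "k * z \<le> c + k\<^sup>2 * z\<^sup>2 / (4 * c)" using c by (simp add: power2_eq_square field_simps)
    then have "l * (z\<^sup>2 / 2 + k * z) \<le> l * (z\<^sup>2 / 2 + (c + k\<^sup>2 * z\<^sup>2 / (4 * c)))"
      using l0 by (intro mult_left_mono) auto
    also have "\<dots> = l * c + z\<^sup>2 * (l * (2 * c + k\<^sup>2)) / (4 * c)" using c by (simp add: field_simps)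
    also have "l * (2 * c + k\<^sup>2) = 4 * c\<^sup>2" using c by (simp add: l add_pos_nonneg less_imp_neq[symmetric])
    finally show ?thesis using c by (simp add: power2_eq_square ac_simps)
  qed
  have Z0: "0 \<le> Z" using z by linarith
  have z2: "z\<^sup>2 \<le> Z\<^sup>2" using z Z0 by (simp add: abs_le_square_iff[symmetric])
  have z3: "\<bar>z^3\<bar> \<le> Z^3" unfolding power_abs by (rule power_mono[OF z]) simp
  have "(z\<^sup>2 / 2 + l) * e1 \<le> (Z\<^sup>2 / 2 + l) * w"
  proof -
    have "(z\<^sup>2 / 2 + l) * e1 \<le> (z\<^sup>2 / 2 + l) * w" using l0 e(1) by (intro mult_left_mono) auto
    also have "\<dots> \<le> (Z\<^sup>2 / 2 + l) * w" using z2 e(1) by (intro mult_right_mono) auto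
    finally show ?thesis .
  qed
  moreover have "(z^3 / 3 + k * z\<^sup>2 / 2) * e2 \<le> (Z^3 / 3 + \<bar>k\<bar> * Z\<^sup>2 / 2) * w"
  proof -
    have "\<bar>k * z\<^sup>2 / 2\<bar> \<le> \<bar>k\<bar> * Z\<^sup>2 / 2" using z2 by (simp add: abs_mult mult_left_mono)
    moreover have "\<bar>z^3 / 3\<bar> \<le> Z^3 / 3" using z3 by simp
    ultimately have "\<bar>z^3 / 3 + k * z\<^sup>2 / 2\<bar> \<le> Z^3 / 3 + \<bar>k\<bar> * Z\<^sup>2 / 2" by linarith
    then have "\<bar>z^3 / 3 + k * z\<^sup>2 / 2\<bar> * \<bar>e2\<bar> \<le> (Z^3 / 3 + \<bar>k\<bar> * Z\<^sup>2 / 2) * w"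
      by (rule mult_mono) (use e Z0 in auto)
    then have "\<bar>(z^3 / 3 + k * z\<^sup>2 / 2) * e2\<bar> \<le> (Z^3 / 3 + \<bar>k\<bar> * Z\<^sup>2 / 2) * w" by (simp only: abs_mult)
    then show ?thesis by linarith
  qed
  moreover have "0 \<le> (z\<^sup>2)\<^sup>2 / 12" by simp
  moreover have "w * ((Z\<^sup>2 / 2 + l) + (Z^3 / 3 + \<bar>k\<bar> * Z\<^sup>2 / 2)) = (Z\<^sup>2 / 2 + l) * w + (Z^3 / 3 + \<bar>k\<bar> * Z\<^sup>2 / 2) * w"
    by (simp add: algebra_simps)
  moreover have "l * c = c * l" by simp
  ultimately show ?thesis unfolding eq using lb by linarith
qed

lemma mult_le_mult_abs:
  fixes a b K :: real
  assumes "\<bar>a\<bar> \<le> K" shows "a * b \<le> K * \<bar>b\<bar>"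
proof -
  have "a * b \<le> \<bar>a\<bar> * \<bar>b\<bar>" by (metis abs_ge_self abs_mult)
  also have "\<dots> \<le> K * \<bar>b\<bar>" using assms by (rule mult_right_mono) simp
  finally show ?thesis .
qed

text \<open>The entropies are parabolas centred at \<open>k\<close>, later the slope of a touching
  function, and raised by a constant \<open>l\<close>, which leaves the flux unchanged. The flux is
  expanded in powers of u - k. Test functions vanish near t = 0, so no initial term appears.\<close>

locale burgers_entropy = balance_law u "\<lambda>P. (u P)\<^sup>2 / 2" u0 B
  for u :: "real \<times> real \<Rightarrow> real" and u0 :: "real \<Rightarrow> real" and B :: real +
  assumes entropy: "\<And>k l \<phi> \<phi>x \<phi>t e. C1_test \<phi> \<phi>x \<phi>t \<Longrightarrow> (\<And>P. 0 \<le> \<phi> P) \<Longrightarrow> 0 < e \<Longrightarrow>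
    (\<And>x t. t \<le> e \<Longrightarrow> \<phi> (x, t) = 0) \<Longrightarrow>
    0 \<le> (\<integral>P. ((u P - k)\<^sup>2 / 2 + l) * \<phi>t P + ((u P - k)^3 / 3 + k * (u P - k)\<^sup>2 / 2) * \<phi>x P \<partial>lborel)"
begin

lemma continuous_Upot: "0 < h \<Longrightarrow> continuous_on {P. 0 \<le> snd P} (Upot h)"
  and continuous_U: "continuous_on {P. 0 \<le> snd P} U"
proof -
  have *: "continuous_on {P. 0 \<le> snd P} F"
    if "\<And>x x' t. 0 \<le> t \<Longrightarrow> \<bar>F (x, t) - F (x', t)\<bar> \<le> B * \<bar>x - x'\<bar>"
      "\<And>x t t'. 0 \<le> t \<Longrightarrow> 0 \<le> t' \<Longrightarrow> \<bar>F (x, t) - F (x, t')\<bar> \<le> B * \<bar>t - t'\<bar>" for F :: "real \<times> real \<Rightarrow> real"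
  proof (rule lipschitz_on_continuous_on[of "2 * B"], rule lipschitz_onI)
    fix P Q assume "P \<in> {P::real\<times>real. 0 \<le> snd P}" "Q \<in> {P::real\<times>real. 0 \<le> snd P}"
    then obtain x t x' t' where P: "P = (x, t)" "Q = (x', t')" "0 \<le> t" "0 \<le> t'" by (cases P; cases Q) auto
    have "\<bar>x - x'\<bar> \<le> dist P Q" "\<bar>t - t'\<bar> \<le> dist P Q"
      unfolding P using dist_fst_le[of P Q] dist_snd_le[of P Q] by (auto simp: P dist_real_def)
    then have "B * \<bar>x - x'\<bar> \<le> B * dist P Q" "B * \<bar>t - t'\<bar> \<le> B * dist P Q" using B_nonneg by (auto intro: mult_left_mono)
    moreover have "\<bar>F (x, t) - F (x', t')\<bar> \<le> B * \<bar>x - x'\<bar> + B * \<bar>t - t'\<bar>"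
      using that(1)[OF P(3), of x x'] that(2)[OF P(3,4), of x'] by linarith
    ultimately show "dist (F P) (F Q) \<le> 2 * B * dist P Q" unfolding P dist_real_def by linarith
  qed (use B_nonneg in simp)
  show "0 < h \<Longrightarrow> continuous_on {P. 0 \<le> snd P} (Upot h)" by (rule *) (use Upot_lipschitz_x Upot_lipschitz_t in auto)
  show "continuous_on {P. 0 \<le> snd P} U" by (rule *) (use U_lipschitz_x U_lipschitz_t in auto)
qed

text \<open>If a smooth function touched \<open>U\<close> from below at a point where the inequality fails, the square of
  the height by which the slightly lifted function exceeds the mollified potential would be a test function
  contradicting the entropy inequality.\<close>

lemma viscosity_supersolution:
  fixes x0 t0 r0 :: real and \<zeta> \<zeta>x \<zeta>t :: "real \<times> real \<Rightarrow> real"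
  assumes r0: "0 < r0" "r0 < t0"
    and \<zeta>x: "\<And>x t. 0 < t \<Longrightarrow> ((\<lambda>y. \<zeta> (y, t)) has_real_derivative \<zeta>x (x, t)) (at x)"
    and \<zeta>t: "\<And>x t. 0 < t \<Longrightarrow> ((\<lambda>s. \<zeta> (x, s)) has_real_derivative \<zeta>t (x, t)) (at t)"
    and cont: "continuous_on {P. 0 < snd P} \<zeta>" "continuous_on {P. 0 < snd P} \<zeta>x" "continuous_on {P. 0 < snd P} \<zeta>t"
    and touch: "\<And>x t. (x - x0)\<^sup>2 + (t - t0)\<^sup>2 < r0\<^sup>2 \<Longrightarrow> \<zeta> (x, t) - U (x, t) \<le> \<zeta> (x0, t0) - U (x0, t0)"
  shows "0 \<le> \<zeta>t (x0, t0) + (\<zeta>x (x0, t0))\<^sup>2 / 2"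
proof (rule ccontr)
  define k b c where "k = \<zeta>x (x0, t0)" and "b = \<zeta>t (x0, t0)" and "c = - (b + k\<^sup>2 / 2) / 2"
  assume "\<not> ?thesis"
  then have c: "0 < c" and bc: "b + k\<^sup>2 / 2 = - 2 * c" by (auto simp: c_def k_def b_def)
  define l Z where "l = 4 * c\<^sup>2 / (2 * c + k\<^sup>2)" and "Z = B + \<bar>k\<bar>"
  have l: "0 < l" using c by (simp add: l_def add_pos_nonneg)
  have Z: "0 \<le> Z" using B_nonneg by (simp add: Z_def)
  define K where "K = (Z\<^sup>2 / 2 + l) + (Z^3 / 3 + \<bar>k\<bar> * Z\<^sup>2 / 2)"
  have K: "0 < K" using l Z unfolding K_def by (intro add_pos_nonneg add_nonneg_nonneg add_nonneg_pos) auto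
  \<comment> \<open>The tolerance for the gradient in the ball: w K = c l / 2, so that replacing it
    by its value at the centre costs half of the gain c l.\<close>
  define w where "w = c * l / (2 * K)"
  have w: "0 < w" "w * K = c * l / 2" using c l K by (auto simp: w_def)
  define N where "N P = (fst P - x0)\<^sup>2 + (snd P - t0)\<^sup>2" for P :: "real \<times> real"
  have N_cont: "continuous_on S N" for S unfolding N_def[abs_def] by (intro continuous_intros)
  have N_dist: "N P = (dist P (x0, t0))\<^sup>2" for P
    by (cases P) (simp add: N_def dist_prod_def dist_real_def)
  \<comment> \<open>The gradient of \<open>\<zeta> - N\<close>. Subtracting the squared distance
    \<open>N\<close> makes the contact strict and localizes the argument, without changing the
    gradient at the centre.\<close>
  define \<xi>x \<xi>t where "\<xi>x P = \<zeta>x P - 2 * (fst P - x0)" and "\<xi>t P = \<zeta>t P - 2 * (snd P - t0)" for P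
  have open_H: "open {P :: real \<times> real. 0 < snd P}" by (intro open_Collect_less continuous_intros)
  have \<xi>_cont: "continuous_on {P. 0 < snd P} \<xi>x" "continuous_on {P. 0 < snd P} \<xi>t"
    unfolding \<xi>x_def[abs_def] \<xi>t_def[abs_def] by (intro continuous_intros cont)+
  have t0: "0 < t0" using r0 by simp
  have near: "\<exists>d>0. \<forall>P. dist P (x0, t0) < d \<longrightarrow> \<bar>F P - F (x0, t0)\<bar> \<le> e"
    if F: "continuous_on {P. 0 < snd P} F" and e: "0 < e" for F :: "real \<times> real \<Rightarrow> real" and e
  proof -
    have "isCont F (x0, t0)" using F open_H t0 by (simp add: continuous_on_eq_continuous_at)
    then obtain d where "d > 0" "\<And>P. dist P (x0, t0) < d \<Longrightarrow> dist (F P) (F (x0, t0)) < e"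
      using e unfolding continuous_at_eps_delta by blast
    then show ?thesis by (intro exI[of _ d]) (auto simp: dist_real_def less_imp_le)
  qed
  obtain d1 where d1: "0 < d1" "\<And>P. dist P (x0, t0) < d1 \<Longrightarrow> \<bar>\<xi>x P - \<xi>x (x0, t0)\<bar> \<le> w" using near[OF \<xi>_cont(1) w(1)] by blast
  obtain d2 where d2: "0 < d2" "\<And>P. dist P (x0, t0) < d2 \<Longrightarrow> \<bar>\<xi>t P - \<xi>t (x0, t0)\<bar> \<le> w" using near[OF \<xi>_cont(2) w(1)] by blast
  define r where "r = min r0 (min d1 d2)"
  have r: "0 < r" "r \<le> r0" "r \<le> d1" "r \<le> d2" using r0 d1 d2 by (auto simp: r_def)
  define A where "A = {P. N P < r\<^sup>2}"
  have A_dist: "P \<in> A \<longleftrightarrow> dist P (x0, t0) < r" for P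
    unfolding A_def N_dist mem_Collect_eq using r power_mono_iff[of r "dist P (x0, t0)" 2] by (simp add: not_le[symmetric])
  have A_rect: "x0 - r \<le> fst P \<and> fst P \<le> x0 + r \<and> t0 - r \<le> snd P \<and> snd P \<le> t0 + r" if "P \<in> A" for P
    using that[unfolded A_dist] dist_fst_le[of P "(x0, t0)"] dist_snd_le[of P "(x0, t0)"] by (auto simp: dist_real_def)
  have A_pos: "0 < snd P" if "P \<in> A" for P using A_rect[OF that] r r0 by auto
  have A_open: "open A" unfolding A_def by (intro open_Collect_less N_cont continuous_intros)
  have \<xi>: "\<bar>\<xi>x P - k\<bar> \<le> w" "\<bar>\<xi>t P - b\<bar> \<le> w" if "P \<in> A" for P
    using that[unfolded A_dist] r d1(2)[of P] d2(2)[of P] by (auto simp: \<xi>x_def \<xi>t_def k_def b_def)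
  \<comment> \<open>The lift is small compared with r^2: by \<open>S_le\<close> the excess
    \<open>S\<close> is at most 3/2 \<delta> - N, with \<delta> / 2 spent on the mollification,
    hence negative once N > 3/8 r^2, well inside the ball \<open>A\<close>.\<close>
  define \<delta> where "\<delta> = r\<^sup>2 / 4"
  have \<delta>: "0 < \<delta>" using r by (simp add: \<delta>_def)
  define S where "S h P = \<delta> + (\<zeta> P - \<zeta> (x0, t0)) - N P - (Upot h P - U (x0, t0))" for h P
  have S_le: "S h P \<le> 3 / 2 * \<delta> - N P" if "P \<in> A" "0 < h" "5 * B * h \<le> \<delta> / 2" for h P
  proof -
    obtain x t where P: "P = (x, t)" by (cases P)
    have "N P < r0\<^sup>2" using that(1) power_mono[OF r(2) less_imp_le[OF r(1)], of 2] unfolding A_def by simp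
    then have "\<zeta> P - U P \<le> \<zeta> (x0, t0) - U (x0, t0)" using touch[of x t] by (simp add: P N_def)
    moreover have "\<bar>Upot h P - U P\<bar> \<le> \<delta> / 2" using Upot_U[OF that(2), of t x] A_pos[OF that(1)] that(3) by (simp add: P)
    ultimately show ?thesis unfolding S_def by linarith
  qed
  have "continuous_on {P. 0 < snd P} (\<lambda>P. \<delta> + (\<zeta> P - \<zeta> (x0, t0)) - N P - (U P - U (x0, t0)))"
    by (intro continuous_intros cont N_cont continuous_on_subset[OF continuous_U]) auto
  from near[OF this, of "\<delta> / 4"] \<delta>
  obtain d3 where d3: "0 < d3" "\<And>P. dist P (x0, t0) < d3 \<Longrightarrow> \<bar>\<delta> + (\<zeta> P - \<zeta> (x0, t0)) - N P - (U P - U (x0, t0)) - \<delta>\<bar> \<le> \<delta> / 4"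
    by (auto simp: N_def)
  define r2 where "r2 = min r d3 / 3"
  have r2: "0 < r2" using r d3 by (simp add: r2_def)
  define R2 where "R2 = {x0 - r2..x0 + r2} \<times> {t0 - r2..t0 + r2}"
  have R2: "dist P (x0, t0) < r" "dist P (x0, t0) < d3" if "P \<in> R2" for P
  proof -
    have "\<bar>fst P - x0\<bar> \<le> r2" "\<bar>snd P - t0\<bar> \<le> r2" using that by (auto simp: R2_def abs_le_iff)
    moreover have "dist P (x0, t0) \<le> \<bar>fst P - x0\<bar> + \<bar>snd P - t0\<bar>"
      using norm_Pair_le[of "fst P - x0" "snd P - t0"] by (cases P) (simp add: dist_norm)
    ultimately have "dist P (x0, t0) \<le> 2 * r2" by linarith
    then show "dist P (x0, t0) < r" "dist P (x0, t0) < d3" using r d3 by (auto simp: r2_def)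
  qed
  \<comment> \<open>On a square whose size does not depend on \<open>h\<close> the excess stays
    above \<delta> / 4: this is the lift less \<delta> / 4 for the variation of the limit function
    and \<delta> / 2 for the mollification.\<close>
  have S_ge: "\<delta> / 4 \<le> S h P" if "P \<in> R2" "0 < h" "5 * B * h \<le> \<delta> / 2" for h P
  proof -
    obtain x t where P: "P = (x, t)" by (cases P)
    have "0 \<le> t" using A_pos[of P] A_dist[of P] R2(1)[OF that(1)] by (simp add: P)
    then have "\<bar>Upot h P - U P\<bar> \<le> \<delta> / 2" using Upot_U[OF that(2), of t x] that(3) by (simp add: P)
    then show ?thesis using d3(2)[OF R2(2)[OF that(1)]] unfolding S_def by linarith
  qed
  let ?R = "{x0 - r..x0 + r} \<times> {t0 - r..t0 + r} :: (real \<times> real) set"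
  let ?f = "\<lambda>P. (u P)\<^sup>2 / 2"
  define eu ef where "eu h = (\<integral>P. indicator ?R P * \<bar>avg h u P - u P\<bar> \<partial>lborel)"
    and "ef h = (\<integral>P. indicator ?R P * \<bar>avg h ?f P - ?f P\<bar> \<partial>lborel)" for h
  \<comment> \<open>The negative production on \<open>R2\<close>, a square of area 4 r2^2, can be
    compensated only by the averaging errors, whose weight is bounded through 2 S \<le> 3 \<delta>.
    The left-hand side does not depend on \<open>h\<close>, while the errors vanish in the
    limit.\<close>
  have main: "c * l * \<delta> * r2\<^sup>2 \<le> 3 * \<delta> * K * (ef h + eu h)" if h: "0 < h" "5 * B * h \<le> \<delta> / 2" for h
  proof -
    define \<phi> where "\<phi> P = (if P \<in> A then (max 0 (S h P))\<^sup>2 else 0)" for P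
    define \<phi>x where "\<phi>x P = (if P \<in> A then 2 * max 0 (S h P) * (\<xi>x P - avg h u P) else 0)" for P
    define \<phi>t where "\<phi>t P = (if P \<in> A then 2 * max 0 (S h P) * (\<xi>t P + avg h ?f P) else 0)" for P
    \<comment> \<open>\<open>A\<close> and \<open>A'\<close> are open and cover the plane, and the
      test function is 0 on all of \<open>A'\<close>; this glues the definition by cases into a C^1
      function.\<close>
    define A' where "A' = {P. 3 / 2 * \<delta> < N P}"
    have A'_open: "open A'" unfolding A'_def by (intro open_Collect_less N_cont continuous_intros)
    have "P \<in> A \<or> P \<in> A'" for P
    proof (cases "N P < r\<^sup>2")
      case False
      moreover have "0 < r\<^sup>2" using r by simp
      ultimately have "3 / 2 * (r\<^sup>2 / 4) < N P" by linarith
      then show ?thesis by (simp add: A'_def \<delta>_def)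
    qed (simp add: A_def)
    then have AA': "A \<union> A' = UNIV" by blast
    have S_neg: "max 0 (S h P) = 0" if "P \<in> A" "P \<in> A'" for P
      using S_le[OF that(1) h] that(2) by (simp add: A'_def)
    have zero': "\<phi> P = 0" "\<phi>x P = 0" "\<phi>t P = 0" if "P \<in> A'" for P
      using S_neg[OF _ that] by (auto simp: \<phi>_def \<phi>x_def \<phi>t_def)
    have S_cont: "continuous_on A (S h)"
      unfolding S_def[abs_def] using A_pos
      by (intro continuous_intros N_cont continuous_on_subset[OF cont(1)] continuous_on_subset[OF continuous_Upot[OF h(1)]]) (auto intro: less_imp_le)
    have avg_cont: "continuous_on S (avg h u)" "continuous_on S (avg h ?f)" for S
      using continuous_avg[OF borel_p p_le h(1)] continuous_avg[OF borel_q q_le h(1)] continuous_on_subset by blast+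
    have Fcont: "continuous_on UNIV \<phi>x" "continuous_on UNIV \<phi>t"
    proof -
      have "continuous_on A (\<lambda>P. 2 * max 0 (S h P) * (\<xi>x P - avg h u P))" "continuous_on A (\<lambda>P. 2 * max 0 (S h P) * (\<xi>t P + avg h ?f P))"
        using A_pos by (intro continuous_intros S_cont avg_cont continuous_on_subset[OF \<xi>_cont(1)] continuous_on_subset[OF \<xi>_cont(2)]; auto)+
      then have "continuous_on A \<phi>x" "continuous_on A \<phi>t"
        by (auto simp: \<phi>x_def \<phi>t_def cong: continuous_on_cong)
      moreover have "continuous_on A' \<phi>x" "continuous_on A' \<phi>t"
        using continuous_on_cong[OF refl, of A' \<phi>x "\<lambda>_. 0"] continuous_on_cong[OF refl, of A' \<phi>t "\<lambda>_. 0"] zero' by auto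
      ultimately have "continuous_on (A \<union> A') \<phi>x" "continuous_on (A \<union> A') \<phi>t"
        by (auto intro!: continuous_on_open_Un A_open A'_open)
      then show "continuous_on UNIV \<phi>x" "continuous_on UNIV \<phi>t" by (auto simp: AA')
    qed
    have C1: "C1_test \<phi> \<phi>x \<phi>t" unfolding C1_test_def
    proof (intro conjI allI Fcont)
      fix x t :: real
      have opx: "open {y. (y, t) \<in> A}" "open {y. (y, t) \<in> A'}" "open {s. (x, s) \<in> A}" "open {s. (x, s) \<in> A'}"
        unfolding A_def A'_def mem_Collect_eq N_def by (intro open_Collect_less continuous_intros)+
      show "((\<lambda>y. \<phi> (y, t)) has_real_derivative \<phi>x (x, t)) (at x)"
      proof (cases "(x, t) \<in> A")
        case True
        have t: "0 < t" using A_pos[OF True] by simp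
        have dS: "((\<lambda>y. S h (y, t)) has_real_derivative \<xi>x (x, t) - avg h u (x, t)) (at x)"
          unfolding S_def \<xi>x_def N_def fst_conv snd_conv using t
          by (auto intro!: derivative_eq_intros \<zeta>x DERIV_Upot_x[OF h(1)])
        have "((\<lambda>y. (max 0 (S h (y, t)))\<^sup>2) has_real_derivative 2 * max 0 (S h (x, t)) * (\<xi>x (x, t) - avg h u (x, t))) (at x)"
          by (rule DERIV_chain2[OF DERIV_pos_part_square dS])
        then have "((\<lambda>y. \<phi> (y, t)) has_real_derivative 2 * max 0 (S h (x, t)) * (\<xi>x (x, t) - avg h u (x, t))) (at x)"
          by (rule has_field_derivative_transform_within_open[OF _ opx(1)]) (use True in \<open>auto simp: \<phi>_def\<close>)
        then show ?thesis using True by (simp add: \<phi>x_def)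
      next
        case False
        then have A': "(x, t) \<in> A'" using AA' by blast
        have "((\<lambda>y. 0) has_real_derivative 0) (at x)" by simp
        then have "((\<lambda>y. \<phi> (y, t)) has_real_derivative 0) (at x)"
          by (rule has_field_derivative_transform_within_open[OF _ opx(2)]) (use A' zero' in auto)
        then show ?thesis using A' zero' by simp
      qed
      show "((\<lambda>s. \<phi> (x, s)) has_real_derivative \<phi>t (x, t)) (at t)"
      proof (cases "(x, t) \<in> A")
        case True
        have t: "0 < t" using A_pos[OF True] by simp
        have dS: "((\<lambda>s. S h (x, s)) has_real_derivative \<xi>t (x, t) + avg h ?f (x, t)) (at t)"
          unfolding S_def \<xi>t_def N_def fst_conv snd_conv using t
          by (auto intro!: derivative_eq_intros \<zeta>t DERIV_Upot_t[OF h(1)])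
        have "((\<lambda>s. (max 0 (S h (x, s)))\<^sup>2) has_real_derivative 2 * max 0 (S h (x, t)) * (\<xi>t (x, t) + avg h ?f (x, t))) (at t)"
          by (rule DERIV_chain2[OF DERIV_pos_part_square dS])
        then have "((\<lambda>s. \<phi> (x, s)) has_real_derivative 2 * max 0 (S h (x, t)) * (\<xi>t (x, t) + avg h ?f (x, t))) (at t)"
          by (rule has_field_derivative_transform_within_open[OF _ opx(3)]) (use True in \<open>auto simp: \<phi>_def\<close>)
        then show ?thesis using True by (simp add: \<phi>t_def)
      next
        case False
        then have A': "(x, t) \<in> A'" using AA' by blast
        have "((\<lambda>s. 0) has_real_derivative 0) (at t)" by simp
        then have "((\<lambda>s. \<phi> (x, s)) has_real_derivative 0) (at t)"
          by (rule has_field_derivative_transform_within_open[OF _ opx(4)]) (use A' zero' in auto)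
        then show ?thesis using A' zero' by simp
      qed
    next
      show "\<exists>R. \<forall>x t. 0 \<le> t \<longrightarrow> R < \<bar>x\<bar> \<or> R < t \<longrightarrow> \<phi> (x, t) = 0"
      proof (intro exI[of _ "\<bar>x0\<bar> + t0 + r"] allI impI)
        fix x t assume "\<bar>x0\<bar> + t0 + r < \<bar>x\<bar> \<or> \<bar>x0\<bar> + t0 + r < t"
        then have "(x, t) \<notin> A" using A_rect[of "(x, t)"] t0 by auto
        then show "\<phi> (x, t) = 0" by (simp add: \<phi>_def)
      qed
    qed
    define \<eta> q where "\<eta> P = (u P - k)\<^sup>2 / 2 + l" and "q P = (u P - k)^3 / 3 + k * (u P - k)\<^sup>2 / 2" for P
    have [measurable]: "\<eta> \<in> borel_measurable borel" "q \<in> borel_measurable borel"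
      unfolding \<eta>_def[abs_def] q_def[abs_def] by measurable
    have [measurable]: "\<phi>x \<in> borel_measurable borel" "\<phi>t \<in> borel_measurable borel"
      by (intro borel_measurable_continuous_onI Fcont)+
    have z: "\<bar>u P - k\<bar> \<le> Z" for P using p_le[of P] by (simp add: Z_def)
    have z2: "(u P - k)\<^sup>2 \<le> Z\<^sup>2" for P using power_mono[OF z, of P 2] by simp
    have z3: "\<bar>(u P - k)^3\<bar> \<le> Z^3" for P unfolding power_abs by (rule power_mono[OF z]) simp
    have \<eta>K: "\<bar>\<eta> P\<bar> \<le> K" for P
    proof -
      have "0 \<le> \<eta> P" "\<eta> P \<le> Z\<^sup>2 / 2 + l" unfolding \<eta>_def using z2[of P] l by auto
      moreover have "0 \<le> Z^3 / 3 + \<bar>k\<bar> * Z\<^sup>2 / 2" using Z by simp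
      ultimately show ?thesis unfolding K_def by linarith
    qed
    have qK: "\<bar>q P\<bar> \<le> K" for P
    proof -
      have "\<bar>k * (u P - k)\<^sup>2 / 2\<bar> \<le> \<bar>k\<bar> * Z\<^sup>2 / 2" using z2[of P] by (simp add: abs_mult mult_left_mono)
      moreover have "\<bar>(u P - k)^3 / 3\<bar> \<le> Z^3 / 3" using z3[of P] by simp
      moreover have "0 \<le> Z\<^sup>2 / 2 + l" using l by simp
      ultimately show ?thesis unfolding K_def q_def by linarith
    qed
    define Ht where "Ht P = \<eta> P * \<phi>t P + q P * \<phi>x P" for P
    have "0 \<le> (\<integral>P. Ht P \<partial>lborel)"
      unfolding Ht_def \<eta>_def q_def
    proof (rule entropy[OF C1])
      show "0 \<le> \<phi> P" for P by (simp add: \<phi>_def)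
      show "0 < (t0 - r) / 2" using r r0 by simp
      show "\<phi> (x, t) = 0" if "t \<le> (t0 - r) / 2" for x t
      proof -
        have "(x, t) \<notin> A" using A_rect[of "(x, t)"] that r r0 by auto
        then show ?thesis by (simp add: \<phi>_def)
      qed
    qed
    define D where "D P = - (c * l * \<delta> / 4) * indicator R2 P
      + 3 * \<delta> * K * (indicator ?R P * \<bar>avg h ?f P - ?f P\<bar> + indicator ?R P * \<bar>avg h u P - u P\<bar>)" for P
    have S_pos_le: "0 \<le> max 0 (S h P)" "max 0 (S h P) \<le> 3 / 2 * \<delta>" if "P \<in> A" for P
    proof -
      have "0 \<le> N P" by (simp add: N_def)
      then have "S h P \<le> 3 / 2 * \<delta>" using S_le[OF that h] by linarith
      then show "0 \<le> max 0 (S h P)" "max 0 (S h P) \<le> 3 / 2 * \<delta>" using \<delta> by auto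
    qed
    have HD: "Ht P \<le> D P" for P
    proof (cases "P \<in> A")
      case True
      let ?E = "\<bar>avg h ?f P - ?f P\<bar> + \<bar>avg h u P - u P\<bar>"
      have R: "P \<in> ?R" using A_rect[OF True] by (simp add: mem_Times_iff)
      \<comment> \<open>The production estimate holds for \<open>u\<close> and its exact flux; the
        gradient of the excess contains their averages instead, and the two differ by the errors
        collected in \<open>?E\<close>.\<close>
      have "\<eta> P * (\<xi>t P + ?f P) + q P * (\<xi>x P - u P) \<le> - c * l + w * K"
        using entropy_production_le[OF c bc z[of P] l_def \<xi>(2,1)[OF True]] by (simp add: \<eta>_def q_def K_def)
      moreover have "\<eta> P * (avg h ?f P - ?f P) \<le> K * \<bar>avg h ?f P - ?f P\<bar>"
        by (rule mult_le_mult_abs[OF \<eta>K])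
      moreover have "- q P * (avg h u P - u P) \<le> K * \<bar>avg h u P - u P\<bar>"
        using qK[of P] by (intro mult_le_mult_abs) simp
      ultimately have br: "\<eta> P * (\<xi>t P + avg h ?f P) + q P * (\<xi>x P - avg h u P) \<le> - (c * l / 2) + K * ?E"
        using w(2) by (simp add: algebra_simps)
      have "Ht P = 2 * max 0 (S h P) * (\<eta> P * (\<xi>t P + avg h ?f P) + q P * (\<xi>x P - avg h u P))"
        using True by (simp add: Ht_def \<phi>t_def \<phi>x_def algebra_simps)
      also have "\<dots> \<le> 2 * max 0 (S h P) * (- (c * l / 2) + K * ?E)"
        by (intro mult_left_mono br) simp
      also have "\<dots> = - (c * l) * max 0 (S h P) + 2 * max 0 (S h P) * (K * ?E)" by (simp add: algebra_simps)
      also have "2 * max 0 (S h P) * (K * ?E) \<le> 3 * \<delta> * (K * ?E)"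
        using S_pos_le[OF True] K by (intro mult_right_mono) auto
      also have "- (c * l) * max 0 (S h P) \<le> - (c * l * \<delta> / 4) * indicator R2 P"
      proof (cases "P \<in> R2")
        case True
        have "c * l * (\<delta> / 4) \<le> c * l * max 0 (S h P)"
          using S_ge[OF True h] c l by (intro mult_left_mono) auto
        then show ?thesis using True by simp
      qed (use c l in auto)
      finally show ?thesis unfolding D_def using R by (simp add: algebra_simps)
    next
      case False
      then have "P \<notin> R2" using R2(1) A_dist by blast
      then show ?thesis using False \<delta> K by (simp add: Ht_def \<phi>t_def \<phi>x_def D_def)
    qed
    have Ht_int: "integrable lborel Ht"
    proof (rule integrable_rect[of _ "K * (3 * \<delta> * (\<bar>b\<bar> + w + B)) + K * (3 * \<delta> * (\<bar>k\<bar> + w + B))" "x0 - r" "x0 + r" "t0 - r" "t0 + r"])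
      show "Ht \<in> borel_measurable borel" unfolding Ht_def[abs_def] by measurable
      show "Ht P = 0" if "P \<notin> ?R" for P
        using that A_rect[of P] by (cases P) (auto simp: Ht_def \<phi>t_def \<phi>x_def)
      show "\<bar>Ht P\<bar> \<le> K * (3 * \<delta> * (\<bar>b\<bar> + w + B)) + K * (3 * \<delta> * (\<bar>k\<bar> + w + B))" for P
      proof -
        have ft: "\<bar>\<phi>t P\<bar> \<le> 3 * \<delta> * (\<bar>b\<bar> + w + B)"
        proof (cases "P \<in> A")
          case True
          have "\<bar>\<xi>t P + avg h ?f P\<bar> \<le> \<bar>b\<bar> + w + B" using \<xi>(2)[OF True] abs_avg_le[OF borel_q q_le, of h P] by linarith
          then have "\<bar>2 * max 0 (S h P)\<bar> * \<bar>\<xi>t P + avg h ?f P\<bar> \<le> 3 * \<delta> * (\<bar>b\<bar> + w + B)"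
            using S_pos_le[OF True] \<delta> by (intro mult_mono) auto
          then show ?thesis using True by (simp add: \<phi>t_def abs_mult)
        qed (use \<delta> w B_nonneg in \<open>simp add: \<phi>t_def\<close>)
        have fx: "\<bar>\<phi>x P\<bar> \<le> 3 * \<delta> * (\<bar>k\<bar> + w + B)"
        proof (cases "P \<in> A")
          case True
          have "\<bar>\<xi>x P - avg h u P\<bar> \<le> \<bar>k\<bar> + w + B" using \<xi>(1)[OF True] abs_avg_le[OF borel_p p_le, of h P] by linarith
          then have "\<bar>2 * max 0 (S h P)\<bar> * \<bar>\<xi>x P - avg h u P\<bar> \<le> 3 * \<delta> * (\<bar>k\<bar> + w + B)"
            using S_pos_le[OF True] \<delta> by (intro mult_mono) auto
          then show ?thesis using True by (simp add: \<phi>x_def abs_mult)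
        qed (use \<delta> w B_nonneg in \<open>simp add: \<phi>x_def\<close>)
        have "\<bar>\<eta> P * \<phi>t P\<bar> \<le> K * (3 * \<delta> * (\<bar>b\<bar> + w + B))" unfolding abs_mult using K by (intro mult_mono \<eta>K ft) auto
        moreover have "\<bar>q P * \<phi>x P\<bar> \<le> K * (3 * \<delta> * (\<bar>k\<bar> + w + B))" unfolding abs_mult using K by (intro mult_mono qK fx) auto
        ultimately show ?thesis unfolding Ht_def by linarith
      qed
    qed
    have err_int: "integrable lborel (\<lambda>P. indicator ?R P * \<bar>avg h v P - v P\<bar>)"
      if [measurable]: "v \<in> borel_measurable borel" and vB: "\<And>P. \<bar>v P\<bar> \<le> B" for v
    proof (rule integrable_rect[of _ "2 * B" "x0 - r" "x0 + r" "t0 - r" "t0 + r"])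
      have [measurable]: "avg h v \<in> borel_measurable borel"
        by (intro borel_measurable_continuous_onI continuous_avg[OF that h(1)])
      show "(\<lambda>P. indicator ?R P * \<bar>avg h v P - v P\<bar>) \<in> borel_measurable borel" by measurable
      show "\<bar>indicator ?R P * \<bar>avg h v P - v P\<bar>\<bar> \<le> 2 * B" for P
        using vB[of P] abs_avg_le[OF that, of h P] B_nonneg by (auto simp: indicator_def)
    qed (simp del: mem_Times_iff)
    have R2m: "emeasure lborel R2 = ennreal (4 * r2\<^sup>2)"
      unfolding R2_def using r2 by (simp add: emeasure_rect power2_eq_square)
    have R2s: "R2 \<in> sets lborel" unfolding R2_def by simp
    have R2i: "integrable lborel (\<lambda>P. - (c * l * \<delta> / 4) * indicator R2 P)"
      using integrable_real_indicator[OF R2s] R2m by simp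
    note E = err_int[OF borel_q q_le] err_int[OF borel_p p_le]
    have D_int: "integrable lborel D"
      unfolding D_def[abs_def] by (intro Bochner_Integration.integrable_add integrable_mult_right R2i E)
    have "(\<integral>P. D P \<partial>lborel) = - (c * l * \<delta> / 4) * (4 * r2\<^sup>2) + 3 * \<delta> * K * (ef h + eu h)"
    proof -
      have "(\<integral>P. D P \<partial>lborel) = (\<integral>P. - (c * l * \<delta> / 4) * indicator R2 P \<partial>lborel)
        + (\<integral>P. 3 * \<delta> * K * (indicator ?R P * \<bar>avg h ?f P - ?f P\<bar> + indicator ?R P * \<bar>avg h u P - u P\<bar>) \<partial>lborel)"
        unfolding D_def by (intro Bochner_Integration.integral_add R2i integrable_mult_right Bochner_Integration.integrable_add E)
      also have "(\<integral>P. - (c * l * \<delta> / 4) * indicator R2 P \<partial>lborel) = - (c * l * \<delta> / 4) * (4 * r2\<^sup>2)"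
        using R2s R2m by (simp add: measure_def)
      also have "(\<integral>P. 3 * \<delta> * K * (indicator ?R P * \<bar>avg h ?f P - ?f P\<bar> + indicator ?R P * \<bar>avg h u P - u P\<bar>) \<partial>lborel)
        = 3 * \<delta> * K * (ef h + eu h)"
        unfolding ef_def eu_def using E by simp
      finally show ?thesis .
    qed
    moreover have "(\<integral>P. Ht P \<partial>lborel) \<le> (\<integral>P. D P \<partial>lborel)" by (rule integral_mono[OF Ht_int D_int HD])
    ultimately show ?thesis using \<open>0 \<le> (\<integral>P. Ht P \<partial>lborel)\<close> by (simp add: algebra_simps)
  qed
  let ?h = "\<lambda>n. 1 / real (Suc n)"
  have h0: "?h \<longlonglongrightarrow> 0" using LIMSEQ_inverse_real_of_nat by (simp add: inverse_eq_divide)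
  have "(\<lambda>n. 3 * \<delta> * K * (ef (?h n) + eu (?h n))) \<longlonglongrightarrow> 3 * \<delta> * K * (0 + 0)"
    unfolding ef_def eu_def
    by (intro tendsto_intros tendsto_L1_avg[OF borel_q q_le h0] tendsto_L1_avg[OF borel_p p_le h0])
  moreover have "0 < c * l * \<delta> * r2\<^sup>2" using c l \<delta> r2 by simp
  ultimately have "eventually (\<lambda>n. 3 * \<delta> * K * (ef (?h n) + eu (?h n)) < c * l * \<delta> * r2\<^sup>2) sequentially"
    by (intro order_tendstoD(2)[where y = "3 * \<delta> * K * (0 + 0)"]) simp_all
  moreover have "eventually (\<lambda>n. 5 * B * ?h n < \<delta> / 2) sequentially"
  proof -
    have "(\<lambda>n. 5 * B * ?h n) \<longlonglongrightarrow> 5 * B * 0" by (intro tendsto_intros h0)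
    then show ?thesis using \<delta> by (intro order_tendstoD(2)[where y = "5 * B * 0"]) simp_all
  qed
  ultimately have "eventually (\<lambda>n. False) sequentially"
  proof eventually_elim
    case (elim n)
    then show ?case using main[of "?h n"] by simp
  qed
  then show False by simp
qed

end

section \<open>Mollified potentials along curves\<close>

context balance_law
begin

lemma has_derivative_Upot:
  assumes h: "0 < h" and t: "0 < t"
  shows "(Upot h has_derivative (\<lambda>(a, b). avg h p (x, t) * a - avg h q (x, t) * b)) (at (x, t))"
proof -
  have "((\<lambda>(x, y). (\<lambda>x y. Upot h (x, y)) x y) has_derivative
      (\<lambda>(tx, ty). avg h p (x, t) * tx + (\<lambda>x y. blinfun_mult_right (- avg h q (x, y))) x t ty))
      (at (x, t) within UNIV \<times> {0<..})"
  proof (rule has_derivative_partialsI)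
    show "((\<lambda>x. Upot h (x, t)) has_derivative (*) (avg h p (x, t))) (at x within UNIV)"
      using DERIV_Upot_x[OF h, of t x] t by (simp add: has_field_derivative_def)
    show "((\<lambda>y. Upot h (x, y)) has_derivative blinfun_apply (blinfun_mult_right (- avg h q (x, y)))) (at y within {0<..})" for x y
      using DERIV_Upot_t[OF h, of x y] by (simp add: has_field_derivative_def has_derivative_at_withinI)
    have "continuous_on UNIV (\<lambda>P. blinfun_mult_right (- avg h q P))"
      by (intro bounded_linear.continuous_on[OF bounded_linear_blinfun_mult_right] continuous_intros
          continuous_avg[OF borel_q q_le h])
    then have "isCont (\<lambda>P. blinfun_mult_right (- avg h q P)) (x, t)"
      using continuous_on_eq_continuous_at[OF open_UNIV] by blast
    then show "continuous (at (x, t) within UNIV \<times> {0<..}) (\<lambda>(x, y). blinfun_mult_right (- avg h q (x, y)))"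
      by (simp add: case_prod_unfold continuous_at_imp_continuous_at_within)
  qed (use t in auto)
  moreover have "at (x, t) within UNIV \<times> {0<..} = at (x, t)"
    by (rule at_within_open) (use t in \<open>auto intro: open_Times\<close>)
  ultimately show ?thesis by (simp add: case_prod_unfold)
qed

lemma DERIV_Upot_path:
  assumes h: "0 < h" and t: "0 < t" and X: "(X has_real_derivative X') (at t)"
  shows "((\<lambda>s. Upot h (X s, s)) has_real_derivative avg h p (X t, t) * X' - avg h q (X t, t)) (at t)"
proof -
  have "((\<lambda>s. (X s, s)) has_derivative (\<lambda>d. (X' * d, d))) (at t)"
    using X by (intro has_derivative_Pair) (auto simp: has_field_derivative_def)
  from has_derivative_compose[OF this has_derivative_Upot[OF h t]]
  have "((\<lambda>s. Upot h (X s, s)) has_derivative (\<lambda>d. avg h p (X t, t) * (X' * d) - avg h q (X t, t) * d)) (at t)" by simp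
  moreover have "(\<lambda>d. avg h p (X t, t) * (X' * d) - avg h q (X t, t) * d) = (*) (avg h p (X t, t) * X' - avg h q (X t, t))"
    by (auto simp: fun_eq_iff algebra_simps)
  ultimately show ?thesis by (simp add: has_field_derivative_def)
qed

lemma U_limit_le:
  assumes "\<And>h. 0 < h \<Longrightarrow> h < e \<Longrightarrow> Upot h (x, t) - Upot h (x', t') \<le> c + K * h"
    and "0 \<le> t" "0 \<le> t'" "0 < e"
  shows "U (x, t) - U (x', t') \<le> c"
proof (rule LIMSEQ_le)
  let ?h = "\<lambda>n. 1 / real (Suc n)"
  have h0: "?h \<longlonglongrightarrow> 0" using LIMSEQ_inverse_real_of_nat by (simp add: inverse_eq_divide)
  show "(\<lambda>n. Upot (?h n) (x, t) - Upot (?h n) (x', t')) \<longlonglongrightarrow> U (x, t) - U (x', t')"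
    by (intro tendsto_intros U_tendsto assms)
  have "(\<lambda>n. c + K * ?h n) \<longlonglongrightarrow> c + K * 0" by (intro tendsto_intros h0)
  then show "(\<lambda>n. c + K * ?h n) \<longlonglongrightarrow> c" by simp
  have "eventually (\<lambda>n. ?h n < e) sequentially" by (rule order_tendstoD(2)[OF h0 \<open>0 < e\<close>])
  then have "eventually (\<lambda>n. Upot (?h n) (x, t) - Upot (?h n) (x', t') \<le> c + K * ?h n) sequentially"
    by eventually_elim (rule assms(1), simp_all)
  then show "\<exists>N. \<forall>n\<ge>N. Upot (?h n) (x, t) - Upot (?h n) (x', t') \<le> c + K * ?h n"
    by (simp only: eventually_sequentially)
qed

end

section \<open>Bounds for the potential of u and the exact solution on a tooth\<close>

context burgers_entropy
begin

text \<open>Along a line of speed \<open>c\<close> the mollified potential grows at the average of c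
  u - u^2 / 2, which is at most c^2 / 2 because 2 c u \<le> c^2 + u^2. This is the upper half of the
  Hopf-Lax formula.\<close>

lemma U_le_along_line:
  assumes t: "0 \<le> t"
  shows "U (y + c * t, t) \<le> U (y, 0) + c\<^sup>2 / 2 * t"
proof (cases "t = 0")
  case False
  with t have t: "0 < t" by simp
  have "U (y + c * t, t) - U (y, 0) \<le> c\<^sup>2 / 2 * t"
  proof (rule U_limit_le[where K = 0 and e = 1])
    fix h :: real assume h: "0 < h"
    let ?F = "\<lambda>s. Upot h (y + c * s, s) - c\<^sup>2 / 2 * s"
    have "?F t \<le> ?F 0"
    proof (rule DERIV_nonpos_imp_decreasing_open[OF less_imp_le[OF t]])
      fix s assume s: "0 < s" "s < t"
      have "((\<lambda>s. y + c * s) has_real_derivative c) (at s)" by (auto intro!: derivative_eq_intros)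
      from DERIV_Upot_path[OF h s(1) this]
      have "(?F has_real_derivative avg h u (y + c * s, s) * c - avg h (\<lambda>P. (u P)\<^sup>2 / 2) (y + c * s, s) - c\<^sup>2 / 2) (at s)"
        by (auto intro!: derivative_eq_intros)
      moreover have "avg h u (y + c * s, s) * c - avg h (\<lambda>P. (u P)\<^sup>2 / 2) (y + c * s, s) - c\<^sup>2 / 2 \<le> 0"
      proof -
        have cB: "\<bar>c * u P\<bar> \<le> \<bar>c\<bar> * B" for P using p_le[of P] by (simp add: abs_mult mult_left_mono)
        have "c * avg h u (y + c * s, s) = avg h (\<lambda>P. c * u P) (y + c * s, s)" by (simp add: avg_cmult)
        also have "\<dots> \<le> avg h (\<lambda>P. (u P)\<^sup>2 / 2 + c\<^sup>2 / 2) (y + c * s, s)"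
        proof (rule avg_mono)
          show "\<bar>c * u P\<bar> \<le> \<bar>c\<bar> * B" for P by (rule cB)
          show "\<bar>(u P)\<^sup>2 / 2 + c\<^sup>2 / 2\<bar> \<le> B + c\<^sup>2 / 2" for P using q_le[of P] by simp
          show "c * u Q \<le> (u Q)\<^sup>2 / 2 + c\<^sup>2 / 2" for Q
            using sum_squares_bound[of c "u Q"] by simp
        qed measurable
        also have "\<dots> = avg h (\<lambda>P. (u P)\<^sup>2 / 2) (y + c * s, s) + c\<^sup>2 / 2"
          by (subst avg_add[OF borel_q q_le, of "\<lambda>_. c\<^sup>2 / 2" "c\<^sup>2 / 2"]) (auto simp: avg_const)
        finally show ?thesis by (simp add: mult.commute)
      qed
      ultimately show "\<exists>z. (?F has_real_derivative z) (at s) \<and> z \<le> 0" by blast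
    next
      have "continuous_on {0..t} (\<lambda>s. (y + c * s, s))" by (intro continuous_intros)
      then have "continuous_on {0..t} (\<lambda>s. Upot h (y + c * s, s))"
        by (rule continuous_on_compose2[OF continuous_Upot[OF h]]) auto
      then show "continuous_on {0..t} ?F" by (intro continuous_intros)
    qed
    then show "Upot h (y + c * t, t) - Upot h (y, 0) \<le> c\<^sup>2 / 2 * t + 0 * h" by simp
  qed (use t in auto)
  then show ?thesis by simp
qed simp

text \<open>A positive maximum of \<zeta> - U would be an interior point, where the supersolution
  property contradicts the strict inequality. The touching condition needs a full neighbourhood in
  time, so the top t = T counts as boundary as well, and every barrier must be brought below
  \<open>U\<close> there by an extra term.\<close>

lemma comparison:
  fixes \<zeta> \<zeta>x \<zeta>t :: "real \<times> real \<Rightarrow> real"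
  assumes \<zeta>x: "\<And>x t. 0 < t \<Longrightarrow> ((\<lambda>y. \<zeta> (y, t)) has_real_derivative \<zeta>x (x, t)) (at x)"
    and \<zeta>t: "\<And>x t. 0 < t \<Longrightarrow> ((\<lambda>s. \<zeta> (x, s)) has_real_derivative \<zeta>t (x, t)) (at t)"
    and cont: "continuous_on {P. 0 \<le> snd P} \<zeta>" "continuous_on {P. 0 < snd P} \<zeta>x" "continuous_on {P. 0 < snd P} \<zeta>t"
    and sub: "\<And>x t. a < x \<Longrightarrow> x < b \<Longrightarrow> 0 < t \<Longrightarrow> t < T \<Longrightarrow> \<zeta>t (x, t) + (\<zeta>x (x, t))\<^sup>2 / 2 < 0"
    and bdry: "\<And>x t. x \<in> {a..b} \<Longrightarrow> t \<in> {0..T} \<Longrightarrow> x = a \<or> x = b \<or> t = 0 \<or> t = T \<Longrightarrow> \<zeta> (x, t) \<le> U (x, t)"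
    and xt: "x \<in> {a..b}" "t \<in> {0..T}"
  shows "\<zeta> (x, t) \<le> U (x, t)"
proof -
  let ?R = "{a..b} \<times> {0..T}"
  have "compact ?R" by (intro compact_Times) auto
  moreover have "?R \<noteq> {}" using xt by auto
  moreover have "continuous_on ?R (\<lambda>P. \<zeta> P - U P)"
    by (intro continuous_intros continuous_on_subset[OF cont(1)] continuous_on_subset[OF continuous_U]) auto
  ultimately have "\<exists>P0\<in>?R. \<forall>P\<in>?R. \<zeta> P - U P \<le> \<zeta> P0 - U P0"
    by (rule continuous_attains_sup)
  then obtain P0 where P0: "P0 \<in> ?R" "\<And>P. P \<in> ?R \<Longrightarrow> \<zeta> P - U P \<le> \<zeta> P0 - U P0"
    by blast
  obtain x0 t0 where xt0: "P0 = (x0, t0)" by (cases P0)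
  have "\<zeta> P0 \<le> U P0"
  proof (rule ccontr)
    assume "\<not> \<zeta> P0 \<le> U P0"
    then have "\<not> (x0 = a \<or> x0 = b \<or> t0 = 0 \<or> t0 = T)" using bdry[of x0 t0] P0(1) xt0 by auto
    then have int: "a < x0" "x0 < b" "0 < t0" "t0 < T" using P0(1) xt0 by auto
    define r where "r = min (min (x0 - a) (b - x0)) (min t0 (T - t0)) / 2"
    have r: "0 < r" "r < t0" "r < x0 - a" "r < b - x0" "r < T - t0" using int by (auto simp: r_def)
    have "0 \<le> \<zeta>t (x0, t0) + (\<zeta>x (x0, t0))\<^sup>2 / 2"
    proof (rule viscosity_supersolution[OF r(1,2) \<zeta>x \<zeta>t _ cont(2,3)])
      show "continuous_on {P. 0 < snd P} \<zeta>" by (rule continuous_on_subset[OF cont(1)]) auto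
      fix x t assume xt: "(x - x0)\<^sup>2 + (t - t0)\<^sup>2 < r\<^sup>2"
      have "(x - x0)\<^sup>2 < r\<^sup>2" "(t - t0)\<^sup>2 < r\<^sup>2" using xt zero_le_power2[of "x - x0"] zero_le_power2[of "t - t0"] by linarith+
      then have "\<bar>x - x0\<bar>\<^sup>2 < r\<^sup>2" "\<bar>t - t0\<bar>\<^sup>2 < r\<^sup>2" by simp_all
      then have "\<bar>x - x0\<bar> < r" "\<bar>t - t0\<bar> < r" using r(1) power2_less_imp_less less_imp_le by blast+
      then have "(x, t) \<in> ?R" using r by auto
      then show "\<zeta> (x, t) - U (x, t) \<le> \<zeta> (x0, t0) - U (x0, t0)" using P0(2) xt0 by simp
    qed simp_all
    then show False using sub[OF int] by linarith
  qed
  then show ?thesis using P0(2)[of "(x, t)"] xt by auto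
qed

text \<open>The only lower bound at hand is - B t, from the Lipschitz estimate in time. Barriers on
  a wide and long rectangle improve it to 0.\<close>

lemma U_nonneg:
  assumes init: "\<And>x. 0 \<le> U (x, 0)" and t1: "0 \<le> t1"
  shows "0 \<le> U (x1, t1)"
proof (rule ccontr)
  define m where "m = - U (x1, t1)"
  assume "\<not> ?thesis"
  then have m: "0 < m" by (simp add: m_def)
  define a where "a = m / (4 * (t1 + 1))"
  have a: "0 < a" "a * t1 \<le> m / 4"
  proof -
    show "0 < a" using m t1 by (simp add: a_def)
    have "a * t1 \<le> a * (t1 + 1)" using \<open>0 < a\<close> by simp
    also have "a * (t1 + 1) = m / 4" using t1 by (simp add: a_def field_simps)
    finally show "a * t1 \<le> m / 4" .
  qed
  define T where "T = t1 + 1 + 4 * B * t1\<^sup>2 / m"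
  have "0 \<le> 4 * B * t1\<^sup>2 / m" using m B_nonneg by simp
  then have T: "0 < T" "t1 < T" using t1 by (auto simp: T_def)
  have bT: "B / T * t1\<^sup>2 \<le> m / 4"
  proof -
    have "4 * B * t1\<^sup>2 / m \<le> T" using t1 by (simp add: T_def)
    then show ?thesis using T(1) m by (simp add: field_simps)
  qed
  define R where "R = 1 + 16 * B * T / a + 16 * B * T + 1"
  have "0 \<le> B * T" using B_nonneg T by simp
  then have "0 \<le> 16 * B * T" "0 \<le> 16 * B * T / a" using a(1) by (simp_all add: mult.assoc)
  then have R: "1 \<le> R" "0 < R" "16 * (B * T) \<le> R" "16 * (B * T) / a \<le> R"
    unfolding R_def mult.assoc by linarith+
  define \<kappa> where "\<kappa> = 2 * B * T / R\<^sup>2"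
  have \<kappa>R: "\<kappa> * R\<^sup>2 = 2 * (B * T)" using R by (simp add: \<kappa>_def)
  have \<kappa>0: "0 \<le> \<kappa>" using \<open>0 \<le> B * T\<close> by (simp add: \<kappa>_def)
  have \<kappa>: "2 * \<kappa>\<^sup>2 * R\<^sup>2 < a"
  proof -
    have "2 * \<kappa>\<^sup>2 * R\<^sup>2 = 8 * (B * T) * (B * T) / R\<^sup>2"
      using R(2) by (simp add: \<kappa>_def power2_eq_square field_simps)
    also have "\<dots> < a"
    proof -
      have "8 * (B * T) * (B * T) \<le> (a * R / 2) * (R / 2)"
      proof (rule mult_mono)
        show "8 * (B * T) \<le> a * R / 2" using R(4) a(1) by (simp add: field_simps)
        show "B * T \<le> R / 2" using R(2,3) \<open>0 \<le> B * T\<close> by linarith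
      qed (use a R \<open>0 \<le> B * T\<close> in auto)
      also have "\<dots> = a * R\<^sup>2 / 4" by (simp add: power2_eq_square)
      also have "\<dots> < a * R\<^sup>2" using a R by simp
      finally show ?thesis using R(2) by (simp add: pos_divide_less_eq)
    qed
    finally show ?thesis .
  qed
  \<comment> \<open>The linear term makes the inequality strict and pays for the gradient of the
    parabola in space. That parabola pushes the barrier below - B t on the sides, by \<kappa> R^2 =
    2 B T, and the quadratic term in time does so at t = T. At (x1, t1) the two terms in time cost
    at most m / 4 each, so the barrier is still above - m.\<close>
  let ?\<zeta> = "\<lambda>P. - a * snd P - B / T * (snd P)\<^sup>2 - \<kappa> * (fst P - x1)\<^sup>2"
  have lower: "- B * t \<le> U (x, t)" if "0 \<le> t" for x t
    using U_lipschitz_t[OF that, of 0 x] init[of x] that by simp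
  have "?\<zeta> (x1, t1) \<le> U (x1, t1)"
  proof (rule comparison[where \<zeta> = ?\<zeta> and \<zeta>x = "\<lambda>P. - 2 * \<kappa> * (fst P - x1)" and \<zeta>t = "\<lambda>P. - a - 2 * (B / T) * snd P"
      and a = "x1 - R" and b = "x1 + R" and T = T])
    show "((\<lambda>y. ?\<zeta> (y, t)) has_real_derivative - 2 * \<kappa> * (fst (x, t) - x1)) (at x)" for x t
      unfolding fst_conv snd_conv by (rule derivative_eq_intros refl | simp)+
    show "((\<lambda>s. ?\<zeta> (x, s)) has_real_derivative - a - 2 * (B / T) * snd (x, t)) (at t)" for x t
      unfolding fst_conv snd_conv by (rule derivative_eq_intros refl | simp)+
    show "- a - 2 * (B / T) * snd (x, t) + (- 2 * \<kappa> * (fst (x, t) - x1))\<^sup>2 / 2 < 0"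
      if "x1 - R < x" "x < x1 + R" "0 < t" "t < T" for x t
    proof -
      have "(x - x1)\<^sup>2 \<le> R\<^sup>2" using that R(2) by (subst abs_le_square_iff[symmetric]) auto
      then have "2 * \<kappa>\<^sup>2 * (x - x1)\<^sup>2 \<le> 2 * \<kappa>\<^sup>2 * R\<^sup>2" by (intro mult_left_mono) auto
      moreover have "(- 2 * \<kappa> * (x - x1))\<^sup>2 / 2 = 2 * \<kappa>\<^sup>2 * (x - x1)\<^sup>2" by (simp add: power_mult_distrib)
      moreover have "0 \<le> 2 * (B / T) * t" using that T B_nonneg by simp
      ultimately show ?thesis using \<kappa> by simp
    qed
    show "?\<zeta> (x, t) \<le> U (x, t)" if "x \<in> {x1 - R..x1 + R}" "t \<in> {0..T}" "x = x1 - R \<or> x = x1 + R \<or> t = 0 \<or> t = T" for x t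
    proof -
      have tT: "B * t \<le> B * T" "0 \<le> a * t" "0 \<le> B / T * t\<^sup>2" "0 \<le> \<kappa> * (x - x1)\<^sup>2"
        using that B_nonneg a T \<kappa>0 by (auto intro: mult_left_mono)
      from that(3) consider "(x - x1)\<^sup>2 = R\<^sup>2" | "t = 0" | "t = T" by auto
      then show ?thesis
      proof cases
        case 1
        then have "\<kappa> * (x - x1)\<^sup>2 = 2 * (B * T)" using \<kappa>R by simp
        then show ?thesis using tT lower[of t x] that(2) \<open>0 \<le> B * T\<close> by simp
      next
        case 2
        then show ?thesis using init[of x] tT(4) by simp
      next
        case 3
        then have "B / T * t\<^sup>2 = B * T" using T by (simp add: power2_eq_square)
        then show ?thesis using tT lower[of t x] that(2) 3 by simp
      qed
    qed
  qed (use R t1 T in \<open>auto intro!: continuous_intros\<close>)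
  then show False using a(2) bT m by (simp add: m_def)
qed

text \<open>Rounding off the concave kink \<open>|x - p|\<close> from below gives smooth subsolutions.\<close>

lemma block_lower:
  assumes init: "\<And>x. 0 \<le> U (x, 0)" and l: "0 < l" and \<tau>: "0 < \<tau>"
    and block: "\<And>x. \<bar>x - p\<bar> \<le> l \<Longrightarrow> (l - \<bar>x - p\<bar>)\<^sup>2 / (2 * \<tau>) \<le> U (x, 0)"
    and x: "\<bar>x - p\<bar> \<le> l" and t: "0 \<le> t"
  shows "(l - \<bar>x - p\<bar>)\<^sup>2 / (2 * (t + \<tau>)) \<le> U (x, t)"
proof -
  \<comment> \<open>The parameter rounds the kink and also tilts the profile: - \<epsilon> t makes
    the subsolution strict and brings it down to 0 at a late time. Enlarging \<open>l\<close> to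
    sqrt (l^2 + \<epsilon>^2) keeps the leading term 0 at both ends of the block.\<close>
  define F where "F \<epsilon> = (sqrt (l\<^sup>2 + \<epsilon>\<^sup>2) - sqrt ((x - p)\<^sup>2 + \<epsilon>\<^sup>2))\<^sup>2 / (2 * (t + \<tau>)) - \<epsilon> * t" for \<epsilon>
  have F_le: "F \<epsilon> \<le> U (x, t)" if \<epsilon>: "0 < \<epsilon>" for \<epsilon>
  proof -
    define l' where "l' = sqrt (l\<^sup>2 + \<epsilon>\<^sup>2)"
    define s where "s y = sqrt ((y - p)\<^sup>2 + \<epsilon>\<^sup>2)" for y
    have s_pos: "0 < s y" "\<bar>y - p\<bar> < s y" for y
    proof -
      have "sqrt ((y - p)\<^sup>2) < s y" unfolding s_def using \<epsilon> by (intro real_sqrt_less_mono) simp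
      then show "\<bar>y - p\<bar> < s y" by simp
      then show "0 < s y" by linarith
    qed
    have s_sq: "(s y)\<^sup>2 = (y - p)\<^sup>2 + \<epsilon>\<^sup>2" for y unfolding s_def by (simp add: add_nonneg_nonneg)
    have s_le: "s y \<le> l'" if "\<bar>y - p\<bar> \<le> l" for y
      unfolding s_def l'_def using that l abs_le_square_iff[of "y - p" l] by simp
    \<comment> \<open>The rounded profile must not exceed the given one at time 0. The difference of
      squares is the same for both profiles, while the sum of the roots has grown; so the difference
      of the roots has shrunk.\<close>
    have gap: "l' - s y \<le> l - \<bar>y - p\<bar>" if "\<bar>y - p\<bar> \<le> l" for y
    proof -
      have l'2: "l'\<^sup>2 = l\<^sup>2 + \<epsilon>\<^sup>2" unfolding l'_def by (simp add: add_nonneg_nonneg)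
      have "(l' - s y) * (l' + s y) = (l - \<bar>y - p\<bar>) * (l + \<bar>y - p\<bar>)"
        using l'2 s_sq[of y] by (simp add: power2_eq_square algebra_simps abs_mult_self_eq)
      also have "\<dots> \<le> (l - \<bar>y - p\<bar>) * (l' + s y)"
      proof (rule mult_left_mono)
        have "l \<le> l'" unfolding l'_def using l by (intro real_le_rsqrt) simp
        then show "l + \<bar>y - p\<bar> \<le> l' + s y" using s_pos(2)[of y] by linarith
      qed (use that in simp)
      finally show ?thesis
        using s_pos(1)[of y] s_le[OF that] by (simp add: mult_le_cancel_right)
    qed
    have ds: "(s has_real_derivative (y - p) / s y) (at y)" for y
    proof -
      have pos: "0 < (y - p)\<^sup>2 + \<epsilon>\<^sup>2" using \<epsilon> by (simp add: add_nonneg_pos)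
      have "((\<lambda>y. (y - p)\<^sup>2 + \<epsilon>\<^sup>2) has_real_derivative 2 * (y - p)) (at y)"
        by (rule derivative_eq_intros refl | simp)+
      from DERIV_chain2[OF DERIV_real_sqrt[OF pos] this]
      have "(s has_real_derivative inverse (s y) / 2 * (2 * (y - p))) (at y)" unfolding s_def[abs_def] .
      moreover have "inverse (s y) / 2 * (2 * (y - p)) = (y - p) / s y" using s_pos(1)[of y] by (simp add: field_simps)
      ultimately show ?thesis by (simp only:)
    qed
    have s_cont: "continuous_on S s" for S unfolding s_def[abs_def] by (intro continuous_intros)
    let ?\<zeta> = "\<lambda>P. (l' - s (fst P))\<^sup>2 / (2 * (snd P + \<tau>)) - \<epsilon> * snd P"
    let ?\<zeta>x = "\<lambda>P. - (l' - s (fst P)) * ((fst P - p) / s (fst P)) / (snd P + \<tau>)"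
    let ?\<zeta>t = "\<lambda>P. - (l' - s (fst P))\<^sup>2 / (2 * (snd P + \<tau>)\<^sup>2) - \<epsilon>"
    define T where "T = t + 1 + l\<^sup>2 / (2 * \<tau>) / \<epsilon>"
    have T: "0 < T" "t \<le> T" "l\<^sup>2 / (2 * \<tau>) \<le> \<epsilon> * T"
    proof -
      have "0 \<le> l\<^sup>2 / (2 * \<tau>) / \<epsilon>" using \<tau> \<epsilon> by simp
      then show "0 < T" "t \<le> T" using t by (auto simp: T_def)
      have "\<epsilon> * (l\<^sup>2 / (2 * \<tau>) / \<epsilon>) \<le> \<epsilon> * T" using t \<epsilon> by (intro mult_left_mono) (auto simp: T_def)
      then show "l\<^sup>2 / (2 * \<tau>) \<le> \<epsilon> * T" using \<epsilon> by simp
    qed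
    have "?\<zeta> (x, t) \<le> U (x, t)"
    proof (rule comparison[where \<zeta> = ?\<zeta> and \<zeta>x = ?\<zeta>x and \<zeta>t = ?\<zeta>t and a = "p - l" and b = "p + l" and T = T])
      fix y r :: real assume r: "0 < r"
      have "((\<lambda>y. (l' - s y)\<^sup>2 / (2 * (r + \<tau>)) - \<epsilon> * r) has_real_derivative
          - (l' - s y) * ((y - p) / s y) / (r + \<tau>)) (at y)"
      proof -
        have "((\<lambda>y. (l' - s y)\<^sup>2) has_real_derivative 2 * (- (l' - s y) * ((y - p) / s y))) (at y)"
          by (rule derivative_eq_intros ds refl)+ (use s_pos(1)[of y] in \<open>simp add: field_simps\<close>)
        from DERIV_diff[OF DERIV_cdivide[OF this, of "2 * (r + \<tau>)"] DERIV_const[of "\<epsilon> * r"]]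
        show ?thesis by (simp only: mult_divide_mult_cancel_left_if) simp
      qed
      then show "((\<lambda>y. ?\<zeta> (y, r)) has_real_derivative ?\<zeta>x (y, r)) (at y)" by simp
      have "((\<lambda>r. (l' - s y)\<^sup>2 / (2 * (r + \<tau>)) - \<epsilon> * r) has_real_derivative
          - (l' - s y)\<^sup>2 / (2 * (r + \<tau>)\<^sup>2) - \<epsilon>) (at r)"
      proof -
        have "((\<lambda>r. inverse (r + \<tau>)) has_real_derivative - (inverse ((r + \<tau>)\<^sup>2))) (at r)"
          using r \<tau> by (auto intro!: derivative_eq_intros simp: power2_eq_square)
        from DERIV_diff[OF DERIV_cmult[OF this, of "(l' - s y)\<^sup>2 / 2"] DERIV_cmult[OF DERIV_ident, of \<epsilon>]]
        show ?thesis by (simp add: inverse_eq_divide)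
      qed
      then show "((\<lambda>r. ?\<zeta> (y, r)) has_real_derivative ?\<zeta>t (y, r)) (at r)" by simp
    next
      have "continuous_on S (\<lambda>P. s (fst P))" for S :: "(real \<times> real) set"
        by (rule continuous_on_compose2[OF s_cont[of UNIV]]) (auto intro: continuous_intros)
      then show "continuous_on {P. 0 \<le> snd P} ?\<zeta>" "continuous_on {P. 0 < snd P} ?\<zeta>x" "continuous_on {P. 0 < snd P} ?\<zeta>t"
        using \<tau> s_pos(1) by (auto intro!: continuous_intros simp: less_imp_neq[symmetric] add_nonneg_pos add_pos_pos)
    next
      fix y r :: real assume r: "0 < r"
      \<comment> \<open>For the exact profile the time derivative and half the squared slope cancel
        away from the kink. The rounded distance has slope at most 1 in modulus, hence their sum
        here is at most - \<epsilon>.\<close>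
      have "((y - p) / s y)\<^sup>2 \<le> 1"
      proof -
        have "0 < (y - p)\<^sup>2 + \<epsilon>\<^sup>2" using \<epsilon> by (simp add: add_nonneg_pos)
        then show ?thesis by (simp add: power_divide s_sq)
      qed
      then have "(l' - s y)\<^sup>2 * ((y - p) / s y)\<^sup>2 \<le> (l' - s y)\<^sup>2 * 1" by (intro mult_left_mono) auto
      then have "(l' - s y)\<^sup>2 * ((y - p) / s y)\<^sup>2 / (2 * (r + \<tau>)\<^sup>2) \<le> (l' - s y)\<^sup>2 / (2 * (r + \<tau>)\<^sup>2)"
        by (intro divide_right_mono) auto
      moreover have "(- (l' - s y) * ((y - p) / s y) / (r + \<tau>))\<^sup>2 / 2 = (l' - s y)\<^sup>2 * ((y - p) / s y)\<^sup>2 / (2 * (r + \<tau>)\<^sup>2)"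
        by (simp add: power_mult_distrib power_divide power2_commute)
      ultimately show "?\<zeta>t (y, r) + (?\<zeta>x (y, r))\<^sup>2 / 2 < 0" using \<epsilon> by simp
    next
      fix y r :: real assume y: "y \<in> {p - l..p + l}" and r: "r \<in> {0..T}" and b: "y = p - l \<or> y = p + l \<or> r = 0 \<or> r = T"
      have yp: "\<bar>y - p\<bar> \<le> l" using y by auto
      have Un: "0 \<le> U (y, r)" using U_nonneg[OF init] r by simp
      have gap2: "(l' - s y)\<^sup>2 \<le> (l - \<bar>y - p\<bar>)\<^sup>2" using gap[OF yp] s_le[OF yp] by (intro power_mono) auto
      from b consider "\<bar>y - p\<bar> = l" | "r = 0" | "r = T" using l by auto
      then show "?\<zeta> (y, r) \<le> U (y, r)"
      proof cases
        case 1
        then have "s y = l'" unfolding s_def l'_def by (metis power2_abs)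
        then show ?thesis using Un r \<epsilon> by (simp add: order_trans[of _ 0])
      next
        case 2
        have "(l' - s y)\<^sup>2 / (2 * \<tau>) \<le> (l - \<bar>y - p\<bar>)\<^sup>2 / (2 * \<tau>)" using gap2 \<tau> by (intro divide_right_mono) auto
        then show ?thesis using block[OF yp] 2 by simp
      next
        case 3
        have "(l - \<bar>y - p\<bar>)\<^sup>2 \<le> l\<^sup>2" using yp by (intro power_mono) auto
        then have "(l' - s y)\<^sup>2 / (2 * (r + \<tau>)) \<le> l\<^sup>2 / (2 * \<tau>)"
          using gap2 r \<tau> by (intro frac_le) auto
        then show ?thesis using T(3) Un 3 by simp
      qed
    qed (use x t T in auto)
    then show ?thesis by (simp add: F_def l'_def s_def)
  qed
  have "(F \<longlongrightarrow> F 0) (at_right 0)"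
    unfolding F_def using t \<tau> by (intro tendsto_intros) auto
  moreover have "eventually (\<lambda>\<epsilon>. F \<epsilon> \<le> U (x, t)) (at_right 0)"
    using F_le by (auto simp: eventually_at_right_less intro: eventually_mono[OF eventually_at_right_less])
  ultimately have "F 0 \<le> U (x, t)" by (rule tendsto_upperbound) simp
  moreover have "F 0 = (l - \<bar>x - p\<bar>)\<^sup>2 / (2 * (t + \<tau>))" using l by (simp add: F_def)
  ultimately show ?thesis by simp
qed

text \<open>The upper bound is the estimate along the straight characteristic through (x, t), where
  the Hopf-Lax minimum is attained: \<open>g\<close> is the modulus of the expected value of u,
  \<open>\<sigma>\<close> its sign, and \<open>y\<close> the foot at time 0, at distance g \<tau>
  from the end of the block on the side of \<open>x\<close>.\<close>

lemma block_exact: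
  assumes init: "\<And>x. 0 \<le> U (x, 0)" and l: "0 < l" and \<tau>: "0 < \<tau>"
    and block: "\<And>x. \<bar>x - p\<bar> \<le> l \<Longrightarrow> U (x, 0) = (l - \<bar>x - p\<bar>)\<^sup>2 / (2 * \<tau>)"
    and x: "\<bar>x - p\<bar> \<le> l" and t: "0 \<le> t"
  shows "U (x, t) = (l - \<bar>x - p\<bar>)\<^sup>2 / (2 * (t + \<tau>))"
proof (rule antisym)
  show "(l - \<bar>x - p\<bar>)\<^sup>2 / (2 * (t + \<tau>)) \<le> U (x, t)"
    using block_lower[OF init l \<tau> _ x t] block by simp
  define g where "g = (l - \<bar>x - p\<bar>) / (t + \<tau>)"
  define \<sigma> :: real where "\<sigma> = (if x \<le> p then 1 else - 1)"
  have tt: "0 < t + \<tau>" using t \<tau> by simp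
  have g: "0 \<le> g" "g * (t + \<tau>) = l - \<bar>x - p\<bar>" using x tt by (auto simp: g_def)
  define y where "y = p - \<sigma> * (l - g * \<tau>)"
  have gt: "0 \<le> g * t" using g t by simp
  have yl: "0 \<le> l - g * \<tau>" using g(2) gt by (simp add: algebra_simps)
  have "\<bar>y - p\<bar> = l - g * \<tau>" using yl by (auto simp: y_def \<sigma>_def)
  moreover have "0 \<le> g * \<tau>" using g \<tau> by simp
  ultimately have y: "\<bar>y - p\<bar> \<le> l" "l - \<bar>y - p\<bar> = g * \<tau>" by auto
  have "y + \<sigma> * g * t = x" using g(2) unfolding y_def \<sigma>_def by (auto simp: algebra_simps)
  then have "U (x, t) \<le> U (y, 0) + (\<sigma> * g)\<^sup>2 / 2 * t" using U_le_along_line[OF t, of y "\<sigma> * g"] by simp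
  also have "\<dots> = g\<^sup>2 * \<tau> / 2 + g\<^sup>2 / 2 * t"
    unfolding block[OF y(1)] y(2) using \<tau> by (simp add: \<sigma>_def power2_eq_square)
  also have "\<dots> = (g * (t + \<tau>))\<^sup>2 / (2 * (t + \<tau>))" using tt by (simp add: power2_eq_square field_simps)
  finally show "U (x, t) \<le> (l - \<bar>x - p\<bar>)\<^sup>2 / (2 * (t + \<tau>))" unfolding g(2) .
qed

end

section \<open>Potentials along characteristics\<close>

text \<open>Open boxes are stable under intersection and generate the Borel sets, so the vanishing
  of the integral spreads from boxes to all Borel sets; a density with all integrals 0 is 0 almost
  everywhere.\<close>

lemma AE_zero_if_rect_integrals_zero:
  fixes f :: "real \<times> real \<Rightarrow> real"
  assumes f[measurable]: "f \<in> borel_measurable borel" and C: "\<And>P. P \<in> {a..b} \<times> {c..d} \<Longrightarrow> \<bar>f P\<bar> \<le> C"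
    and rect: "\<And>x1 x2 t1 t2. a \<le> x1 \<Longrightarrow> x1 \<le> x2 \<Longrightarrow> x2 \<le> b \<Longrightarrow> c \<le> t1 \<Longrightarrow> t1 \<le> t2 \<Longrightarrow> t2 \<le> d \<Longrightarrow>
      (\<integral>P. indicator ({x1..x2} \<times> {t1..t2}) P * f P \<partial>lborel) = 0"
  shows "AE P in lborel. P \<in> {a..b} \<times> {c..d} \<longrightarrow> f P = 0"
proof (cases "a \<le> b \<and> c \<le> d")
  case False
  then show ?thesis by auto
next
  case True
  let ?K = "{a..b} \<times> {c..d} :: (real \<times> real) set"
  define F where "F P = indicator ?K P * f P" for P
  have [measurable]: "F \<in> borel_measurable borel" unfolding F_def[abs_def] by measurable
  have "0 \<le> \<bar>f (a, c)\<bar>" "\<bar>f (a, c)\<bar> \<le> C" using C[of "(a, c)"] True by auto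
  then have C0: "0 \<le> C" by linarith
  have F_int: "integrable lborel F"
    by (rule integrable_rect[of _ C a b c d])
      (use C C0 in \<open>auto simp: F_def indicator_def simp del: mem_Times_iff\<close>)
  have FA: "integrable lborel (\<lambda>P. indicator A P * F P)" if "A \<in> sets borel" for A
    using integrable_mult_indicator[OF _ F_int, of A] that by simp
  have zero: "(\<integral>P. indicator A P * F P \<partial>lborel) = 0" if A: "A \<in> sets borel" for A
  proof -
    let ?G = "range (\<lambda>(l, r). box l r :: (real \<times> real) set)"
    have A': "A \<in> sigma_sets UNIV ?G" using A by (simp add: borel_eq_box)
    have sb: "sigma_sets UNIV ?G = sets borel" by (simp add: borel_eq_box)
    have boxes: "(\<integral>P. indicator (box l r) P * F P \<partial>lborel) = 0" for l r :: "real \<times> real"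
    proof -
      let ?x1 = "max a (fst l)" and ?x2 = "min b (fst r)" and ?t1 = "max c (snd l)" and ?t2 = "min d (snd r)"
      \<comment> \<open>The generators are open boxes, the hypothesis speaks of closed rectangles;
        the faces between them form a null set.\<close>
      have "emeasure lborel (cbox l r - box l r) = emeasure lborel (cbox l r) - emeasure lborel (box l r)"
        by (rule emeasure_Diff) (auto simp: box_subset_cbox emeasure_lborel_box_eq)
      also have "\<dots> = 0" by (auto simp: emeasure_lborel_box_eq emeasure_lborel_cbox_eq)
      finally have "cbox l r - box l r \<in> null_sets lborel" by (simp add: null_sets_def)
      then have "AE P in lborel. P \<notin> cbox l r - box l r" by (rule AE_not_in)
      then have "(\<integral>P. indicator (box l r) P * F P \<partial>lborel) = (\<integral>P. indicator (cbox l r) P * F P \<partial>lborel)"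
      proof (intro integral_cong_AE)
        assume "AE P in lborel. P \<notin> cbox l r - box l r"
        then show "AE P in lborel. indicator (box l r) P * F P = indicator (cbox l r) P * F P"
          by eventually_elim (use box_subset_cbox[of l r] in \<open>auto simp: indicator_def\<close>)
      qed measurable
      also have "\<dots> = (\<integral>P. indicator ({?x1..?x2} \<times> {?t1..?t2}) P * f P \<partial>lborel)"
      proof (rule Bochner_Integration.integral_cong[OF refl])
        fix P :: "real \<times> real"
        obtain x t where P: "P = (x, t)" by (cases P)
        obtain lx lt rx rt where lr: "l = (lx, lt)" "r = (rx, rt)" by (cases l; cases r)
        have "cbox l r = {lx..rx} \<times> {lt..rt}" unfolding lr cbox_Pair_eq by simp
        then show "indicator (cbox l r) P * F P = indicator ({?x1..?x2} \<times> {?t1..?t2}) P * f P"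
          unfolding F_def P lr by (auto simp: indicator_def)
      qed
      also have "\<dots> = 0"
      proof (cases "?x1 \<le> ?x2 \<and> ?t1 \<le> ?t2")
        case True
        then show ?thesis by (intro rect) auto
      next
        case False
        then have e: "{?x1..?x2} \<times> {?t1..?t2} = {}" by auto
        show ?thesis unfolding e by simp
      qed
      finally show ?thesis .
    qed
    show ?thesis
    proof (rule sigma_sets_induct_disjoint[OF _ _ A'])
      show "Int_stable ?G" by (auto simp: Int_stable_def box_Int_box)
      show "?G \<subseteq> Pow UNIV" by simp
      show "(\<integral>P. indicator X P * F P \<partial>lborel) = 0" if "X \<in> ?G" for X using that boxes by auto
      show "(\<integral>P. indicator (UNIV - X) P * F P \<partial>lborel) = 0"
        if "X \<in> sigma_sets UNIV ?G" and X0: "(\<integral>P. indicator X P * F P \<partial>lborel) = 0" for X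
      proof -
        have X: "X \<in> sets borel" using that(1) sb by simp
        \<comment> \<open>Complements require the integral over the whole plane to be 0. It equals
          the integral over one box that contains \<open>?K\<close>, outside of which
          \<open>F\<close> vanishes.\<close>
        have "bounded ?K" by (intro bounded_Times) auto
        then obtain r where r: "?K \<subseteq> box (- r) r" by (rule bounded_subset_box_symmetric)
        have "(\<integral>P. F P \<partial>lborel) = (\<integral>P. indicator (box (- r) r) P * F P \<partial>lborel)"
          by (rule Bochner_Integration.integral_cong) (use r in \<open>auto simp: F_def indicator_def simp del: mem_Times_iff\<close>)
        then have F0: "(\<integral>P. F P \<partial>lborel) = 0" using boxes by simp
        have "(\<integral>P. indicator (UNIV - X) P * F P \<partial>lborel) = (\<integral>P. F P - indicator X P * F P \<partial>lborel)"
          by (rule Bochner_Integration.integral_cong) (auto simp: indicator_def)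
        also have "\<dots> = 0" using F_int FA[OF X] F0 X0 by simp
        finally show ?thesis .
      qed
      show "(\<integral>P. indicator (\<Union>i. A i) P * F P \<partial>lborel) = 0"
        if A: "disjoint_family A" "range A \<subseteq> sigma_sets UNIV ?G" and A0: "\<And>i. (\<integral>P. indicator (A i) P * F P \<partial>lborel) = 0" for A :: "nat \<Rightarrow> _"
      proof -
        have Ai: "A i \<in> sets lborel" for i using A(2) sb by auto
        then have "(\<Union>i. A i) \<in> sets borel" by auto
        from FA[OF this] have "set_integrable lborel (\<Union>i. A i) F" by (simp add: set_integrable_def)
        from lebesgue_integral_countable_add[OF Ai _ this] A(1)
        have "(LINT P:(\<Union>i. A i)|lborel. F P) = (\<Sum>i. (LINT P:(A i)|lborel. F P))"
          by (simp add: disjoint_family_on_def)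
        then show ?thesis using A0 by (simp add: set_lebesgue_integral_def)
      qed
    qed simp
  qed
  have "AE P in lborel. F P = 0"
  proof (rule sigma_finite_measure.density_unique_banach[OF sigma_finite_lborel F_int])
    show "integrable lborel (\<lambda>_::real \<times> real. 0 :: real)" by simp
    show "(LINT P:A|lborel. F P) = (LINT P:A|lborel. 0)" if "A \<in> sets lborel" for A
      using zero[of A] that by (simp add: set_lebesgue_integral_def)
  qed
  then show ?thesis by eventually_elim (auto simp: F_def simp del: mem_Times_iff)
qed

lemma integral_rect_iterated:
  fixes f :: "real \<times> real \<Rightarrow> real"
  assumes f[measurable]: "f \<in> borel_measurable borel" and C: "\<And>P. P \<in> {x1..x2} \<times> {t1..t2} \<Longrightarrow> \<bar>f P\<bar> \<le> C"
    and inner: "\<And>s. s \<in> {t1..t2} \<Longrightarrow> (\<integral>y. f (y, s) * indicator {x1..x2} y \<partial>lborel) = J s"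
  shows "(\<integral>P. indicator ({x1..x2} \<times> {t1..t2}) P * f P \<partial>lborel) = (\<integral>s. indicator {t1..t2} s * J s \<partial>lborel)"
proof -
  let ?F = "\<lambda>P. indicator ({x1..x2} \<times> {t1..t2}) P * f P"
  have "\<bar>?F P\<bar> \<le> \<bar>C\<bar>" for P using C[of P] by (auto simp: indicator_def simp del: mem_Times_iff)
  then have "integrable lborel ?F"
    by (intro integrable_rect[of ?F "\<bar>C\<bar>" x1 x2 t1 t2]) (auto simp del: mem_Times_iff)
  then have int: "integrable (lborel \<Otimes>\<^sub>M lborel) (\<lambda>(y, s). ?F (y, s))" by (simp add: lborel_prod case_prod_unfold)
  have "(\<integral>P. ?F P \<partial>lborel) = (\<integral>s. (\<integral>y. ?F (y, s) \<partial>lborel) \<partial>lborel)"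
    using lborel_pair.integral_snd[OF int] by (simp add: lborel_prod case_prod_unfold)
  also have "\<dots> = (\<integral>s. indicator {t1..t2} s * J s \<partial>lborel)"
  proof (rule Bochner_Integration.integral_cong[OF refl])
    fix s
    have "(\<integral>y. ?F (y, s) \<partial>lborel) = indicator {t1..t2} s * (\<integral>y. f (y, s) * indicator {x1..x2} y \<partial>lborel)"
      by (simp add: indicator_times ac_simps flip: integral_mult_right_zero)
    then show "(\<integral>y. ?F (y, s) \<partial>lborel) = indicator {t1..t2} s * J s"
      using inner[of s] by (simp add: indicator_def)
  qed
  finally show ?thesis .
qed

context balance_law
begin

text \<open>For the mollified potential this is the fundamental theorem of calculus in x, integrated
  in time. The left-hand side passes to the limit by the L^1 convergence of averages, the right-hand
  side by the pointwise limit and the common Lipschitz bound in x.\<close>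

lemma rect_integral_p:
  assumes x: "x1 \<le> x2" and t: "0 \<le> t1" "t1 \<le> t2"
  shows "(\<integral>P. indicator ({x1..x2} \<times> {t1..t2}) P * p P \<partial>lborel) = (\<integral>s. indicator {t1..t2} s * (U (x2, s) - U (x1, s)) \<partial>lborel)"
proof (rule LIMSEQ_unique)
  let ?R = "{x1..x2} \<times> {t1..t2} :: (real \<times> real) set"
  let ?h = "\<lambda>n. 1 / real (Suc n)"
  have h0: "?h \<longlonglongrightarrow> 0" using LIMSEQ_inverse_real_of_nat by (simp add: inverse_eq_divide)
  have am[measurable]: "avg (?h n) p \<in> borel_measurable borel" for n
    by (intro borel_measurable_continuous_onI continuous_avg[OF borel_p p_le]) simp
  have int: "integrable lborel (\<lambda>P. indicator ?R P * f P)"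
    if [measurable]: "f \<in> borel_measurable borel" and "\<And>P. \<bar>f P\<bar> \<le> 2 * B" for f
    by (rule integrable_rect[of _ "2 * B" x1 x2 t1 t2])
      (use that B_nonneg in \<open>auto simp: indicator_def simp del: mem_Times_iff\<close>)
  have pB: "\<bar>p P\<bar> \<le> 2 * B" "\<bar>avg (?h n) p P\<bar> \<le> 2 * B" "\<bar>\<bar>avg (?h n) p P - p P\<bar>\<bar> \<le> 2 * B" for P n
    using p_le[of P] abs_avg_le[OF borel_p p_le, of "?h n" P] B_nonneg by linarith+
  show "(\<lambda>n. \<integral>P. indicator ?R P * avg (?h n) p P \<partial>lborel) \<longlonglongrightarrow> (\<integral>P. indicator ?R P * p P \<partial>lborel)"
  proof (rule LIM_zero_cancel, rule Lim_null_comparison[OF always_eventually tendsto_L1_avg[OF borel_p p_le h0], rule_format])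
    fix n
    have "(\<integral>P. indicator ?R P * avg (?h n) p P \<partial>lborel) - (\<integral>P. indicator ?R P * p P \<partial>lborel)
        = (\<integral>P. indicator ?R P * (avg (?h n) p P - p P) \<partial>lborel)"
      using Bochner_Integration.integral_diff[OF int[OF am pB(2)] int[OF borel_p pB(1)]]
      by (simp only: right_diff_distrib)
    also have "norm \<dots> \<le> (\<integral>P. \<bar>indicator ?R P * (avg (?h n) p P - p P)\<bar> \<partial>lborel)"
      using integral_abs_bound by simp
    also have "\<dots> = (\<integral>P. indicator ?R P * \<bar>avg (?h n) p P - p P\<bar> \<partial>lborel)" by (simp add: abs_mult)
    finally show "norm ((\<integral>P. indicator ?R P * avg (?h n) p P \<partial>lborel) - (\<integral>P. indicator ?R P * p P \<partial>lborel))
      \<le> (\<integral>P. indicator ?R P * \<bar>avg (?h n) p P - p P\<bar> \<partial>lborel)" .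
  qed
  have eq: "(\<integral>P. indicator ?R P * avg (?h n) p P \<partial>lborel)
      = (\<integral>s. indicator {t1..t2} s * (Upot (?h n) (x2, s) - Upot (?h n) (x1, s)) \<partial>lborel)" for n
  proof (rule integral_rect_iterated[OF am])
    show "\<bar>avg (?h n) p P\<bar> \<le> B" for P by (rule abs_avg_le[OF borel_p p_le])
    fix s assume s: "s \<in> {t1..t2}"
    have "has_bochner_integral lborel (\<lambda>y. avg (?h n) p (y, s) * indicator {x1..x2} y) (Upot (?h n) (x2, s) - Upot (?h n) (x1, s))"
    proof (rule has_bochner_integral_FTC_Icc_real[OF x])
      show "((\<lambda>y. Upot (?h n) (y, s)) has_real_derivative avg (?h n) p (y, s)) (at y)" for y
        by (rule DERIV_Upot_x) (use s t in auto)
      have "continuous_on UNIV (\<lambda>y. avg (?h n) p (y, s))"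
        by (rule continuous_on_compose2[OF continuous_avg[OF borel_p p_le]]) (auto intro!: continuous_intros)
      then show "isCont (\<lambda>y. avg (?h n) p (y, s)) y" for y using continuous_on_eq_continuous_at[OF open_UNIV] by blast
    qed
    then show "(\<integral>y. avg (?h n) p (y, s) * indicator {x1..x2} y \<partial>lborel) = Upot (?h n) (x2, s) - Upot (?h n) (x1, s)"
      by (simp add: has_bochner_integral_iff)
  qed
  show "(\<lambda>n. \<integral>P. indicator ?R P * avg (?h n) p P \<partial>lborel) \<longlonglongrightarrow> (\<integral>s. indicator {t1..t2} s * (U (x2, s) - U (x1, s)) \<partial>lborel)"
    unfolding eq
  proof (rule integral_dominated_convergence[where w = "\<lambda>s. indicator {t1..t2} s * (B * \<bar>x2 - x1\<bar>)"])
    have cont: "continuous_on {t1..t2} (\<lambda>s. Upot (?h n) (y, s))" for n y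
    proof -
      have "continuous_on {t1..t2} (\<lambda>s. Upot (?h n) (y, s))"
        using DERIV_Upot_t[of "?h n" y] by (intro DERIV_continuous_on[of _ _ "\<lambda>s. - avg (?h n) q (y, s)"])
          (auto intro: has_field_derivative_at_within)
      then show ?thesis .
    qed
    have Um: "(\<lambda>s. indicator {t1..t2} s * Upot (?h n) (y, s)) \<in> borel_measurable borel" for n y
      using borel_measurable_continuous_on_indicator[OF _ cont, of n y] by simp
    show Dm: "(\<lambda>s. indicator {t1..t2} s * (Upot (?h n) (x2, s) - Upot (?h n) (x1, s))) \<in> borel_measurable lborel" for n
      using borel_measurable_diff[OF Um Um, of n x2 n x1] by (simp add: right_diff_distrib)
    show lim: "AE s in lborel. (\<lambda>n. indicator {t1..t2} s * (Upot (?h n) (x2, s) - Upot (?h n) (x1, s)))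
        \<longlonglongrightarrow> indicator {t1..t2} s * (U (x2, s) - U (x1, s))"
    proof (rule AE_I2)
      fix s show "(\<lambda>n. indicator {t1..t2} s * (Upot (?h n) (x2, s) - Upot (?h n) (x1, s)))
        \<longlonglongrightarrow> indicator {t1..t2} s * (U (x2, s) - U (x1, s))"
        by (cases "s \<in> {t1..t2}") (use t in \<open>auto intro!: tendsto_intros U_tendsto simp del: of_nat_Suc\<close>)
    qed
    show "(\<lambda>s. indicator {t1..t2} s * (U (x2, s) - U (x1, s))) \<in> borel_measurable lborel"
    proof (rule borel_measurable_LIMSEQ_real[OF _ Dm])
      fix s show "(\<lambda>n. indicator {t1..t2} s * (Upot (?h n) (x2, s) - Upot (?h n) (x1, s)))
        \<longlonglongrightarrow> indicator {t1..t2} s * (U (x2, s) - U (x1, s))"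
        by (cases "s \<in> {t1..t2}") (use t in \<open>auto intro!: tendsto_intros U_tendsto simp del: of_nat_Suc\<close>)
    qed
    show "integrable lborel (\<lambda>s. indicator {t1..t2} s * (B * \<bar>x2 - x1\<bar>))"
      by (rule integrable_Icc[of _ "B * \<bar>x2 - x1\<bar>" t1 t2]) (use B_nonneg in \<open>auto simp: indicator_def\<close>)
    show "AE s in lborel. norm (indicator {t1..t2} s * (Upot (?h n) (x2, s) - Upot (?h n) (x1, s)))
        \<le> indicator {t1..t2} s * (B * \<bar>x2 - x1\<bar>)" for n
      by (rule AE_I2) (use Upot_lipschitz_x[of "?h n"] t in \<open>auto simp: indicator_def\<close>)
  qed
qed

text \<open>Where \<open>U\<close> has a classical x-derivative \<open>g\<close>, both
  \<open>p\<close> and \<open>g\<close> have the increments of \<open>U\<close> as integrals over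
  rectangles. The open strip is exhausted by the closed rectangles \<open>?K n\<close>, to which the
  uniqueness lemma applies.\<close>

lemma AE_p_eq_deriv_U:
  assumes [measurable]: "g \<in> borel_measurable borel"
    and G: "\<And>x t. a < x \<Longrightarrow> x < b \<Longrightarrow> 0 < t \<Longrightarrow> \<bar>g (x, t)\<bar> \<le> G"
    and cont: "\<And>x t. a < x \<Longrightarrow> x < b \<Longrightarrow> 0 < t \<Longrightarrow> isCont (\<lambda>y. g (y, t)) x"
    and deriv: "\<And>x t. a < x \<Longrightarrow> x < b \<Longrightarrow> 0 < t \<Longrightarrow> ((\<lambda>y. U (y, t)) has_real_derivative g (x, t)) (at x)"
  shows "AE P in lborel. P \<in> {a<..<b} \<times> {0<..} \<longrightarrow> p P = g P"
proof -
  let ?K = "\<lambda>n. {a + 1 / real (Suc n)..b - 1 / real (Suc n)} \<times> {1 / real (Suc n)..real (Suc n)} :: (real \<times> real) set"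
  have in_K: "a < fst P \<and> fst P < b \<and> 0 < snd P" if "P \<in> ?K n" for n P
  proof -
    define e where "e = 1 / real (Suc n)"
    have "0 < e" by (simp add: e_def)
    then show ?thesis using that unfolding e_def[symmetric] by (cases P) auto
  qed
  have "AE P in lborel. P \<in> ?K n \<longrightarrow> p P - g P = 0" for n
  proof (rule AE_zero_if_rect_integrals_zero[where C = "B + G"])
    show "\<bar>p P - g P\<bar> \<le> B + G" if "P \<in> ?K n" for P
      using in_K[OF that] G[of "fst P" "snd P"] p_le[of P] by simp
    fix x1 x2 t1 t2 assume x: "a + 1 / real (Suc n) \<le> x1" "x1 \<le> x2" "x2 \<le> b - 1 / real (Suc n)"
      and t: "1 / real (Suc n) \<le> t1" "t1 \<le> t2" "t2 \<le> real (Suc n)"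
    have e: "0 < 1 / real (Suc n)" by simp
    have pos: "0 < t1" "a < x1" "x2 < b" using x t e by linarith+
    have GR: "\<bar>g P\<bar> \<le> G" if "P \<in> {x1..x2} \<times> {t1..t2}" for P
      using that G[of "fst P" "snd P"] pos by (cases P) auto
    have "(\<integral>P. indicator ({x1..x2} \<times> {t1..t2}) P * g P \<partial>lborel) = (\<integral>s. indicator {t1..t2} s * (U (x2, s) - U (x1, s)) \<partial>lborel)"
    proof (rule integral_rect_iterated[OF _ GR])
      fix s assume s: "s \<in> {t1..t2}"
      have "has_bochner_integral lborel (\<lambda>y. g (y, s) * indicator {x1..x2} y) (U (x2, s) - U (x1, s))"
        by (rule has_bochner_integral_FTC_Icc_real[OF x(2)]) (use pos s in \<open>auto intro!: deriv cont\<close>)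
      then show "(\<integral>y. g (y, s) * indicator {x1..x2} y \<partial>lborel) = U (x2, s) - U (x1, s)"
        by (simp add: has_bochner_integral_iff)
    qed measurable
    moreover have "integrable lborel (\<lambda>P. indicator ({x1..x2} \<times> {t1..t2}) P * g P)"
      by (rule integrable_rect[of _ "\<bar>G\<bar>" x1 x2 t1 t2])
        (use GR in \<open>force simp: indicator_def simp del: mem_Times_iff\<close>)+
    moreover have "integrable lborel (\<lambda>P. indicator ({x1..x2} \<times> {t1..t2}) P * p P)"
      by (rule integrable_rect[of _ B x1 x2 t1 t2])
        (use p_le B_nonneg in \<open>auto simp: indicator_def simp del: mem_Times_iff\<close>)
    ultimately show "(\<integral>P. indicator ({x1..x2} \<times> {t1..t2}) P * (p P - g P) \<partial>lborel) = 0"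
      using rect_integral_p[OF x(2) less_imp_le[OF pos(1)] t(2)] by (simp add: right_diff_distrib)
  qed measurable
  then have "AE P in lborel. \<forall>n. P \<in> ?K n \<longrightarrow> p P - g P = 0" unfolding AE_all_countable by blast
  then show ?thesis
  proof eventually_elim
    case (elim P)
    show ?case
    proof
      assume P: "P \<in> {a<..<b} \<times> {0<..}"
      obtain x t where xt: "P = (x, t)" by (cases P)
      \<comment> \<open>The entry 1 / (t + 1) guarantees that \<open>Suc n\<close> exceeds t, so
        that the point lies below the top of \<open>?K n\<close>.\<close>
      define m where "m = min (min (x - a) (b - x)) (min t (1 / (t + 1)))"
      have "0 < m" using P xt by (auto simp: m_def)
      then obtain n where n: "1 / real (Suc n) < m" using reals_Archimedean by (auto simp: inverse_eq_divide)
      then have n': "1 / real (Suc n) < x - a" "1 / real (Suc n) < b - x" "1 / real (Suc n) < t" "1 / real (Suc n) < 1 / (t + 1)"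
        by (auto simp: m_def)
      have "t + 1 < real (Suc n)" using n'(4) P xt by (simp add: field_simps)
      then have "P \<in> ?K n" unfolding xt using n' by (simp del: of_nat_Suc)
      then show "p P = g P" using elim by auto
    qed
  qed
qed

text \<open>The commutator of the Lipschitz velocity with the averaging operator is \<open>O(h)\<close>.\<close>

lemma U_const_along_path:
  assumes vel: "AE P in lborel. P \<in> {a<..<b} \<times> {0<..} \<longrightarrow> q P = g P * p P"
    and L: "\<And>x x' t t'. x \<in> {a<..<b} \<Longrightarrow> x' \<in> {a<..<b} \<Longrightarrow> 0 < t \<Longrightarrow> 0 < t' \<Longrightarrow> \<bar>g (x, t) - g (x', t')\<bar> \<le> L * (\<bar>x - x'\<bar> + \<bar>t - t'\<bar>)"
    and t: "0 \<le> t1" "t1 < t2"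
    and X: "continuous_on {t1..t2} X"
    and in_ab: "\<And>t. t1 < t \<Longrightarrow> t < t2 \<Longrightarrow> X t \<in> {a<..<b}"
    and DX: "\<And>t. t1 < t \<Longrightarrow> t < t2 \<Longrightarrow> (X has_real_derivative g (X t, t)) (at t)"
  shows "U (X t1, t1) = U (X t2, t2)"
proof -
  have sub_le: "\<bar>U (X s1, s1) - U (X s2, s2)\<bar> \<le> 0" if s: "t1 < s1" "s1 < s2" "s2 < t2" for s1 s2
  proof -
    \<comment> \<open>Averages look to the upper right of the path, so the path must keep a distance
      from the right boundary \<open>b\<close>. Compactness provides one on each closed subinterval;
      the end times are added at the very end.\<close>
    have "compact (X ` {s1..s2})" using s by (intro compact_continuous_image continuous_on_subset[OF X]) auto
    moreover have "X ` {s1..s2} \<noteq> {}" using s by simp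
    ultimately obtain m where m: "m \<in> X ` {s1..s2}" "\<And>y. y \<in> X ` {s1..s2} \<Longrightarrow> y \<le> m"
      using compact_attains_sup by metis
    have mb: "m < b" using m(1) in_ab s by force
    have est: "\<bar>Upot h (X s2, s2) - Upot h (X s1, s1)\<bar> \<le> B * L * 2 * h * (s2 - s1)" if h: "0 < h" "h < b - m" for h
    proof -
      have D: "((\<lambda>s. Upot h (X s, s)) has_real_derivative avg h p (X s, s) * g (X s, s) - avg h q (X s, s)) (at s)"
        if "s1 \<le> s" "s \<le> s2" for s
        by (rule DERIV_Upot_path[OF h(1) _ DX]) (use that s t in auto)
      have bd: "\<bar>avg h p (X s, s) * g (X s, s) - avg h q (X s, s)\<bar> \<le> B * L * 2 * h" if "s1 \<le> s" "s \<le> s2" for s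
      proof -
        have s0: "0 < s" using that s t by simp
        have Xs: "X s \<in> {a<..<b}" "X s + h < b" using that s in_ab[of s] m(2)[of "X s"] h by auto
        let ?k = "\<lambda>Q. bump ((fst Q - X s) / h) / h * (bump ((snd Q - s) / h) / h)"
        let ?c = "g (X s, s)"
        have k0: "0 \<le> ?k Q" for Q using h by (simp add: bump_nonneg)
        have kint: "integrable lborel (\<lambda>Q. v Q * ?k Q)"
          if [measurable]: "v \<in> borel_measurable borel" and v: "\<And>Q. \<bar>v Q\<bar> \<le> C" for v C
        proof (rule integrable_rect[of _ "C * (2 / h * (2 / h))" "X s" "X s + h" s "s + h"])
          have C0: "0 \<le> C" using v abs_ge_zero order_trans by blast
          show "\<bar>v Q * ?k Q\<bar> \<le> C * (2 / h * (2 / h))" for Q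
            unfolding abs_mult abs_divide using h C0 by (intro mult_mono v divide_mono bump_abs_le) auto
          show "v Q * ?k Q = 0" if "Q \<notin> {X s..X s + h} \<times> {s..s + h}" for Q
            using that scaled_0[OF h(1), of "fst Q" "X s"] scaled_0[OF h(1), of "snd Q" s] by (cases Q) auto
        qed measurable
        have eq: "avg h p (X s, s) * ?c - avg h q (X s, s) = (\<integral>Q. ?c * (p Q * ?k Q) - q Q * ?k Q \<partial>lborel)"
          unfolding avg_kernel[OF borel_p h(1)] avg_kernel[OF borel_q h(1)]
            Bochner_Integration.integral_diff[OF integrable_mult_right[OF kint[OF borel_p p_le]] kint[OF borel_q q_le]]
            integral_mult_right_zero by (simp only: mult.commute)
        have le: "\<bar>\<integral>Q. ?c * (p Q * ?k Q) - q Q * ?k Q \<partial>lborel\<bar> \<le> (\<integral>Q. (B * L * 2 * h) * ?k Q \<partial>lborel)"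
        proof (rule order_trans[OF integral_abs_bound], rule integral_mono_AE)
          show "integrable lborel (\<lambda>Q. \<bar>?c * (p Q * ?k Q) - q Q * ?k Q\<bar>)"
            by (intro integrable_abs Bochner_Integration.integrable_diff integrable_mult_right
                kint[OF borel_p p_le] kint[OF borel_q q_le])
          show "integrable lborel (\<lambda>Q. (B * L * 2 * h) * ?k Q)"
            using kint[of "\<lambda>_. B * L * 2 * h" "\<bar>B * L * 2 * h\<bar>"] by simp
          show "AE Q in lborel. \<bar>?c * (p Q * ?k Q) - q Q * ?k Q\<bar> \<le> (B * L * 2 * h) * ?k Q"
            using vel
          proof eventually_elim
            case (elim Q)
            show ?case
            proof (cases "Q \<in> {X s..X s + h} \<times> {s..s + h}")
              case True
              obtain y r where Q: "Q = (y, r)" by (cases Q)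
              have yr: "X s \<le> y" "y \<le> X s + h" "s \<le> r" "r \<le> s + h" using True Q by auto
              then have dom: "y \<in> {a<..<b}" "0 < r" using Xs s0 by auto
              have "\<bar>?c - g Q\<bar> \<le> L * (\<bar>X s - y\<bar> + \<bar>s - r\<bar>)" unfolding Q by (rule L[OF Xs(1) dom(1) s0 dom(2)])
              also have "\<dots> \<le> L * (2 * h)"
              proof (rule mult_left_mono)
                show "\<bar>X s - y\<bar> + \<bar>s - r\<bar> \<le> 2 * h" using yr by linarith
                show "0 \<le> L" using L[OF Xs(1) Xs(1), of 1 2] by simp
              qed
              finally have "\<bar>p Q\<bar> * \<bar>?c - g Q\<bar> \<le> B * (L * (2 * h))"
                using p_le[of Q] B_nonneg by (intro mult_mono) auto
              then have "\<bar>p Q\<bar> * \<bar>?c - g Q\<bar> * ?k Q \<le> B * (L * (2 * h)) * ?k Q" by (rule mult_right_mono[OF _ k0])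
              moreover have "?c * (p Q * ?k Q) - q Q * ?k Q = p Q * (?c - g Q) * ?k Q"
                using elim dom unfolding Q by (simp add: algebra_simps)
              moreover have "\<bar>p Q * (?c - g Q) * ?k Q\<bar> = \<bar>p Q\<bar> * \<bar>?c - g Q\<bar> * ?k Q"
                unfolding abs_mult[of "p Q * (?c - g Q)"] abs_mult[of "p Q"] abs_of_nonneg[OF k0] ..
              moreover have "B * (L * (2 * h)) = B * L * 2 * h" by simp
              ultimately show ?thesis by (simp only:)
            next
              case False
              then have "?k Q = 0"
                using scaled_0[OF h(1), of "fst Q" "X s"] scaled_0[OF h(1), of "snd Q" s] by (cases Q) auto
              then show ?thesis by (simp only: mult_zero_right diff_self abs_zero order_refl)
            qed
          qed
        qed
        have one: "(\<integral>Q. (B * L * 2 * h) * ?k Q \<partial>lborel) = B * L * 2 * h"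
        proof -
          have "(\<integral>Q. 1 * ?k Q \<partial>lborel) = 1"
            using avg_kernel[of "\<lambda>_. 1" h "X s" s, symmetric] h(1) avg_const[of h 1 "(X s, s)"] by (simp only: borel_measurable_const)
          then show ?thesis by (simp only: integral_mult_right_zero mult_1 mult_1_right)
        qed
        show ?thesis unfolding eq using le unfolding one .
      qed
      have "norm (Upot h (X s2, s2) - Upot h (X s1, s1)) \<le> (B * L * 2 * h) * norm (s2 - s1)"
      proof (rule field_differentiable_bound[of "{s1..s2}" "\<lambda>s. Upot h (X s, s)" "\<lambda>s. avg h p (X s, s) * g (X s, s) - avg h q (X s, s)"])
        show "((\<lambda>s. Upot h (X s, s)) has_field_derivative avg h p (X s, s) * g (X s, s) - avg h q (X s, s)) (at s within {s1..s2})"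
          if "s \<in> {s1..s2}" for s using D[of s] that by (auto intro: has_field_derivative_at_within)
      qed (use bd s in auto)
      then show ?thesis using s by simp
    qed
    have "U (X s2, s2) - U (X s1, s1) \<le> 0"
      by (rule U_limit_le[where K = "B * L * 2 * (s2 - s1)" and e = "b - m"]) (use est s t mb in \<open>force simp: algebra_simps abs_le_iff\<close>)+
    moreover have "U (X s1, s1) - U (X s2, s2) \<le> 0"
      by (rule U_limit_le[where K = "B * L * 2 * (s2 - s1)" and e = "b - m"]) (use est s t mb in \<open>force simp: algebra_simps abs_le_iff\<close>)+
    ultimately show ?thesis by simp
  qed
  \<comment> \<open>Continuity extends the constancy to the closed time interval. The path may then
    start or end on the boundary of the strip, that is on an edge or a shock, which is how pieces of
    characteristics are joined.\<close>
  have Ucont: "continuous_on {t1..t2} (\<lambda>s. U (X s, s))"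
  proof (rule continuous_on_eq_continuous_within[THEN iffD2], rule ballI)
    fix s assume s: "s \<in> {t1..t2}"
    have "((\<lambda>r. B * \<bar>X r - X s\<bar> + B * \<bar>r - s\<bar>) \<longlongrightarrow> B * \<bar>X s - X s\<bar> + B * \<bar>s - s\<bar>) (at s within {t1..t2})"
      using X s by (intro tendsto_intros) (auto simp: continuous_on_def)
    then have "((\<lambda>r. B * \<bar>X r - X s\<bar> + B * \<bar>r - s\<bar>) \<longlongrightarrow> 0) (at s within {t1..t2})" by simp
    moreover have "eventually (\<lambda>r. norm (U (X r, r) - U (X s, s)) \<le> B * \<bar>X r - X s\<bar> + B * \<bar>r - s\<bar>) (at s within {t1..t2})"
      unfolding eventually_at_filter
    proof (rule always_eventually, intro allI impI)
      fix r assume "r \<in> {t1..t2}"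
      then have "0 \<le> r" "0 \<le> s" using s t by auto
      then show "norm (U (X r, r) - U (X s, s)) \<le> B * \<bar>X r - X s\<bar> + B * \<bar>r - s\<bar>"
        using U_lipschitz_x[of r "X r" "X s"] U_lipschitz_t[of r s "X s"] by simp
    qed
    ultimately have "((\<lambda>r. U (X r, r) - U (X s, s)) \<longlongrightarrow> 0) (at s within {t1..t2})"
      by (rule Lim_null_comparison[rotated])
    then show "continuous (at s within {t1..t2}) (\<lambda>s. U (X s, s))"
      unfolding continuous_within by (rule LIM_zero_cancel)
  qed
  define m where "m = (t1 + t2) / 2"
  have m: "t1 < m" "m < t2" using t by (auto simp: m_def)
  define c where "c = U (X m, m)"
  have const: "U (X s, s) = c" if "s \<in> {t1<..<t2}" for s
  proof -
    consider "s < m" | "s = m" | "m < s" by linarith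
    then show ?thesis
      using sub_le[of s m] sub_le[of m s] that m unfolding c_def by cases auto
  qed
  have cl: "closure {t1<..<t2} = {t1..t2}" using t by simp
  have "U (X s, s) = c" if "s \<in> {t1..t2}" for s
    using continuous_constant_on_closure[of "{t1<..<t2}" "\<lambda>s. U (X s, s)" c s] Ucont const that unfolding cl by auto
  then show ?thesis using t by simp
qed

end

text \<open>Fixes the additive constant: at x = 0 the two steps in the initial term coincide, and
  the flux term of \<open>Upot\<close> at time 0 is O(h).\<close>

lemma (in balance_law) U_origin: "U (0, 0) = 0"
proof -
  have "\<bar>U (0, 0)\<bar> \<le> 0"
  proof (rule LIMSEQ_le)
    let ?h = "\<lambda>n. 1 / real (Suc n)"
    show "(\<lambda>n. \<bar>Upot (?h n) (0, 0)\<bar>) \<longlonglongrightarrow> \<bar>U (0, 0)\<bar>" by (intro tendsto_intros U_tendsto) simp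
    have "(\<lambda>n. 2 * B * ?h n) \<longlonglongrightarrow> 2 * B * 0"
      by (intro tendsto_intros LIMSEQ_inverse_real_of_nat[unfolded inverse_eq_divide])
    then show "(\<lambda>n. 2 * B * ?h n) \<longlonglongrightarrow> 0" by simp
    have est: "\<bar>Upot h (0, 0)\<bar> \<le> 2 * B * h" if h: "0 < h" for h
    proof -
      have "\<bar>\<integral>Q. q Q * (bump ((fst Q - 0) / h) / h * (1 - step ((snd Q - 0) / h))) \<partial>lborel\<bar>
          \<le> B * (2 / h * 1) * ((0 + h - 0) * (\<bar>0\<bar> + h - 0))"
      proof (rule abs_integral_rect)
        show "\<bar>q Q * (bump ((fst Q - 0) / h) / h * (1 - step ((snd Q - 0) / h)))\<bar> \<le> B * (2 / h * 1)" for Q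
          unfolding abs_mult abs_divide using h B_nonneg
          by (intro mult_mono q_le one_minus_step_abs_le divide_mono bump_abs_le) auto
        show "q Q * (bump ((fst Q - 0) / h) / h * (1 - step ((snd Q - 0) / h))) = 0" if "Q \<notin> {0..0 + h} \<times> {0..\<bar>0\<bar> + h}" for Q
          using q_kernel_0(1)[OF h that] by auto
      qed (use h in auto)
      then show ?thesis using h by (simp add: Upot_def)
    qed
    show "\<exists>N. \<forall>n\<ge>N. \<bar>Upot (?h n) (0, 0)\<bar> \<le> 2 * B * ?h n" by (intro exI[of _ 0] allI impI est) simp
  qed
  then show ?thesis by simp
qed

section \<open>Transport of v along the characteristics through one tooth\<close>

locale burgers_transport = burgers_entropy u u0 B + V: balance_law v "\<lambda>P. (u P - 1) * v P" v0 C
  for u :: "real \<times> real \<Rightarrow> real" and u0 :: "real \<Rightarrow> real" and B :: real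
    and v :: "real \<times> real \<Rightarrow> real" and v0 :: "real \<Rightarrow> real" and C :: real
begin

text \<open>In a strip where the potential of u is smooth, u agrees almost everywhere with the
  Lipschitz function \<open>g\<close>. The potential of v sees the velocity only under integrals, so
  \<open>g - 1\<close> may take the place of u - 1 although a single path is a null set.\<close>

lemma V_const_along_path:
  assumes g: "g \<in> borel_measurable borel"
    and G: "\<And>x t. a < x \<Longrightarrow> x < b \<Longrightarrow> 0 < t \<Longrightarrow> \<bar>g (x, t)\<bar> \<le> G"
    and cont: "\<And>x t. a < x \<Longrightarrow> x < b \<Longrightarrow> 0 < t \<Longrightarrow> isCont (\<lambda>y. g (y, t)) x"
    and deriv: "\<And>x t. a < x \<Longrightarrow> x < b \<Longrightarrow> 0 < t \<Longrightarrow> ((\<lambda>y. U (y, t)) has_real_derivative g (x, t)) (at x)"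
    and L: "\<And>x x' t t'. x \<in> {a<..<b} \<Longrightarrow> x' \<in> {a<..<b} \<Longrightarrow> 0 < t \<Longrightarrow> 0 < t' \<Longrightarrow> \<bar>g (x, t) - g (x', t')\<bar> \<le> L * (\<bar>x - x'\<bar> + \<bar>t - t'\<bar>)"
    and t: "0 \<le> t1" "t1 < t2"
    and X: "continuous_on {t1..t2} X"
    and in_ab: "\<And>t. t1 < t \<Longrightarrow> t < t2 \<Longrightarrow> X t \<in> {a<..<b}"
    and DX: "\<And>t. t1 < t \<Longrightarrow> t < t2 \<Longrightarrow> (X has_real_derivative g (X t, t) - 1) (at t)"
  shows "V.U (X t1, t1) = V.U (X t2, t2)"
proof (rule V.U_const_along_path[where g = "\<lambda>P. g P - 1" and a = a and b = b and L = L])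
  have "AE P in lborel. P \<in> {a<..<b} \<times> {0<..} \<longrightarrow> u P = g P"
    by (rule AE_p_eq_deriv_U[OF g G cont deriv])
  then show "AE P in lborel. P \<in> {a<..<b} \<times> {0<..} \<longrightarrow> (u P - 1) * v P = (g P - 1) * v P"
    by eventually_elim auto
qed (use L t X in_ab DX in auto)

text \<open>The curve solves x' = (x - e) / (t + \<tau>) - 1, whose right-hand side is the velocity
  of v in a rarefaction centred at (e, - \<tau>). The Lipschitz constant adds the bounds 1 / \<tau>
  and l / \<tau>^2 of the two partial derivatives.\<close>

lemma V_const_in_rarefaction:
  assumes \<tau>: "0 < \<tau>" and l: "\<And>x. a < x \<Longrightarrow> x < b \<Longrightarrow> \<bar>x - e\<bar> \<le> l"
    and U: "\<And>x t. a < x \<Longrightarrow> x < b \<Longrightarrow> 0 < t \<Longrightarrow> U (x, t) = (x - e)\<^sup>2 / (2 * (t + \<tau>))"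
    and t: "0 \<le> t1" "t1 < t2"
    and in_ab: "\<And>t. t1 < t \<Longrightarrow> t < t2 \<Longrightarrow> e + (t + \<tau>) * (K - ln (t + \<tau>)) \<in> {a<..<b}"
  shows "V.U (e + (t1 + \<tau>) * (K - ln (t1 + \<tau>)), t1) = V.U (e + (t2 + \<tau>) * (K - ln (t2 + \<tau>)), t2)"
proof -
  define X where "X t = e + (t + \<tau>) * (K - ln (t + \<tau>))" for t
  define g where "g P = (fst P - e) / (snd P + \<tau>)" for P :: "real \<times> real"
  have ab: "a < b" using in_ab[of "(t1 + t2) / 2"] t by auto
  have l0: "0 \<le> l" using l[of "(a + b) / 2"] ab by (auto intro: order_trans[OF abs_ge_zero])
  have "V.U (X t1, t1) = V.U (X t2, t2)"
  proof (rule V_const_along_path[where g = g and a = a and b = b and G = "l / \<tau>" and L = "1 / \<tau> + l / \<tau>\<^sup>2"])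
    show "g \<in> borel_measurable borel" unfolding g_def[abs_def] by measurable
    show "\<bar>g (x, t)\<bar> \<le> l / \<tau>" if "a < x" "x < b" "0 < t" for x t
      unfolding g_def abs_divide fst_conv snd_conv using that l[of x] \<tau> by (intro frac_le) auto
    show "isCont (\<lambda>y. g (y, t)) x" if "0 < t" for x t
      unfolding g_def using that \<tau> by (auto intro!: continuous_intros)
    show "((\<lambda>y. U (y, t)) has_real_derivative g (x, t)) (at x)" if x: "a < x" "x < b" "0 < t" for x t
    proof -
      have "((\<lambda>y. (y - e)\<^sup>2 / (2 * (t + \<tau>))) has_real_derivative 2 * (x - e) / (2 * (t + \<tau>))) (at x)"
        by (rule DERIV_cdivide) (rule derivative_eq_intros refl | simp)+
      then have "((\<lambda>y. (y - e)\<^sup>2 / (2 * (t + \<tau>))) has_real_derivative g (x, t)) (at x)"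
        unfolding g_def fst_conv snd_conv by (simp only: mult_divide_mult_cancel_left_if) simp
      then show ?thesis
        by (rule has_field_derivative_transform_within_open[of _ _ _ "{a<..<b}"]) (use x U in auto)
    qed
    show "\<bar>g (x, t) - g (x', t')\<bar> \<le> (1 / \<tau> + l / \<tau>\<^sup>2) * (\<bar>x - x'\<bar> + \<bar>t - t'\<bar>)"
      if "x \<in> {a<..<b}" "x' \<in> {a<..<b}" "0 < t" "0 < t'" for x x' t t'
    proof -
      have pos: "0 < t + \<tau>" "0 < t' + \<tau>" using that \<tau> by auto
      have "g (x, t) - g (x', t') = (x - x') / (t + \<tau>) + (x' - e) * (t' - t) / ((t + \<tau>) * (t' + \<tau>))"
      proof -
        have "y / A - y' / A' = (y - y') / A + y' * (A' - A) / (A * A')" if "0 < A" "0 < A'" for y y' A A' :: real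
          using that by (simp add: field_simps)
        from this[OF pos, of "x - e" "x' - e"] show ?thesis unfolding g_def by simp
      qed
      also have "\<bar>\<dots>\<bar> \<le> \<bar>x - x'\<bar> / \<tau> + l * \<bar>t - t'\<bar> / \<tau>\<^sup>2"
      proof (rule order_trans[OF abs_triangle_ineq], rule add_mono)
        show "\<bar>(x - x') / (t + \<tau>)\<bar> \<le> \<bar>x - x'\<bar> / \<tau>" using that \<tau> by (simp add: frac_le)
        have "\<bar>x' - e\<bar> * \<bar>t' - t\<bar> \<le> l * \<bar>t - t'\<bar>" using l[of x'] that by (intro mult_mono) auto
        moreover have "\<tau>\<^sup>2 \<le> (t + \<tau>) * (t' + \<tau>)" unfolding power2_eq_square using that \<tau> by (intro mult_mono) auto
        ultimately have "\<bar>x' - e\<bar> * \<bar>t' - t\<bar> / ((t + \<tau>) * (t' + \<tau>)) \<le> l * \<bar>t - t'\<bar> / \<tau>\<^sup>2"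
          using \<tau> l0 by (intro frac_le) auto
        then show "\<bar>(x' - e) * (t' - t) / ((t + \<tau>) * (t' + \<tau>))\<bar> \<le> l * \<bar>t - t'\<bar> / \<tau>\<^sup>2"
          using pos by (simp add: abs_mult)
      qed
      also have "\<dots> \<le> (1 / \<tau> + l / \<tau>\<^sup>2) * (\<bar>x - x'\<bar> + \<bar>t - t'\<bar>)"
      proof -
        have "0 \<le> 1 / \<tau> * \<bar>t - t'\<bar>" "0 \<le> l / \<tau>\<^sup>2 * \<bar>x - x'\<bar>" using \<tau> l0 by auto
        moreover have "(1 / \<tau> + l / \<tau>\<^sup>2) * (\<bar>x - x'\<bar> + \<bar>t - t'\<bar>) = \<bar>x - x'\<bar> / \<tau> + l * \<bar>t - t'\<bar> / \<tau>\<^sup>2 + (1 / \<tau> * \<bar>t - t'\<bar> + l / \<tau>\<^sup>2 * \<bar>x - x'\<bar>)"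
          by (simp add: algebra_simps)
        ultimately show ?thesis by linarith
      qed
      finally show ?thesis .
    qed
    show DX: "(X has_real_derivative g (X t, t) - 1) (at t)" if "t1 < t" for t
    proof -
      have pos: "0 < t + \<tau>" using that t \<tau> by auto
      have d1: "((\<lambda>t. t + \<tau>) has_real_derivative 1) (at t)" by (auto intro!: derivative_eq_intros)
      from DERIV_chain2[OF DERIV_ln_divide[OF pos] d1]
      have "((\<lambda>t. ln (t + \<tau>)) has_real_derivative 1 / (t + \<tau>)) (at t)" by simp
      from DERIV_add[OF DERIV_const[of e] DERIV_mult[OF d1 DERIV_diff[OF DERIV_const[of K] this]]]
      show ?thesis using pos by (simp add: X_def[abs_def] g_def)
    qed
    show "continuous_on {t1..t2} X" unfolding X_def[abs_def] using t \<tau> by (auto intro!: continuous_intros)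
    show "X t \<in> {a<..<b}" if "t1 < t" "t < t2" for t using in_ab[OF that] by (simp add: X_def)
  qed (use t in auto)
  then show ?thesis by (simp add: X_def)
qed

text \<open>In a rarefaction the quantity \<open>u + ln (t + \<tau>)\<close> is constant along the characteristics of
  the second equation. With \<open>k\<close> the strength of the shock at the time it is met, a characteristic enters the
  block at \<open>t + \<tau> = \<sigma> e^-k\<close>, meets the shock at \<open>\<sigma>\<close>, and leaves at \<open>\<sigma> e^k\<close>.\<close>

lemma V_across_block:
  assumes \<tau>: "0 < \<tau>" and \<sigma>: "0 < \<sigma>" and l: "0 < l" and k: "l / \<sigma> < 1" and T: "\<tau> \<le> \<sigma> * exp (- (l / \<sigma>))"
    and U: "\<And>x t. \<bar>x - p\<bar> \<le> l \<Longrightarrow> 0 \<le> t \<Longrightarrow> U (x, t) = (l - \<bar>x - p\<bar>)\<^sup>2 / (2 * (t + \<tau>))"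
  shows "V.U (p + l, \<sigma> * exp (- (l / \<sigma>)) - \<tau>) = V.U (p - l, \<sigma> * exp (l / \<sigma>) - \<tau>)"
proof -
  define k where "k = l / \<sigma>"
  have k: "0 < k" "k < 1" "\<sigma> * k = l" using assms by (auto simp: k_def)
  have em: "exp (- k) < 1" "1 < exp k" using k by auto
  have order: "\<sigma> * exp (- k) < \<sigma>" "\<sigma> < \<sigma> * exp k" using em \<sigma> by auto
  have T0: "0 \<le> \<sigma> * exp (- k) - \<tau>" using T by (simp add: k_def)
  have lns: "ln (\<sigma> * exp (- k)) = ln \<sigma> - k" "ln (\<sigma> * exp k) = ln \<sigma> + k" using \<sigma> by (auto simp: ln_mult_pos)
  \<comment> \<open>Right half, with centre p + l and K = ln \<sigma> - k: the curve is at the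
    centre when t + \<tau> = \<sigma> exp (-k), and at \<sigma> it has moved by \<sigma> k = l, onto
    the shock.\<close>
  have "V.U ((p + l) + ((\<sigma> * exp (- k) - \<tau>) + \<tau>) * (ln \<sigma> - k - ln ((\<sigma> * exp (- k) - \<tau>) + \<tau>)), \<sigma> * exp (- k) - \<tau>)
    = V.U ((p + l) + ((\<sigma> - \<tau>) + \<tau>) * (ln \<sigma> - k - ln ((\<sigma> - \<tau>) + \<tau>)), \<sigma> - \<tau>)"
  proof (rule V_const_in_rarefaction[OF \<tau>, where a = p and b = "p + l" and l = l])
    show "U (x, t) = (x - (p + l))\<^sup>2 / (2 * (t + \<tau>))" if "p < x" "x < p + l" "0 < t" for x t
    proof -
      have "(l - \<bar>x - p\<bar>)\<^sup>2 = (x - (p + l))\<^sup>2" using that by (simp add: power2_eq_square algebra_simps)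
      then show ?thesis using U[of x t] that by simp
    qed
    fix t assume t: "\<sigma> * exp (- k) - \<tau> < t" "t < \<sigma> - \<tau>"
    define r where "r = t + \<tau>"
    have r: "\<sigma> * exp (- k) < r" "r < \<sigma>" using t by (auto simp: r_def)
    have rp: "0 < r" using r \<sigma> by (smt (verit) exp_gt_zero mult_pos_pos)
    have "ln \<sigma> - k < ln r" unfolding lns(1)[symmetric] using r \<sigma> rp by (simp add: ln_less_cancel_iff)
    moreover have "ln r < ln \<sigma>" using r rp \<sigma> by simp
    ultimately have "r * (ln \<sigma> - k - ln r) < 0" "r * (k + ln r - ln \<sigma>) < r * k"
      using rp by (auto simp: mult_pos_neg)
    moreover have "r * k < \<sigma> * k" by (rule mult_strict_right_mono[OF r(2) k(1)])
    ultimately show "(p + l) + (t + \<tau>) * (ln \<sigma> - k - ln (t + \<tau>)) \<in> {p<..<p + l}"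
      unfolding r_def[symmetric] using k(3) by (simp add: algebra_simps)
  qed (use T0 order in auto)
  then have right: "V.U (p + l, \<sigma> * exp (- k) - \<tau>) = V.U (p, \<sigma> - \<tau>)"
    using k by (simp add: lns)
  \<comment> \<open>Left half, with centre p - l and K = ln \<sigma> + k, chosen so that the curve
    is on the shock at \<sigma>, where the first piece ended.\<close>
  have "V.U ((p - l) + ((\<sigma> - \<tau>) + \<tau>) * (ln \<sigma> + k - ln ((\<sigma> - \<tau>) + \<tau>)), \<sigma> - \<tau>)
    = V.U ((p - l) + ((\<sigma> * exp k - \<tau>) + \<tau>) * (ln \<sigma> + k - ln ((\<sigma> * exp k - \<tau>) + \<tau>)), \<sigma> * exp k - \<tau>)"
  proof (rule V_const_in_rarefaction[OF \<tau>, where a = "p - l" and b = p and l = l])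
    show "U (x, t) = (x - (p - l))\<^sup>2 / (2 * (t + \<tau>))" if "p - l < x" "x < p" "0 < t" for x t
    proof -
      have "(l - \<bar>x - p\<bar>)\<^sup>2 = (x - (p - l))\<^sup>2" using that by (simp add: power2_eq_square algebra_simps)
      then show ?thesis using U[of x t] that by simp
    qed
    fix t assume t: "\<sigma> - \<tau> < t" "t < \<sigma> * exp k - \<tau>"
    define r where "r = t + \<tau>"
    have r: "\<sigma> < r" "r < \<sigma> * exp k" using t by (auto simp: r_def)
    have rp: "0 < r" using r \<sigma> by simp
    have lr: "ln r < ln \<sigma> + k" unfolding lns(2)[symmetric] using r \<sigma> rp by (simp add: ln_less_cancel_iff)
    define y where "y = ln r - ln \<sigma>"
    have y: "0 < y" "y < k" using lr r \<sigma> by (auto simp: y_def)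
    have ry: "r = \<sigma> * exp y" using rp \<sigma> by (simp add: y_def exp_diff)
    \<comment> \<open>With r = \<sigma> exp y, staying left of the shock means exp y (k - y) < k.
      Here k < 1 is essential: just left of the shock v has the velocity k - 1, which must be
      negative for the curve to leave the shock.\<close>
    have "1 - y \<le> exp (- y)" using exp_ge_add_one_self[of "- y"] by simp
    then have "k - k * y \<le> k * exp (- y)" using k mult_left_mono[of "1 - y" "exp (- y)" k] by (simp add: algebra_simps)
    moreover have "k * y < y" using k y by simp
    ultimately have "k - y < k * exp (- y)" by linarith
    then have "exp y * (k - y) < exp y * (k * exp (- y))" by simp
    then have "exp y * (k - y) < k" by (simp add: exp_minus field_simps)
    then have "r * (k - y) < \<sigma> * k" using \<sigma> unfolding ry by (simp add: mult.assoc)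
    moreover have "0 < r * (k - y)" using rp y by simp
    ultimately show "(p - l) + (t + \<tau>) * (ln \<sigma> + k - ln (t + \<tau>)) \<in> {p - l<..<p}"
      unfolding r_def[symmetric] using k(3) by (simp add: algebra_simps y_def)
  qed (use T0 order in auto)
  then have "V.U (p, \<sigma> - \<tau>) = V.U (p - l, \<sigma> * exp k - \<tau>)"
    using k by (simp add: lns)
  with right show ?thesis unfolding k_def by simp
qed

end

section \<open>Contraction of the crossing times\<close>

lemma exp_contraction:
  fixes k :: real
  assumes "0 \<le> k" "k < 1"
  shows "exp (2 * k) * (1 - k) \<le> exp (- (2 * k^3 / 3)) * (1 + k)"
proof -
  \<comment> \<open>The logarithmic form of the claim truncates the series ln ((1 + k) / (1 - k)) =
    2 k + 2 k^3 / 3 + ...; its derivative comes down to 2 / (1 - s^2) \<ge> 2 + 2 s^2.\<close>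
  let ?F = "\<lambda>k. ln (1 + k) - ln (1 - k) - 2 * k - 2 * k^3 / 3"
  have "?F 0 \<le> ?F k"
  proof (rule DERIV_nonneg_imp_nondecreasing[OF assms(1)])
    fix s assume s: "0 \<le> s" "s \<le> k"
    then have s1: "s < 1" using assms by simp
    have "(?F has_real_derivative (1 / (1 + s) + 1 / (1 - s) - 2 - 2 * s\<^sup>2)) (at s)"
      using s s1 by (auto intro!: derivative_eq_intros simp: power2_eq_square)
    moreover have "0 \<le> 1 / (1 + s) + 1 / (1 - s) - 2 - 2 * s\<^sup>2"
    proof -
      have s2: "s\<^sup>2 < 1" using s s1 by (simp add: power_less_one_iff abs_square_less_1)
      have "1 / (1 + s) + 1 / (1 - s) = 2 / (1 - s\<^sup>2)" using s s1 s2 by (simp add: field_simps power2_eq_square)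
      moreover have "(2 + 2 * s\<^sup>2) * (1 - s\<^sup>2) \<le> 2" by (simp add: algebra_simps flip: power_add)
      then have "2 + 2 * s\<^sup>2 \<le> 2 / (1 - s\<^sup>2)" using s2 by (simp add: pos_le_divide_eq)
      ultimately show ?thesis by linarith
    qed
    ultimately show "\<exists>y. (?F has_real_derivative y) (at s) \<and> 0 \<le> y" by blast
  qed
  then have "2 * k + ln (1 - k) \<le> - (2 * k^3 / 3) + ln (1 + k)" by simp
  then have "exp (2 * k + ln (1 - k)) \<le> exp (- (2 * k^3 / 3) + ln (1 + k))" by simp
  moreover have "exp (2 * k + ln (1 - k)) = exp (2 * k) * (1 - k)" using assms by (subst exp_add) simp
  moreover have "exp (- (2 * k^3 / 3) + ln (1 + k)) = exp (- (2 * k^3 / 3)) * (1 + k)" using assms by (subst exp_add) simp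
  ultimately show ?thesis by (simp only:)
qed

lemma exp_quarter_le: "exp (1 / 4 :: real) \<le> 21 / 16"
  using exp_bound[of "1 / 4"] by (simp add: power2_eq_square)

text \<open>For a characteristic that meets the shock at t + \<tau> = s, the auxiliary
  \<open>f s\<close> and \<open>g s\<close> are the values of t + \<tau> at entry and at exit. With
  k = l / s the quotient of their derivatives is exp (2 k) (1 - k) / (1 + k). Strengths k \<ge>
  \<delta> / 2 give the stated factor, as 2 / 3 times (\<delta> / 2)^3 is \<delta>^3 / 12.\<close>

lemma crossing_times:
  fixes \<tau> \<delta> T T' :: real
  assumes \<tau>: "0 < \<tau>" and \<delta>: "0 < \<delta>" "\<delta> \<le> 1 / 8" and T: "0 \<le> T" "T \<le> T'" "T' \<le> \<tau> / 4"
  defines "l \<equiv> \<delta> * \<tau>"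
  obtains \<sigma> \<sigma>' where "\<tau> \<le> \<sigma>" "\<sigma> \<le> \<sigma>'" "\<sigma> * exp (- (l / \<sigma>)) = T + \<tau>" "\<sigma>' * exp (- (l / \<sigma>')) = T' + \<tau>"
    "\<sigma> * exp (l / \<sigma>) \<le> \<sigma>' * exp (l / \<sigma>')" "\<sigma>' * exp (l / \<sigma>') \<le> 2 * \<tau>"
    "\<sigma>' * exp (l / \<sigma>') - \<sigma> * exp (l / \<sigma>) \<le> exp (- (\<delta>^3 / 12)) * (T' - T)"
proof -
  define f where "f s = s * exp (- (l / s))" for s
  define g where "g s = s * exp (l / s)" for s
  have l: "0 < l" using \<tau> \<delta> by (simp add: l_def)
  have fc: "continuous_on S f" if "S \<subseteq> {0<..}" for S unfolding f_def using that by (auto intro!: continuous_intros)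
  \<comment> \<open>Entry happens before 5/4 \<tau>, because T' \<le> \<tau> / 4. Hence the
    intermediate value theorem places the meeting with the shock before 2 \<tau>, when the strength
    is still at least half of the initial one.\<close>
  have f2: "5 / 4 * \<tau> \<le> f (2 * \<tau>)"
  proof -
    have eq: "l / (2 * \<tau>) = \<delta> / 2" using \<tau> by (simp add: l_def)
    have "1 - \<delta> / 2 \<le> exp (- (\<delta> / 2))" using exp_ge_add_one_self[of "- (\<delta> / 2)"] by simp
    then have "15 / 16 \<le> exp (- (\<delta> / 2))" using \<delta> by linarith
    then have "2 * \<tau> * (15 / 16) \<le> f (2 * \<tau>)" unfolding f_def eq using \<tau> by (intro mult_left_mono) auto
    then show ?thesis using \<tau> by linarith
  qed
  have "f (T + \<tau>) \<le> T + \<tau>" unfolding f_def using l T \<tau> by (simp add: mult_le_cancel_left1)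
  then have "\<exists>s\<ge>T + \<tau>. s \<le> 2 * \<tau> \<and> f s = T + \<tau>"
    using f2 T \<tau> by (intro IVT' fc) auto
  then obtain \<sigma> where \<sigma>: "T + \<tau> \<le> \<sigma>" "\<sigma> \<le> 2 * \<tau>" "f \<sigma> = T + \<tau>" by blast
  have "\<exists>s\<ge>\<sigma>. s \<le> 2 * \<tau> \<and> f s = T' + \<tau>"
    using f2 T \<tau> \<sigma> by (intro IVT' fc) auto
  then obtain \<sigma>' where \<sigma>': "\<sigma> \<le> \<sigma>'" "\<sigma>' \<le> 2 * \<tau>" "f \<sigma>' = T' + \<tau>" by blast
  have k: "0 < s" "\<delta> / 2 \<le> l / s" "l / s \<le> \<delta>" "l / s < 1" if "\<sigma> \<le> s" "s \<le> \<sigma>'" for s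
  proof -
    have s: "\<tau> \<le> s" "s \<le> 2 * \<tau>" using that \<sigma> \<sigma>' T by auto
    then show "0 < s" using \<tau> by simp
    have "l / s \<le> l / \<tau>" using s \<tau> l by (intro divide_left_mono) auto
    then show *: "l / s \<le> \<delta>" using \<tau> by (simp add: l_def)
    have "l / (2 * \<tau>) \<le> l / s" using s \<tau> l by (intro divide_left_mono) auto
    then show "\<delta> / 2 \<le> l / s" using \<tau> by (simp add: l_def)
    show "l / s < 1" using * \<delta> by simp
  qed
  have Dg: "(g has_real_derivative exp (l / s) * (1 - l / s)) (at s)"
    and Df: "(f has_real_derivative exp (- (l / s)) * (1 + l / s)) (at s)" if "0 < s" for s
  proof -
    have d: "((\<lambda>s. l / s) has_real_derivative - (l / s\<^sup>2)) (at s)"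
      using that by (auto intro!: derivative_eq_intros simp: power2_eq_square)
    have "(g has_real_derivative exp (l / s) + s * (exp (l / s) * - (l / s\<^sup>2))) (at s)"
      unfolding g_def[abs_def] by (rule derivative_eq_intros d refl | simp)+
    then show "(g has_real_derivative exp (l / s) * (1 - l / s)) (at s)"
      using that by (simp add: power2_eq_square algebra_simps)
    have "(f has_real_derivative exp (- (l / s)) + s * (exp (- (l / s)) * (l / s\<^sup>2))) (at s)"
      unfolding f_def[abs_def] by (rule derivative_eq_intros d refl | simp)+
    then show "(f has_real_derivative exp (- (l / s)) * (1 + l / s)) (at s)"
      using that by (simp add: power2_eq_square algebra_simps)
  qed
  have gmono: "g \<sigma> \<le> g \<sigma>'"
  proof (rule DERIV_nonneg_imp_nondecreasing[OF \<sigma>'(1)])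
    fix s assume s: "\<sigma> \<le> s" "s \<le> \<sigma>'"
    then show "\<exists>y. (g has_real_derivative y) (at s) \<and> 0 \<le> y"
      using Dg[OF k(1)[OF s]] k(4)[OF s] by (intro exI[of _ "exp (l / s) * (1 - l / s)"]) auto
  qed
  define c where "c = exp (- (\<delta>^3 / 12))"
  \<comment> \<open>Monotonicity of \<open>g - c * f\<close> carries the bound on the quotient of
    the derivatives over to finite time gaps.\<close>
  have "g \<sigma>' - c * f \<sigma>' \<le> g \<sigma> - c * f \<sigma>"
  proof (rule DERIV_nonpos_imp_nonincreasing[OF \<sigma>'(1)])
    fix s assume s: "\<sigma> \<le> s" "s \<le> \<sigma>'"
    define \<kappa> where "\<kappa> = l / s"
    have "\<delta> / 2 \<le> \<kappa>" "\<kappa> < 1" using k[OF s] by (auto simp: \<kappa>_def)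
    then have \<kappa>: "0 \<le> \<kappa>" "\<delta> / 2 \<le> \<kappa>" "\<kappa> < 1" using \<delta> by linarith+
    have "(\<delta> / 2)^3 \<le> \<kappa>^3" using \<kappa> \<delta> by (intro power_mono) auto
    then have "exp (- (2 * \<kappa>^3 / 3)) \<le> c" unfolding c_def by (simp add: power_divide)
    then have "exp (2 * \<kappa>) * (1 - \<kappa>) \<le> c * (1 + \<kappa>)"
      using exp_contraction[OF \<kappa>(1,3)] \<kappa> by (meson add_nonneg_nonneg mult_right_mono order_trans zero_le_one)
    then have "exp (- \<kappa>) * (exp (2 * \<kappa>) * (1 - \<kappa>)) \<le> exp (- \<kappa>) * (c * (1 + \<kappa>))" by simp
    moreover have "exp (- \<kappa>) * exp (2 * \<kappa>) = exp \<kappa>" by (simp flip: exp_add)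
    ultimately have "exp \<kappa> * (1 - \<kappa>) - c * (exp (- \<kappa>) * (1 + \<kappa>)) \<le> 0" by (simp add: mult.assoc[symmetric]) (simp add: ac_simps)
    moreover have "((\<lambda>s. g s - c * f s) has_real_derivative exp \<kappa> * (1 - \<kappa>) - c * (exp (- \<kappa>) * (1 + \<kappa>))) (at s)"
      unfolding \<kappa>_def by (intro DERIV_diff DERIV_cmult Dg Df k(1)[OF s])
    ultimately show "\<exists>y. ((\<lambda>s. g s - c * f s) has_real_derivative y) (at s) \<and> y \<le> 0" by blast
  qed
  then have gap: "g \<sigma>' - g \<sigma> \<le> c * (T' - T)" using \<sigma>(3) \<sigma>'(3) by (simp add: algebra_simps)
  \<comment> \<open>Exit occurs before 2 \<tau>, as 5/4 times 21/16 is less than 2. In actual time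
    this is at most \<tau>, a quarter of the next \<tau>, which reproduces the hypothesis on T' for
    the following tooth.\<close>
  have "g \<sigma>' = f \<sigma>' * exp (2 * (l / \<sigma>'))"
    unfolding g_def f_def by (simp flip: exp_add)
  also have "\<dots> \<le> (5 / 4 * \<tau>) * (21 / 16)"
  proof (rule mult_mono)
    show "f \<sigma>' \<le> 5 / 4 * \<tau>" using \<sigma>'(3) T by simp
    have "exp (2 * (l / \<sigma>')) \<le> exp (1 / 4)" using k(3)[of \<sigma>'] \<sigma>' \<delta> by simp
    then show "exp (2 * (l / \<sigma>')) \<le> 21 / 16" using exp_quarter_le by linarith
  qed (use \<tau> in auto)
  finally have "g \<sigma>' \<le> 2 * \<tau>" using \<tau> by linarith
  then show thesis
    using that[of \<sigma> \<sigma>'] \<sigma> \<sigma>' T gmono gap unfolding f_def g_def c_def by auto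
qed

section \<open>The initial datum\<close>

text \<open>The ratio 4 matches the exit time, at most \<open>tau n\<close>, with the entry
  condition T' \<le> \<open>tau (Suc n) / 4\<close>. The factor 8 makes the time 2, at which the
  tracked mass has entered the first tooth, admissible for n = 0.\<close>

definition tau :: "nat \<Rightarrow> real" where "tau n = 8 * 4 ^ n"
text \<open>The height of the tooth. The factor 1/8 keeps u small enough for strict hyperbolicity
  and for the estimate exp (2 k) \<le> exp (1/4) at a crossing.\<close>

definition delta :: "nat \<Rightarrow> real" where "delta n = 1 / 8 * real (Suc n) powr (- (1 / 3))"
definition len :: "nat \<Rightarrow> real" where "len n = delta n * tau n"
definition edge :: "nat \<Rightarrow> real" where "edge n = - 2 * (\<Sum>i<n. len i)"
definition mid :: "nat \<Rightarrow> real" where "mid n = edge n - len n"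

text \<open>Both branches have slope 1 / \<open>tau n\<close> and vanish at the two edges, so that
  neighbouring teeth join continuously. At \<open>mid n\<close> the value drops from
  \<open>delta n\<close> to \<open>- delta n\<close>: an admissible shock whose symmetry makes it
  stationary.\<close>

definition tooth :: "nat \<Rightarrow> real \<Rightarrow> real" where
  "tooth n x = (if edge (Suc n) \<le> x \<and> x \<le> mid n then (x - edge (Suc n)) / tau n
     else if mid n < x \<and> x \<le> edge n then (x - edge n) / tau n else 0)"

definition sawtooth :: "real \<Rightarrow> real" where "sawtooth x = (\<Sum>n. tooth n x)"

lemma tau_pos: "0 < tau n" by (simp add: tau_def)

lemma delta_pos: "0 < delta n" and delta_le: "delta n \<le> 1 / 8"
proof -
  show "0 < delta n" by (simp add: delta_def)
  have "real (Suc n) powr (- (1 / 3)) \<le> real (Suc n) powr 0" by (intro powr_mono) auto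
  then show "delta n \<le> 1 / 8" by (simp add: delta_def)
qed

lemma delta_cubed: "delta n ^ 3 = 1 / (512 * real (Suc n))"
proof -
  have "(real (Suc n) powr (- (1 / 3))) ^ 3 = real (Suc n) powr (- 1)"
    by (simp add: powr_powr flip: powr_realpow)
  then show ?thesis unfolding delta_def power_mult_distrib by (simp add: powr_minus_divide power_divide)
qed

lemma len_pos: "0 < len n" using tau_pos delta_pos by (simp add: len_def)

text \<open>The growth of \<open>tau\<close> outweighs the decay of \<open>delta\<close>. A uniform
  lower bound sends the edges to minus infinity, so the blocks cover the whole half line.\<close>

lemma len_ge: "1 \<le> len n"
proof -
  have "real (Suc n) \<le> 4 ^ n" by (induction n) auto
  have "real (Suc n) powr (- 1) \<le> real (Suc n) powr (- (1 / 3))" by (intro powr_mono) auto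
  then have "1 / real (Suc n) \<le> 8 * delta n" by (simp add: delta_def powr_minus_divide)
  then have "1 / real (Suc n) * 4 ^ n \<le> 8 * delta n * 4 ^ n" by (rule mult_right_mono) simp
  moreover have "1 \<le> 1 / real (Suc n) * 4 ^ n" using \<open>real (Suc n) \<le> 4 ^ n\<close> by simp
  ultimately have "1 \<le> 8 * delta n * 4 ^ n" by linarith
  then show ?thesis by (simp add: len_def tau_def)
qed

lemma edge_0: "edge 0 = 0" and edge_Suc: "edge (Suc n) = edge n - 2 * len n"
  and mid_eq: "mid n = edge (Suc n) + len n"
  by (simp_all add: edge_def mid_def algebra_simps)

lemma edge_order: "edge (Suc n) < mid n" "mid n < edge n"
  using len_pos[of n] edge_Suc[of n] by (auto simp: mid_def)

lemma edge_antimono: "m \<le> n \<Longrightarrow> edge n \<le> edge m"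
  by (rule lift_Suc_antimono_le[of edge]) (use edge_order less_trans less_imp_le in blast)+

lemma edge_le: "edge n \<le> - real n"
  by (induction n) (use len_ge in \<open>auto simp: edge_0 edge_Suc intro: order_trans\<close>, smt (verit) len_ge)

lemma block_exists:
  assumes "x \<le> 0" obtains n where "edge (Suc n) \<le> x" "x \<le> edge n"
proof -
  obtain N where "- x \<le> real N" using real_arch_simple by blast
  then have N: "edge N \<le> x" using edge_le[of N] by linarith
  define m where "m = (LEAST m. edge m \<le> x)"
  have m: "edge m \<le> x" unfolding m_def by (rule LeastI[of _ N]) (rule N)
  show thesis
  proof (cases m)
    case 0
    then have "x = 0" using m assms by (simp add: edge_0)
    then show ?thesis using that[of 0] edge_order[of 0] by (simp add: edge_0)
  next
    case (Suc n)
    then have "\<not> edge n \<le> x" using not_less_Least[of n "\<lambda>m. edge m \<le> x"] by (simp add: m_def)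
    then show ?thesis using that[of n] m Suc by simp
  qed
qed

lemma tooth_0: "x \<le> edge (Suc n) \<or> edge n \<le> x \<Longrightarrow> tooth n x = 0"
  using edge_order[of n] by (auto simp: tooth_def)

lemma sawtooth_block:
  assumes "edge (Suc n) \<le> x" "x \<le> edge n"
  shows "sawtooth x = tooth n x"
proof -
  have 0: "tooth m x = 0" if "m \<notin> {n}" for m
  proof (rule tooth_0)
    have "m < n \<or> n < m" using that by auto
    then show "x \<le> edge (Suc m) \<or> edge m \<le> x"
      using edge_antimono[of "Suc m" n] edge_antimono[of "Suc n" m] assms by auto
  qed
  have "(\<Sum>m. tooth m x) = (\<Sum>m\<in>{n}. tooth m x)" by (rule suminf_finite) (use 0 in auto)
  then show ?thesis by (simp add: sawtooth_def)
qed

lemma sawtooth_pos: "0 \<le> x \<Longrightarrow> sawtooth x = 0"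
proof -
  assume "0 \<le> x"
  then have "tooth n x = 0" for n using edge_antimono[of 0 n] by (intro tooth_0) (simp add: edge_0)
  then show ?thesis by (simp add: sawtooth_def)
qed

lemma sawtooth_left: "edge (Suc n) \<le> x \<Longrightarrow> x \<le> mid n \<Longrightarrow> sawtooth x = (x - edge (Suc n)) / tau n"
  and sawtooth_right: "mid n < x \<Longrightarrow> x \<le> edge n \<Longrightarrow> sawtooth x = (x - edge n) / tau n"
  using sawtooth_block[of n x] edge_order[of n] by (auto simp: tooth_def)

lemma borel_sawtooth [measurable]: "sawtooth \<in> borel_measurable borel"
proof -
  have [measurable]: "tooth n \<in> borel_measurable borel" for n unfolding tooth_def[abs_def] by measurable
  show ?thesis unfolding sawtooth_def[abs_def] by measurable
qed

lemma tooth_abs_le: "\<bar>tooth n x\<bar> \<le> delta n"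
proof -
  have le: "\<bar>y\<bar> / tau n \<le> delta n" if "\<bar>y\<bar> \<le> len n" for y
  proof -
    have "\<bar>y\<bar> / tau n \<le> len n / tau n" using that tau_pos[of n] by (intro divide_right_mono) auto
    then show ?thesis using tau_pos[of n] by (simp add: len_def)
  qed
  show ?thesis unfolding tooth_def abs_divide
    using le[of "x - edge (Suc n)"] le[of "x - edge n"] tau_pos[of n] delta_pos[of n] mid_eq[of n] mid_def[of n]
    by (auto simp: abs_divide)
qed

lemma sawtooth_abs_le: "\<bar>sawtooth x\<bar> \<le> 1 / 8"
proof (cases "x \<le> 0")
  case True
  then obtain n where "edge (Suc n) \<le> x" "x \<le> edge n" by (rule block_exists)
  then show ?thesis using sawtooth_block tooth_abs_le[of n x] delta_le[of n] by simp
qed (simp add: sawtooth_pos)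

text \<open>Up to the factor \<open>(2 \<delta>\<^sub>n)^p\<close>, the increments of the ramp dominate the \<open>p\<close>-th powers of those of the tooth.
  A function whose increments are dominated in this way by a bounded monotone one has finite \<open>p\<close>-variation.\<close>

definition ramp :: "nat \<Rightarrow> real \<Rightarrow> real" where
  "ramp n x = clip ((x - edge (Suc n)) / (2 * len n)) + (if mid n < x then 1 else 0)"

lemma ramp_mono: "x \<le> y \<Longrightarrow> ramp n x \<le> ramp n y"
proof -
  assume "x \<le> y"
  then have "(x - edge (Suc n)) / (2 * len n) \<le> (y - edge (Suc n)) / (2 * len n)"
    using len_pos[of n] by (intro divide_right_mono) auto
  then have "clip ((x - edge (Suc n)) / (2 * len n)) \<le> clip ((y - edge (Suc n)) / (2 * len n))"
    unfolding clip_def by auto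
  then show ?thesis using \<open>x \<le> y\<close> unfolding ramp_def by auto
qed

lemma ramp_range: "0 \<le> ramp n x" "ramp n x \<le> 2"
  unfolding ramp_def using clip_range[of "(x - edge (Suc n)) / (2 * len n)"] by auto

text \<open>If the jump lies between the points, the unit jump of the ramp alone pays for (2
  \<delta>)^p. Otherwise the increment is 2 \<delta> D, where D in [0, 1] is the increase of the
  ramp, and D^p \<le> D.\<close>

lemma tooth_diff_le:
  assumes "edge (Suc n) \<le> x" "x \<le> y" "y \<le> edge n" and p: "1 \<le> p"
  shows "\<bar>tooth n y - tooth n x\<bar> powr p \<le> (2 * delta n) powr p * (ramp n y - ramp n x)"
proof -
  let ?D = "ramp n y - ramp n x"
  have D0: "0 \<le> ?D" using ramp_mono[OF assms(2)] by simp
  have le2: "\<bar>tooth n y - tooth n x\<bar> \<le> 2 * delta n" using tooth_abs_le[of n x] tooth_abs_le[of n y] by linarith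
  have clip: "clip ((z - edge (Suc n)) / (2 * len n)) = (z - edge (Suc n)) / (2 * len n)" if "edge (Suc n) \<le> z" "z \<le> edge n" for z
    by (rule clip_id) (use that len_pos[of n] edge_Suc[of n] in auto)
  have DD: "?D = (y - x) / (2 * len n) + ((if mid n < y then 1 else 0) - (if mid n < x then 1 else 0))"
    unfolding ramp_def using assms by (simp add: clip) (simp add: diff_divide_distrib)
  have yx: "(y - x) / tau n = 2 * delta n * ((y - x) / (2 * len n))"
    using tau_pos[of n] delta_pos[of n] by (simp add: len_def)
  show ?thesis
  proof (cases "x \<le> mid n \<and> mid n < y")
    case True
    have "0 \<le> (y - x) / (2 * len n)" using assms len_pos[of n] by simp
    then have "1 \<le> ?D" unfolding DD using True by simp
    have "\<bar>tooth n y - tooth n x\<bar> powr p \<le> (2 * delta n) powr p" using le2 p by (intro powr_mono2) auto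
    also have "\<dots> \<le> (2 * delta n) powr p * ?D" using \<open>1 \<le> ?D\<close> by (simp add: mult_le_cancel_left1)
    finally show ?thesis .
  next
    case False
    then have "(x \<le> mid n \<and> y \<le> mid n) \<or> (mid n < x \<and> mid n < y)" using assms by auto
    then have "tooth n y - tooth n x = (y - x) / tau n" and D: "?D = (y - x) / (2 * len n)"
      unfolding DD tooth_def using assms edge_order[of n] by (auto simp: diff_divide_distrib)
    note td = this(1)
    have "0 \<le> (y - x) / tau n" using assms tau_pos[of n] by simp
    then have eq: "\<bar>tooth n y - tooth n x\<bar> = 2 * delta n * ?D" unfolding td D yx[symmetric] by (rule abs_of_nonneg)
    have D1: "?D \<le> 1" using assms len_pos[of n] edge_Suc[of n] unfolding D by simp
    have "?D powr p \<le> ?D powr 1" using D0 D1 p by (intro powr_mono') auto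
    then have "?D powr p \<le> ?D" using D0 by simp
    then show ?thesis unfolding eq using D0 delta_pos[of n] by (simp add: powr_mult mult_left_mono)
  qed
qed

text \<open>With p = 1 / s the weights (2 \<delta>_n)^p are of order n^(-p/3), summable because p >
  3. The weighted sum \<open>G\<close> of all ramps is bounded and monotone, and its increments
  telescope over any partition.\<close>

lemma sawtooth_in_BV:
  assumes s: "0 < s" "s < 1 / 3"
  shows "sawtooth \<in> BV s"
proof -
  define p where "p = 1 / s"
  have p: "3 < p" using s by (simp add: p_def field_simps)
  define w where "w n = (2 * delta n) powr p" for n
  have w0: "0 \<le> w n" for n by (simp add: w_def)
  have "summable (\<lambda>n. real n powr (- (p / 3)))" using p by (simp add: summable_real_powr_iff)
  then have "summable (\<lambda>n. real (Suc n) powr (- (p / 3)))" by (subst summable_Suc_iff)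
  then have "summable (\<lambda>n. (1 / 4) powr p * real (Suc n) powr (- (p / 3)))" by (rule summable_mult)
  moreover have "(1 / 4) powr p * real (Suc n) powr (- (p / 3)) = w n" for n
  proof -
    have "2 * delta n = 1 / 4 * real (Suc n) powr (- (1 / 3))" by (simp add: delta_def)
    then show ?thesis unfolding w_def by (simp only: powr_mult powr_powr) simp
  qed
  ultimately have w: "summable w" by (simp only:)
  define G where "G x = (\<Sum>n. w n * ramp n x)" for x
  have sm: "summable (\<lambda>n. w n * ramp n x)" for x
  proof (rule summable_comparison_test'[OF summable_mult[OF w, of 2]])
    show "norm (w n * ramp n x) \<le> 2 * w n" for n
      using mult_left_mono[OF ramp_range(2)[of n x] w0[of n]] ramp_range(1)[of n x] w0[of n] by simp
  qed
  have Gdiff: "G y - G x = (\<Sum>n. w n * (ramp n y - ramp n x))" "summable (\<lambda>n. w n * (ramp n y - ramp n x))" for x y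
    unfolding G_def using suminf_diff[OF sm[of y] sm[of x]] summable_diff[OF sm[of y] sm[of x]]
    by (simp_all add: right_diff_distrib)
  have Gmono: "G x \<le> G y" if "x \<le> y" for x y
    unfolding G_def by (intro suminf_le sm mult_left_mono ramp_mono that w0)
  have G0: "0 \<le> G x" for x unfolding G_def by (intro suminf_nonneg sm mult_nonneg_nonneg w0 ramp_range)
  have G2: "G x \<le> 2 * suminf w" for x
  proof -
    have "G x \<le> (\<Sum>n. 2 * w n)" unfolding G_def
    proof (intro suminf_le sm summable_mult w)
      show "w n * ramp n x \<le> 2 * w n" for n using mult_left_mono[OF ramp_range(2)[of n x] w0[of n]] by simp
    qed
    then show ?thesis using suminf_mult[OF w, of 2] by simp
  qed
  have single: "\<bar>tooth n y - tooth n x\<bar> powr p \<le> G y - G x"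
    if "edge (Suc n) \<le> x" "x \<le> y" "y \<le> edge n" for n x y
  proof -
    have "\<bar>tooth n y - tooth n x\<bar> powr p \<le> w n * (ramp n y - ramp n x)"
      unfolding w_def using that p by (intro tooth_diff_le) auto
    also have "\<dots> = (\<Sum>m\<in>{n}. w m * (ramp m y - ramp m x))" by simp
    also have "\<dots> \<le> G y - G x"
      unfolding Gdiff by (intro sum_le_suminf Gdiff) (use ramp_mono[OF that(2)] w0 in auto)
    finally show ?thesis .
  qed
  have pair: "\<bar>sawtooth y - sawtooth x\<bar> powr p \<le> 2 powr p * (G y - G x)" if "x \<le> y" for x y
  proof -
    have p2: "1 \<le> (2::real) powr p" using p by (simp add: ge_one_powr_ge_zero)
    have le: "G y - G x \<le> 2 powr p * (G y - G x)"
      using mult_right_mono[OF p2, of "G y - G x"] Gmono[OF that] by simp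
    show ?thesis
    proof (cases "x \<le> 0")
      case False
      then show ?thesis using that Gmono[OF that] by (simp add: sawtooth_pos)
    next
      case True
      then obtain n where n: "edge (Suc n) \<le> x" "x \<le> edge n" by (rule block_exists)
      show ?thesis
      proof (cases "y \<le> edge n")
        case True
        have "\<bar>sawtooth y - sawtooth x\<bar> powr p \<le> G y - G x"
          using single[OF n(1) that True] sawtooth_block[OF n] sawtooth_block[of n y] n that True by simp
        then show ?thesis using le by linarith
      next
        case False
        \<comment> \<open>The sawtooth vanishes at every edge, so points of different blocks are
          compared through the value 0 at \<open>edge n\<close>. This costs the factor 2^p.\<close>
        have a: "\<bar>sawtooth x\<bar> powr p \<le> G (edge n) - G x"
          using single[OF n order_refl] sawtooth_block[OF n] tooth_0[of "edge n" n] by simp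
        have b: "\<bar>sawtooth y\<bar> powr p \<le> G y - G (edge n)"
        proof (cases "y \<le> 0")
          case True
          then obtain m where m: "edge (Suc m) \<le> y" "y \<le> edge m" by (rule block_exists)
          have "Suc m \<le> n" using False m(2) edge_antimono[of n m] by (rule_tac ccontr) auto
          then have "edge n \<le> edge (Suc m)" by (rule edge_antimono)
          then have "G (edge n) \<le> G (edge (Suc m))" by (rule Gmono)
          moreover have "\<bar>sawtooth y\<bar> powr p \<le> G y - G (edge (Suc m))"
            using single[OF order_refl m] sawtooth_block[OF m] tooth_0[of "edge (Suc m)" m] by simp
          ultimately show ?thesis by linarith
        next
          case False': False
          then show ?thesis using Gmono[of "edge n" y] False by (simp add: sawtooth_pos)
        qed
        have "\<bar>sawtooth y - sawtooth x\<bar> \<le> 2 * max \<bar>sawtooth x\<bar> \<bar>sawtooth y\<bar>" by auto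
        then have "\<bar>sawtooth y - sawtooth x\<bar> powr p \<le> (2 * max \<bar>sawtooth x\<bar> \<bar>sawtooth y\<bar>) powr p"
          using p by (intro powr_mono2) auto
        also have "\<dots> = 2 powr p * (max \<bar>sawtooth x\<bar> \<bar>sawtooth y\<bar>) powr p" by (simp add: powr_mult)
        also have "\<dots> \<le> 2 powr p * (\<bar>sawtooth x\<bar> powr p + \<bar>sawtooth y\<bar> powr p)"
          by (intro mult_left_mono) (auto simp: max_def)
        also have "\<dots> \<le> 2 powr p * (G y - G x)" using a b by (intro mult_left_mono) auto
        finally show ?thesis .
      qed
    qed
  qed
  have "TV s sawtooth \<le> ennreal (2 powr p * (2 * suminf w))"
    unfolding TV_def
  proof (rule SUP_least, clarify)
    fix n and x :: "nat \<Rightarrow> real" assume x: "strict_mono_on {1..n} x"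
    have "(\<Sum>i = 1..<n. ennreal (\<bar>sawtooth (x (i + 1)) - sawtooth (x i)\<bar> powr (1 / s)))
        = ennreal (\<Sum>i = 1..<n. \<bar>sawtooth (x (i + 1)) - sawtooth (x i)\<bar> powr p)"
      by (simp add: p_def)
    also have "\<dots> \<le> ennreal (\<Sum>i = 1..<n. 2 powr p * (G (x (Suc i)) - G (x i)))"
    proof (intro ennreal_leI sum_mono)
      fix i assume i: "i \<in> {1..<n}"
      then have "x i < x (Suc i)" by (intro strict_mono_onD[OF x]) auto
      then show "\<bar>sawtooth (x (i + 1)) - sawtooth (x i)\<bar> powr p \<le> 2 powr p * (G (x (Suc i)) - G (x i))"
        using pair[of "x i" "x (Suc i)"] by simp
    qed
    also have "\<dots> \<le> ennreal (2 powr p * (2 * suminf w))"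
    proof (rule ennreal_leI)
      have "(\<Sum>i = 1..<n. 2 powr p * (G (x (Suc i)) - G (x i))) = 2 powr p * (\<Sum>i = 1..<n. G (x (Suc i)) - G (x i))"
        by (simp add: sum_distrib_left)
      also have "\<dots> \<le> 2 powr p * (2 * suminf w)"
      proof (rule mult_left_mono)
        show "(\<Sum>i = 1..<n. G (x (Suc i)) - G (x i)) \<le> 2 * suminf w"
        proof (cases "1 \<le> n")
          case True
          then have "(\<Sum>i = 1..<n. G (x (Suc i)) - G (x i)) = G (x n) - G (x 1)"
            by (rule sum_Suc_diff')
          then show ?thesis using G2[of "x n"] G0[of "x 1"] by linarith
        qed (use suminf_nonneg[OF w w0] in simp)
      qed simp
      finally show "(\<Sum>i = 1..<n. 2 powr p * (G (x (Suc i)) - G (x i))) \<le> 2 powr p * (2 * suminf w)" .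
    qed
    finally show "(\<Sum>i = 1..<n. ennreal (\<bar>sawtooth (x (i + 1)) - sawtooth (x i)\<bar> powr (1 / s))) \<le> ennreal (2 powr p * (2 * suminf w))" .
  qed
  then have "TV s sawtooth < top" by (rule le_less_trans) simp
  then show ?thesis unfolding BV_def by simp
qed

section \<open>The initial potential of the sawtooth\<close>

lemma (in balance_law) U_initial_linear:
  assumes x: "x \<le> x'" and lin: "\<And>y. x < y \<Longrightarrow> y \<le> x' \<Longrightarrow> p0 y = (y - e) / \<tau>"
  shows "U (x', 0) - U (x, 0) = ((x' - e)\<^sup>2 - (x - e)\<^sup>2) / (2 * \<tau>)"
proof -
  have "has_bochner_integral lborel (\<lambda>y. (y - e) / \<tau> * indicator {x..x'} y) ((x' - e)\<^sup>2 / (2 * \<tau>) - (x - e)\<^sup>2 / (2 * \<tau>))"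
  proof (rule has_bochner_integral_FTC_Icc_real[OF x])
    show "((\<lambda>y. (y - e)\<^sup>2 / (2 * \<tau>)) has_real_derivative (y - e) / \<tau>) (at y)" for y
    proof -
      have "((\<lambda>y. (y - e)\<^sup>2) has_real_derivative 2 * (y - e)) (at y)" by (rule derivative_eq_intros refl | simp)+
      from DERIV_cdivide[OF this, of "2 * \<tau>"] show ?thesis by (simp only: mult_divide_mult_cancel_left_if) simp
    qed
    show "isCont (\<lambda>y. (y - e) / \<tau>) y" for y
      unfolding divide_inverse by (intro continuous_intros)
  qed
  then have "(\<integral>y. (y - e) / \<tau> * indicator {x..x'} y \<partial>lborel) = ((x' - e)\<^sup>2 - (x - e)\<^sup>2) / (2 * \<tau>)"
    by (simp add: has_bochner_integral_iff diff_divide_distrib)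
  moreover have "(\<integral>y. p0 y * indicator {x<..x'} y \<partial>lborel) = (\<integral>y. (y - e) / \<tau> * indicator {x..x'} y \<partial>lborel)"
  proof (rule integral_cong_AE)
    have "AE y in lborel. y \<noteq> x" by (rule AE_lborel_singleton)
    then show "AE y in lborel. p0 y * indicator {x<..x'} y = (y - e) / \<tau> * indicator {x..x'} y"
      by eventually_elim (use lin in \<open>auto simp: indicator_def\<close>)
  qed measurable
  ultimately show ?thesis using U_initial[OF x] by simp
qed

locale sawtooth_law = balance_law p q sawtooth B for p q B
begin

lemma U_initial_right:
  assumes "mid n \<le> x" "x \<le> edge n"
  shows "U (x, 0) = U (edge n, 0) + (len n - \<bar>x - mid n\<bar>)\<^sup>2 / (2 * tau n)"
proof -
  have "U (edge n, 0) - U (x, 0) = ((edge n - edge n)\<^sup>2 - (x - edge n)\<^sup>2) / (2 * tau n)"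
    by (rule U_initial_linear[OF assms(2)]) (use assms sawtooth_right in auto)
  moreover have "(x - edge n)\<^sup>2 = (len n - \<bar>x - mid n\<bar>)\<^sup>2"
    using assms by (simp add: mid_def power2_eq_square algebra_simps)
  ultimately show ?thesis by (simp add: field_simps)
qed

lemma U_initial_left:
  assumes "edge (Suc n) \<le> x" "x \<le> mid n"
  shows "U (x, 0) = U (edge n, 0) + (len n - \<bar>x - mid n\<bar>)\<^sup>2 / (2 * tau n)"
proof -
  have "U (mid n, 0) - U (x, 0) = ((mid n - edge (Suc n))\<^sup>2 - (x - edge (Suc n))\<^sup>2) / (2 * tau n)"
    by (rule U_initial_linear[OF assms(2)]) (use assms sawtooth_left in auto)
  moreover have "U (mid n, 0) = U (edge n, 0) + (len n)\<^sup>2 / (2 * tau n)"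
    using U_initial_right[of n "mid n"] edge_order[of n] by simp
  moreover have "(x - edge (Suc n))\<^sup>2 = (len n - \<bar>x - mid n\<bar>)\<^sup>2"
    using assms by (simp add: mid_eq power2_eq_square algebra_simps)
  moreover have "mid n - edge (Suc n) = len n" by (simp add: mid_eq)
  ultimately show ?thesis by (simp add: diff_divide_distrib)
qed

text \<open>Each tooth is odd about its midpoint and has integral 0, so the potential returns to 0
  at every edge. This is what makes the blocks evolve independently, with edges that do not
  move.\<close>

lemma U_initial_edge: "U (edge n, 0) = 0"
proof (induction n)
  case 0
  then show ?case using U_origin by (simp add: edge_0)
next
  case (Suc n)
  then show ?case using U_initial_left[of n "edge (Suc n)"] edge_order[of n] by (simp add: mid_eq len_pos less_imp_le)
qed

lemma U_initial_block:
  assumes "\<bar>x - mid n\<bar> \<le> len n"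
  shows "U (x, 0) = (len n - \<bar>x - mid n\<bar>)\<^sup>2 / (2 * tau n)"
proof (cases "x \<le> mid n")
  case True
  then show ?thesis using assms U_initial_left[of n x] U_initial_edge[of n] mid_eq[of n] by (simp add: abs_le_iff)
next
  case False
  then show ?thesis using assms U_initial_right[of n x] U_initial_edge[of n] mid_def[of n] by (simp add: abs_le_iff)
qed

lemma U_initial_pos: "0 \<le> x \<Longrightarrow> U (x, 0) = 0"
  using U_initial_linear[of 0 x 0 0] U_origin by (simp add: sawtooth_pos)

lemma U_initial_nonneg: "0 \<le> U (x, 0)"
proof (cases "x \<le> 0")
  case True
  then obtain n where "edge (Suc n) \<le> x" "x \<le> edge n" by (rule block_exists)
  then have "\<bar>x - mid n\<bar> \<le> len n" using mid_eq[of n] mid_def[of n] by (auto simp: abs_le_iff)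
  then show ?thesis using U_initial_block tau_pos[of n] by simp
qed (simp add: U_initial_pos)

end

section \<open>Non-existence\<close>

lemma delta_cubed_sum_unbounded: "\<exists>n. K < (\<Sum>i<n. delta i ^ 3 / 12)"
proof -
  have eq: "delta i ^ 3 / 12 = 1 / 6144 * inverse (real (Suc i))" for i
    by (simp add: delta_cubed inverse_eq_divide)
  have ge: "0 \<le> delta i ^ 3 / 12" for i using delta_pos[of i] by simp
  show ?thesis
  proof (rule ccontr)
    assume "\<not> ?thesis"
    then have "(\<Sum>i<n. delta i ^ 3 / 12) \<le> K" for n by (simp add: not_less)
    then have "summable (\<lambda>i. delta i ^ 3 / 12)"
      by (intro summableI_nonneg_bounded ge)
    then have "summable (\<lambda>i. 6144 * (delta i ^ 3 / 12))" by (rule summable_mult)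
    then have "summable (\<lambda>i. inverse (real (Suc i)))" unfolding eq by simp
    then show False using not_summable_harmonic[where 'a = real] by (simp add: summable_Suc_iff[of "\<lambda>i. inverse (real i)"] del: of_nat_Suc)
  qed
qed

text \<open>The time derivative of the potential of v is (1 - u) v, so its increment at an edge is
  the amount of v that crosses to the left. One unit of it is followed through all teeth.\<close>

lemma no_bounded_transport: "\<not> burgers_transport u sawtooth B v (\<lambda>_. 1) C"
proof
  assume "burgers_transport u sawtooth B v (\<lambda>_. 1) C"
  then interpret T: burgers_transport u sawtooth B v "\<lambda>_. 1" C .
  interpret S: sawtooth_law u "\<lambda>P. (u P)\<^sup>2 / 2" B by unfold_locales
  have block: "T.U (x, t) = (len n - \<bar>x - mid n\<bar>)\<^sup>2 / (2 * (t + tau n))" if "\<bar>x - mid n\<bar> \<le> len n" "0 \<le> t" for n x t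
    by (rule T.block_exact[OF S.U_initial_nonneg len_pos tau_pos S.U_initial_block that])
  have right: "T.U (x, t) = 0" if "0 \<le> x" "0 \<le> t" for x t
    using T.U_le_along_line[OF that(2), of x 0] T.U_nonneg[OF S.U_initial_nonneg that(2), of x] S.U_initial_pos[OF that(1)] by simp
  \<comment> \<open>To the right of the origin u is 0, hence v moves with velocity -1, and the
    potential at (0, t) is the initial mass of (0, t].\<close>
  have V0: "T.V.U (0, t) = t" if t: "0 < t" for t
  proof -
    have "T.V.U (t, 0) - T.V.U (0, 0) = (\<integral>y. 1 * indicator {0<..t} y \<partial>lborel)"
      by (rule T.V.U_initial) (use t in simp)
    then have "T.V.U (t, 0) = t" using t T.V.U_origin by simp
    moreover have "T.V.U ((\<lambda>s. t - s) 0, 0) = T.V.U ((\<lambda>s. t - s) t, t)"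
    proof (rule T.V_const_along_path[where g = "\<lambda>_. 0" and a = 0 and b = t and G = 0 and L = 0])
      show "((\<lambda>y. T.U (y, s)) has_real_derivative 0) (at x)" if "0 < x" "0 < s" for x s
      proof -
        have "((\<lambda>y. 0) has_real_derivative 0) (at x)" by simp
        then show ?thesis
          by (rule has_field_derivative_transform_within_open[of _ _ _ "{0<..}"]) (use that right in auto)
      qed
      show "((\<lambda>s. t - s) has_real_derivative 0 - 1) (at s)" for s
        by (auto intro!: derivative_eq_intros)
    qed (use t in \<open>auto intro!: continuous_intros\<close>)
    ultimately show ?thesis by simp
  qed
  have ex: "\<exists>T T'. 0 \<le> T \<and> T \<le> T' \<and> T' \<le> tau n / 4 \<and> T.V.U (edge n, T') - T.V.U (edge n, T) = 1
      \<and> T' - T \<le> exp (- (\<Sum>i<n. delta i ^ 3 / 12))" for n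
  proof (induction n)
    case 0
    \<comment> \<open>Between the times 1 and 2 one unit of mass passes x = 0; the empty sum gives
      exp 0 = 1 for the gap, and 2 is exactly \<open>tau 0 / 4\<close>.\<close>
    show ?case by (rule exI[of _ 1], rule exI[of _ 2]) (simp add: tau_def edge_0 V0)
  next
    case (Suc n)
    then obtain t t' where t: "0 \<le> t" "t \<le> t'" "t' \<le> tau n / 4"
      and V: "T.V.U (edge n, t') - T.V.U (edge n, t) = 1" and gap: "t' - t \<le> exp (- (\<Sum>i<n. delta i ^ 3 / 12))"
      by blast
    obtain \<sigma> \<sigma>' where \<sigma>: "tau n \<le> \<sigma>" "\<sigma> \<le> \<sigma>'" "\<sigma> * exp (- (len n / \<sigma>)) = t + tau n" "\<sigma>' * exp (- (len n / \<sigma>')) = t' + tau n"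
      "\<sigma> * exp (len n / \<sigma>) \<le> \<sigma>' * exp (len n / \<sigma>')" "\<sigma>' * exp (len n / \<sigma>') \<le> 2 * tau n"
      "\<sigma>' * exp (len n / \<sigma>') - \<sigma> * exp (len n / \<sigma>) \<le> exp (- (delta n ^ 3 / 12)) * (t' - t)"
      using crossing_times[OF tau_pos delta_pos delta_le t, of n] unfolding len_def[symmetric] by blast
    have cross: "T.V.U (edge n, r) = T.V.U (edge (Suc n), s * exp (len n / s) - tau n)"
      if "tau n \<le> s" "s * exp (- (len n / s)) = r + tau n" "0 \<le> r" for r s
    proof -
      have s: "0 < s" using that(1) tau_pos[of n] by linarith
      have "delta n * tau n < 1 * tau n" using delta_le[of n] tau_pos[of n] by (intro mult_strict_right_mono) auto
      then have "len n < s" using that(1) by (simp add: len_def)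
      then have k: "len n / s < 1" using s by simp
      have "T.V.U (mid n + len n, s * exp (- (len n / s)) - tau n) = T.V.U (mid n - len n, s * exp (len n / s) - tau n)"
        by (rule T.V_across_block[OF tau_pos s len_pos k _ block]) (use that in auto)
      moreover have "mid n + len n = edge n" "mid n - len n = edge (Suc n)" by (simp_all add: mid_eq[of n] edge_Suc)
      ultimately show ?thesis using that(2) by simp
    qed
    have "\<sigma> * 1 \<le> \<sigma> * exp (len n / \<sigma>)" using \<sigma>(1) tau_pos[of n] len_pos[of n] by (intro mult_left_mono) auto
    then have lo: "0 \<le> \<sigma> * exp (len n / \<sigma>) - tau n" using \<sigma>(1) by linarith
    have "exp (- (delta n ^ 3 / 12)) * (t' - t) \<le> exp (- (delta n ^ 3 / 12)) * exp (- (\<Sum>i<n. delta i ^ 3 / 12))"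
      using gap by (intro mult_left_mono) auto
    also have "\<dots> = exp (- (\<Sum>i<Suc n. delta i ^ 3 / 12))" by (simp flip: exp_add)
    finally have gap': "(\<sigma>' * exp (len n / \<sigma>') - tau n) - (\<sigma> * exp (len n / \<sigma>) - tau n) \<le> exp (- (\<Sum>i<Suc n. delta i ^ 3 / 12))"
      using \<sigma>(7) by linarith
    show ?case
    proof (intro exI conjI)
      show "0 \<le> \<sigma> * exp (len n / \<sigma>) - tau n" by (rule lo)
      show "\<sigma> * exp (len n / \<sigma>) - tau n \<le> \<sigma>' * exp (len n / \<sigma>') - tau n" using \<sigma>(5) by simp
      show "\<sigma>' * exp (len n / \<sigma>') - tau n \<le> tau (Suc n) / 4" using \<sigma>(6) by (simp add: tau_def)
      show "T.V.U (edge (Suc n), \<sigma>' * exp (len n / \<sigma>') - tau n) - T.V.U (edge (Suc n), \<sigma> * exp (len n / \<sigma>) - tau n) = 1"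
        using V cross[OF _ \<sigma>(4)] cross[OF \<sigma>(1,3)] \<sigma>(1,2) t by simp
    qed (rule gap')
  qed
  \<comment> \<open>The threshold ln (C + 1) makes the time gap smaller than 1 / (C + 1); the shift
    by 1 keeps the logarithm meaningful for C = 0.\<close>
  obtain n where n: "ln (C + 1) < (\<Sum>i<n. delta i ^ 3 / 12)" using delta_cubed_sum_unbounded by blast
  obtain t t' where t: "0 \<le> t" "t \<le> t'" "T.V.U (edge n, t') - T.V.U (edge n, t) = 1"
    "t' - t \<le> exp (- (\<Sum>i<n. delta i ^ 3 / 12))"
    using ex[of n] by blast
  have C: "0 \<le> C" by (rule T.V.B_nonneg)
  have "1 \<le> C * (t' - t)" using T.V.U_lipschitz_t[of t' t "edge n"] t by simp
  also have "\<dots> \<le> C * exp (- (\<Sum>i<n. delta i ^ 3 / 12))" using t(4) C by (intro mult_left_mono)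
  also have "\<dots> \<le> C * exp (- ln (C + 1))" using n C by (intro mult_left_mono) auto
  also have "\<dots> = C / (C + 1)" using C by (simp add: exp_minus divide_inverse)
  also have "\<dots> < 1" using C by simp
  finally show False by simp
qed

section \<open>From bounded entropy solutions on the half plane to balance laws on the plane\<close>

lemma C1_test_derivatives:
  assumes "C1_test \<phi> \<phi>x \<phi>t"
  shows "\<exists>R M. 0 \<le> M \<and> (\<forall>P. 0 < snd P \<longrightarrow> \<bar>\<phi>x P\<bar> \<le> M \<and> \<bar>\<phi>t P\<bar> \<le> M \<and>
    (P \<notin> {- R..R} \<times> {0..R} \<longrightarrow> \<phi>x P = 0 \<and> \<phi>t P = 0))"
proof -
  obtain R where R: "\<And>x t. 0 \<le> t \<Longrightarrow> R < \<bar>x\<bar> \<or> R < t \<Longrightarrow> \<phi> (x, t) = 0"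
    using assms unfolding C1_test_def by metis
  have out: "\<phi>x P = 0 \<and> \<phi>t P = 0" if t: "0 < snd P" and P: "P \<notin> {- R..R} \<times> {0..R}" for P
  proof -
    obtain x t where xt: "P = (x, t)" by (cases P)
    have t: "0 < t" using t by (simp add: xt)
    have o: "R < \<bar>x\<bar> \<or> R < t" using P t by (auto simp: xt abs_le_iff not_le)
    \<comment> \<open>\<open>\<phi>\<close> is known to vanish only at t \<ge> 0, so the
      neighbourhood in time is kept inside t > 0. The cases reflect which coordinate exceeds
      \<open>R\<close>: if it is the other one, the whole line may be taken.\<close>
    let ?A = "if R < t then UNIV else {y. R < \<bar>y\<bar>}" and ?T = "{0<..} \<inter> (if R < \<bar>x\<bar> then UNIV else {R<..})"
    have "open ?A" by (auto intro!: open_Collect_less continuous_intros)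
    have dx0: "((\<lambda>y. \<phi> (y, t)) has_real_derivative 0) (at x)"
    proof (rule has_field_derivative_transform_within_open[OF _ \<open>open ?A\<close>])
      show "((\<lambda>y. 0) has_real_derivative 0) (at x)" by simp
    qed (use o t R in \<open>auto split: if_splits\<close>)
    have "open ?T" by (auto intro!: open_Int)
    have dt0: "((\<lambda>s. \<phi> (x, s)) has_real_derivative 0) (at t)"
    proof (rule has_field_derivative_transform_within_open[OF _ \<open>open ?T\<close>])
      show "((\<lambda>y. 0) has_real_derivative 0) (at t)" by simp
    qed (use o t R in \<open>auto split: if_splits\<close>)
    show ?thesis
      using dx0 dt0 assms DERIV_unique unfolding C1_test_def xt by blast
  qed
  let ?K = "{- R..R} \<times> {0..R}"
  have "compact ?K" by (intro compact_Times) auto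
  have "bounded (\<phi>x ` ?K)" "bounded (\<phi>t ` ?K)"
    using assms \<open>compact ?K\<close> unfolding C1_test_def
    by (auto intro!: compact_imp_bounded compact_continuous_image intro: continuous_on_subset)
  then obtain M1 M2 where M: "\<And>P. P \<in> ?K \<Longrightarrow> \<bar>\<phi>x P\<bar> \<le> M1" "\<And>P. P \<in> ?K \<Longrightarrow> \<bar>\<phi>t P\<bar> \<le> M2"
    unfolding bounded_iff by (metis (no_types, lifting) image_eqI real_norm_def)
  have "\<bar>\<phi>x P\<bar> \<le> max 0 (max M1 M2) \<and> \<bar>\<phi>t P\<bar> \<le> max 0 (max M1 M2)" if "0 < snd P" for P
    using M(1)[of P] M(2)[of P] out[OF that] by (cases "P \<in> ?K") auto
  then show ?thesis using out by (intro exI[of _ R] exI[of _ "max 0 (max M1 M2)"]) auto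
qed

lemma borel_C1_test:
  assumes "C1_test \<phi> \<phi>x \<phi>t"
  shows "\<phi>x \<in> borel_measurable borel" "\<phi>t \<in> borel_measurable borel"
  using assms unfolding C1_test_def by (auto intro: borel_measurable_continuous_onI)

text \<open>\<open>F\<close> is built from arbitrary members of L-infinity classes, \<open>G\<close>
  from representatives bounded everywhere. Agreement almost everywhere on the open half plane lets
  Fubini turn the iterated integral of \<open>F\<close> into a plane integral of
  \<open>G\<close>.\<close>

lemma half_plane_integral:
  fixes F G :: "real \<times> real \<Rightarrow> real"
  assumes F: "(\<lambda>P. indicator open_half_plane P * F P) \<in> borel_measurable borel"
    and G: "G \<in> borel_measurable borel" "integrable lborel G"
    and FG: "AE P in lborel. P \<in> open_half_plane \<longrightarrow> F P = G P" and G0: "\<And>P. snd P \<le> 0 \<Longrightarrow> G P = 0"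
  shows "(LBINT t:{0<..}. LBINT x. F (x, t)) = (\<integral>P. G P \<partial>lborel)"
proof -
  let ?F = "\<lambda>P. indicator open_half_plane P * F P"
  have "G P = 0" if "P \<notin> open_half_plane" for P using that G0[of P] by (cases P) (auto simp: open_half_plane_def not_less)
  then have ae: "AE P in lborel. ?F P = G P" using FG by (auto simp: indicator_def elim!: eventually_mono)
  have int: "integrable lborel ?F" using integrable_cong_AE[OF _ _ ae] F G by simp
  have "(LBINT t:{0<..}. LBINT x. F (x, t)) = (\<integral>t. (\<integral>x. ?F (x, t) \<partial>lborel) \<partial>lborel)"
    unfolding set_lebesgue_integral_def
    by (rule Bochner_Integration.integral_cong) (auto simp: open_half_plane_def indicator_def)
  also have "\<dots> = (\<integral>P. ?F P \<partial>lborel)"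
    using lborel_pair.integral_snd[of "\<lambda>x t. ?F (x, t)"] int by (simp add: lborel_prod case_prod_unfold)
  also have "\<dots> = (\<integral>P. G P \<partial>lborel)" using integral_cong_AE[OF _ _ ae] F G by simp
  finally show ?thesis .
qed

lemma open_half_plane_borel [measurable]: "open_half_plane \<in> sets borel"
  unfolding open_half_plane_def by (intro borel_open open_Times) auto

text \<open>Truncation at the essential bound changes \<open>u\<close> only on a null set, and
  extension by 0 yields a Borel function on the whole plane, bounded at every point.\<close>

lemma Linf_half_plane:
  assumes "u \<in> Linf (restrict_space lborel open_half_plane)"
  obtains w B where "w \<in> borel_measurable borel" "\<forall>P. \<bar>w P\<bar> \<le> B" "\<forall>P. snd P \<le> 0 \<longrightarrow> w P = 0"
    "AE P in lborel. P \<in> open_half_plane \<longrightarrow> u P = w P"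
    "(\<lambda>P. indicator open_half_plane P * u P) \<in> borel_measurable borel"
proof -
  let ?M = "restrict_space lborel open_half_plane :: (real \<times> real) measure"
  have u: "u \<in> borel_measurable ?M" and fin: "esssup ?M (\<lambda>P. ereal \<bar>u P\<bar>) < \<infinity>"
    using assms by (auto simp: Linf_def Linf_norm_def)
  have m[measurable]: "(\<lambda>P. indicator open_half_plane P * u P) \<in> borel_measurable borel"
    using u by (subst (asm) borel_measurable_restrict_space_iff) (auto simp: mult.commute)
  define e where "e = esssup ?M (\<lambda>P. ereal \<bar>u P\<bar>)"
  \<comment> \<open>\<open>real_of_ereal\<close> returns 0 at minus infinity, so this value
    dominates \<open>e\<close> in that case too; its sign is needed where \<open>w\<close> is set to
    0.\<close>
  define B where "B = max 0 (real_of_ereal e)"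
  have eB: "e \<le> ereal B" using fin unfolding B_def e_def[symmetric] by (cases e) auto
  have "AE P in ?M. ereal \<bar>u P\<bar> \<le> e" unfolding e_def by (rule esssup_AE)
  then have "AE P in ?M. \<bar>u P\<bar> \<le> B"
  proof eventually_elim
    case (elim P)
    then have "ereal \<bar>u P\<bar> \<le> ereal B" using eB by (rule order_trans)
    then show ?case by simp
  qed
  then have ae: "AE P in lborel. P \<in> open_half_plane \<longrightarrow> \<bar>u P\<bar> \<le> B"
    by (subst (asm) AE_restrict_space_iff) auto
  define w where "w P = (if \<bar>indicator open_half_plane P * u P\<bar> \<le> B then indicator open_half_plane P * u P else 0)" for P
  show thesis
  proof (rule that[of w B])
    show "w \<in> borel_measurable borel" unfolding w_def[abs_def] by measurable
    show "\<forall>P. \<bar>w P\<bar> \<le> B" by (auto simp: w_def B_def)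
    show "\<forall>P. snd P \<le> 0 \<longrightarrow> w P = 0" by (auto simp: w_def open_half_plane_def)
    show "AE P in lborel. P \<in> open_half_plane \<longrightarrow> u P = w P" using ae by eventually_elim (auto simp: w_def)
  qed (rule m)
qed

text \<open>Primed functions are the original ones on the half plane, unprimed ones their bounded
  representatives extended by 0, for which the plane integrals converge absolutely.\<close>

lemma balance_lawI:
  assumes p: "p \<in> borel_measurable borel" "\<And>P. \<bar>p P\<bar> \<le> B" "\<And>P. snd P \<le> 0 \<Longrightarrow> p P = 0"
    and q: "q \<in> borel_measurable borel" "\<And>P. \<bar>q P\<bar> \<le> B" "\<And>P. snd P \<le> 0 \<Longrightarrow> q P = 0"
    and p0: "p0 \<in> borel_measurable borel" "\<And>x. \<bar>p0 x\<bar> \<le> B"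
    and ae: "AE P in lborel. P \<in> open_half_plane \<longrightarrow> p' P = p P" "AE P in lborel. P \<in> open_half_plane \<longrightarrow> q' P = q P"
    and meas: "(\<lambda>P. indicator open_half_plane P * p' P) \<in> borel_measurable borel"
      "(\<lambda>P. indicator open_half_plane P * q' P) \<in> borel_measurable borel"
    and weak: "\<And>\<phi>. \<phi> \<in> test_functions \<Longrightarrow>
      (LBINT t:{0<..}. LBINT x. p' (x, t) * dt \<phi> x t + q' (x, t) * dx \<phi> x t) + (LBINT x. p0 x * \<phi> (x, 0)) = 0"
  shows "balance_law p q p0 B"
proof
  show "q (x, t) = 0" if "t \<le> 0" for x t using q(3)[of "(x, t)"] that by auto
  fix \<phi> \<phi>x \<phi>t assume C1: "C1_test \<phi> \<phi>x \<phi>t"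
  note bm[measurable] = borel_C1_test[OF C1]
  obtain R M where RM: "0 \<le> M" "\<forall>P. 0 < snd P \<longrightarrow> \<bar>\<phi>x P\<bar> \<le> M \<and> \<bar>\<phi>t P\<bar> \<le> M \<and>
      (P \<notin> {- R..R} \<times> {0..R} \<longrightarrow> \<phi>x P = 0 \<and> \<phi>t P = 0)"
    using C1_test_derivatives[OF C1] by (elim exE conjE)
  have M: "0 \<le> M" "\<And>P. 0 < snd P \<Longrightarrow> \<bar>\<phi>x P\<bar> \<le> M" "\<And>P. 0 < snd P \<Longrightarrow> \<bar>\<phi>t P\<bar> \<le> M"
    "\<And>P. 0 < snd P \<Longrightarrow> P \<notin> {- R..R} \<times> {0..R} \<Longrightarrow> \<phi>x P = 0 \<and> \<phi>t P = 0"
    using RM by blast+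
  have B0: "0 \<le> B" using p(2) abs_ge_zero order_trans by blast
  have "(LBINT t:{0<..}. LBINT x. (\<lambda>P. p' P * \<phi>t P + q' P * \<phi>x P) (x, t)) = (\<integral>P. p P * \<phi>t P + q P * \<phi>x P \<partial>lborel)"
  proof (rule half_plane_integral)
    have "(\<lambda>P. indicator open_half_plane P * p' P * \<phi>t P + indicator open_half_plane P * q' P * \<phi>x P) \<in> borel_measurable borel"
      using meas by measurable
    then show "(\<lambda>P. indicator open_half_plane P * (p' P * \<phi>t P + q' P * \<phi>x P)) \<in> borel_measurable borel"
      by (simp add: distrib_left mult.assoc)
    show mG: "(\<lambda>P. p P * \<phi>t P + q P * \<phi>x P) \<in> borel_measurable borel" using p(1) q(1) by measurable
    show "integrable lborel (\<lambda>P. p P * \<phi>t P + q P * \<phi>x P)"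
    proof (rule integrable_rect[OF mG, of "B * M + B * M" "- R" R 0 R])
      show "\<bar>p P * \<phi>t P + q P * \<phi>x P\<bar> \<le> B * M + B * M" for P
      proof (cases "0 < snd P")
        case True
        have "\<bar>p P * \<phi>t P\<bar> \<le> B * M" "\<bar>q P * \<phi>x P\<bar> \<le> B * M"
          unfolding abs_mult by (intro mult_mono p(2) q(2) M True B0 abs_ge_zero)+
        then show ?thesis by linarith
      qed (use p(3)[of P] q(3)[of P] B0 M(1) in simp)
      show "p P * \<phi>t P + q P * \<phi>x P = 0" if "P \<notin> {- R..R} \<times> {0..R}" for P
        using M(4)[OF _ that] p(3)[of P] q(3)[of P] by (cases "0 < snd P") auto
    qed
    show "AE P in lborel. P \<in> open_half_plane \<longrightarrow> p' P * \<phi>t P + q' P * \<phi>x P = p P * \<phi>t P + q P * \<phi>x P"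
      using ae by eventually_elim auto
  qed (use p(3) q(3) in simp)
  then show "(\<integral>P. p P * \<phi>t P + q P * \<phi>x P \<partial>lborel) + (\<integral>x. p0 x * \<phi> (x, 0) \<partial>lborel) = 0"
    using weak[OF C1_test_imp_test_function(1)[OF C1]] by (simp add: C1_test_imp_test_function(2,3)[OF C1])
qed (use p q p0 in auto)

lemma convex_quadratic: "convex_on UNIV (\<lambda>w::real. (w - k)\<^sup>2 / 2 + l)"
proof (rule convex_onI)
  fix t x y :: real assume t: "0 < t" "t < 1"
  have "(1 - t) * ((x - k)\<^sup>2 / 2 + l) + t * ((y - k)\<^sup>2 / 2 + l) - ((((1 - t) *\<^sub>R x + t *\<^sub>R y) - k)\<^sup>2 / 2 + l)
      = t * (1 - t) * (x - y)\<^sup>2 / 2"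
    by (simp add: field_simps power2_eq_square)
  moreover have "0 \<le> t * (1 - t) * (x - y)\<^sup>2 / 2" using t by simp
  ultimately show "(((1 - t) *\<^sub>R x + t *\<^sub>R y) - k)\<^sup>2 / 2 + l \<le> (1 - t) * ((x - k)\<^sup>2 / 2 + l) + t * ((y - k)\<^sup>2 / 2 + l)"
    by linarith
qed simp

lemma deriv_burgers: "deriv (\<lambda>w::real. w\<^sup>2 / 2) w = w"
  by (rule DERIV_imp_deriv) (auto intro!: derivative_eq_intros)

text \<open>The antiderivative of (w - k) w that vanishes at w = k, expanded in powers of w - k, the
  form in which the cubic terms of the production cancel.\<close>

lemma entropy_flux_quadratic:
  "entropy_flux (\<lambda>w. w\<^sup>2 / 2) (\<lambda>w. (w - k)\<^sup>2 / 2 + l) (\<lambda>w. (w - k)^3 / 3 + k * (w - k)\<^sup>2 / 2)"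
  unfolding entropy_flux_def
proof (intro conjI allI impI)
  show "continuous_on UNIV (\<lambda>w. (w - k)^3 / 3 + k * (w - k)\<^sup>2 / 2)" by (intro continuous_intros) auto
  fix w :: real
  have "deriv (\<lambda>w. (w - k)\<^sup>2 / 2 + l) w = w - k"
    by (rule DERIV_imp_deriv) (auto intro!: derivative_eq_intros)
  moreover have "((\<lambda>w. (w - k)^3 / 3 + k * (w - k)\<^sup>2 / 2) has_real_derivative (w - k)\<^sup>2 + k * (w - k)) (at w)"
    by (auto intro!: derivative_eq_intros)
  moreover have "(w - k)\<^sup>2 + k * (w - k) = (w - k) * w" by (simp add: power2_eq_square algebra_simps)
  ultimately show "((\<lambda>w. (w - k)^3 / 3 + k * (w - k)\<^sup>2 / 2) has_real_derivative deriv (\<lambda>w. (w - k)\<^sup>2 / 2 + l) w * deriv (\<lambda>w. w\<^sup>2 / 2) w) (at w)"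
    unfolding deriv_burgers by (simp only:)
qed

lemma entropy_solution_imp_transport:
  assumes u0: "u0 \<in> borel_measurable borel" "\<And>x. \<bar>u0 x\<bar> \<le> 1" and v0: "v0 \<in> borel_measurable borel" "\<And>x. \<bar>v0 x\<bar> \<le> 1"
    and u: "u \<in> Linf (restrict_space lborel open_half_plane)"
    and v: "v \<in> Linf (restrict_space lborel open_half_plane)"
    and sol: "entropy_solution (\<lambda>w. w\<^sup>2 / 2) (\<lambda>w. w - 1) u0 v0 u v"
  obtains u' B v' C where "burgers_transport u' u0 B v' v0 C"
proof -
  obtain w A where ww: "w \<in> borel_measurable borel" "\<forall>P. \<bar>w P\<bar> \<le> A" "\<forall>P. snd P \<le> 0 \<longrightarrow> w P = 0"
    "AE P in lborel. P \<in> open_half_plane \<longrightarrow> u P = w P"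
    "(\<lambda>P. indicator open_half_plane P * u P) \<in> borel_measurable borel"
    by (rule Linf_half_plane[OF u])
  have w: "w \<in> borel_measurable borel" "\<And>P. \<bar>w P\<bar> \<le> A" "\<And>P. snd P \<le> 0 \<Longrightarrow> w P = 0"
    "AE P in lborel. P \<in> open_half_plane \<longrightarrow> u P = w P"
    "(\<lambda>P. indicator open_half_plane P * u P) \<in> borel_measurable borel"
    using ww by auto
  obtain z D where zz: "z \<in> borel_measurable borel" "\<forall>P. \<bar>z P\<bar> \<le> D" "\<forall>P. snd P \<le> 0 \<longrightarrow> z P = 0"
    "AE P in lborel. P \<in> open_half_plane \<longrightarrow> v P = z P"
    "(\<lambda>P. indicator open_half_plane P * v P) \<in> borel_measurable borel"
    by (rule Linf_half_plane[OF v])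
  have z: "z \<in> borel_measurable borel" "\<And>P. \<bar>z P\<bar> \<le> D" "\<And>P. snd P \<le> 0 \<Longrightarrow> z P = 0"
    "AE P in lborel. P \<in> open_half_plane \<longrightarrow> v P = z P"
    "(\<lambda>P. indicator open_half_plane P * v P) \<in> borel_measurable borel"
    using zz by auto
  note [measurable] = w(1,5) z(1,5)
  have A0: "0 \<le> A" and D0: "0 \<le> D" using w(2) z(2) abs_ge_zero order_trans by blast+
  \<comment> \<open>One constant has to bound the datum, the solution and the flux; \<open>C\<close>
    does the same for the second equation, whose flux is bounded by (A + 1) D.\<close>
  define B where "B = 1 + A + A\<^sup>2"
  define C where "C = 1 + D + (A + 1) * D"
  have w2: "\<bar>(w P)\<^sup>2 / 2\<bar> \<le> A\<^sup>2" for P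
  proof -
    have "(w P)\<^sup>2 \<le> A\<^sup>2" "0 \<le> (w P)\<^sup>2" using power_mono[OF w(2)[of P], of 2] by auto
    then show ?thesis by linarith
  qed
  have wz: "\<bar>(w P - 1) * z P\<bar> \<le> (A + 1) * D" for P
    unfolding abs_mult by (rule mult_mono) (use w(2)[of P] z(2)[of P] A0 in auto)
  have AD: "0 \<le> (A + 1) * D" using A0 D0 by simp
  have "balance_law w (\<lambda>P. (w P)\<^sup>2 / 2) u0 B"
  proof (rule balance_lawI[where p' = u and q' = "\<lambda>P. (u P)\<^sup>2 / 2"])
    show "\<bar>w P\<bar> \<le> B" for P using w(2)[of P] zero_le_power2[of A] unfolding B_def by linarith
    show "\<bar>(w P)\<^sup>2 / 2\<bar> \<le> B" for P using w2[of P] A0 unfolding B_def by linarith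
    show "\<bar>u0 x\<bar> \<le> B" for x using u0(2)[of x] A0 zero_le_power2[of A] unfolding B_def by linarith
    show "AE P in lborel. P \<in> open_half_plane \<longrightarrow> (u P)\<^sup>2 / 2 = (w P)\<^sup>2 / 2" using w(4) by eventually_elim auto
    have "(\<lambda>P. (indicator open_half_plane P * u P)\<^sup>2 / 2) \<in> borel_measurable borel" by measurable
    moreover have "(\<lambda>P. (indicator open_half_plane P * u P)\<^sup>2 / 2) = (\<lambda>P. indicator open_half_plane P * ((u P)\<^sup>2 / 2))"
      by (auto simp: indicator_def)
    ultimately show "(\<lambda>P. indicator open_half_plane P * ((u P)\<^sup>2 / 2)) \<in> borel_measurable borel" by simp
    show "(LBINT t:{0<..}. LBINT x. u (x, t) * dt \<phi> x t + (u (x, t))\<^sup>2 / 2 * dx \<phi> x t) + (LBINT x. u0 x * \<phi> (x, 0)) = 0"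
      if "\<phi> \<in> test_functions" for \<phi>
      using sol that unfolding entropy_solution_def weak_solution_def by blast
  qed (use w u0 in auto)
  moreover have "balance_law z (\<lambda>P. (w P - 1) * z P) v0 C"
  proof (rule balance_lawI[where p' = v and q' = "\<lambda>P. (u P - 1) * v P"])
    show "\<bar>z P\<bar> \<le> C" for P using z(2)[of P] AD by (simp add: C_def)
    show "\<bar>(w P - 1) * z P\<bar> \<le> C" for P using wz[of P] D0 unfolding C_def by linarith
    show "\<bar>v0 x\<bar> \<le> C" for x using v0(2)[of x] D0 AD by (simp add: C_def)
    show "AE P in lborel. P \<in> open_half_plane \<longrightarrow> (u P - 1) * v P = (w P - 1) * z P"
      using w(4) z(4) by eventually_elim auto
    have "(\<lambda>P. (indicator open_half_plane P * u P - 1) * (indicator open_half_plane P * v P)) \<in> borel_measurable borel" by measurable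
    moreover have "(\<lambda>P. (indicator open_half_plane P * u P - 1) * (indicator open_half_plane P * v P))
        = (\<lambda>P. indicator open_half_plane P * ((u P - 1) * v P))"
      by (auto simp: indicator_def)
    ultimately show "(\<lambda>P. indicator open_half_plane P * ((u P - 1) * v P)) \<in> borel_measurable borel" by simp
    show "(LBINT t:{0<..}. LBINT x. v (x, t) * dt \<phi> x t + (u (x, t) - 1) * v (x, t) * dx \<phi> x t) + (LBINT x. v0 x * \<phi> (x, 0)) = 0"
      if "\<phi> \<in> test_functions" for \<phi>
      using sol that unfolding entropy_solution_def weak_solution_def by blast
  qed (use z w v0 in auto)
  moreover have "burgers_entropy_axioms w"
  proof
    fix k l e :: real and \<phi> \<phi>x \<phi>t
    assume C1: "C1_test \<phi> \<phi>x \<phi>t" and nn: "\<And>P. 0 \<le> \<phi> P" and e: "0 < e" and 0: "\<And>x t. t \<le> e \<Longrightarrow> \<phi> (x, t) = 0"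
    note bm[measurable] = borel_C1_test[OF C1]
    obtain R M where RM: "0 \<le> M" "\<forall>P. 0 < snd P \<longrightarrow> \<bar>\<phi>x P\<bar> \<le> M \<and> \<bar>\<phi>t P\<bar> \<le> M \<and>
      (P \<notin> {- R..R} \<times> {0..R} \<longrightarrow> \<phi>x P = 0 \<and> \<phi>t P = 0)"
    using C1_test_derivatives[OF C1] by (elim exE conjE)
  have M: "0 \<le> M" "\<And>P. 0 < snd P \<Longrightarrow> \<bar>\<phi>x P\<bar> \<le> M" "\<And>P. 0 < snd P \<Longrightarrow> \<bar>\<phi>t P\<bar> \<le> M"
    "\<And>P. 0 < snd P \<Longrightarrow> P \<notin> {- R..R} \<times> {0..R} \<Longrightarrow> \<phi>x P = 0 \<and> \<phi>t P = 0"
    using RM by blast+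
    \<comment> \<open>For t \<le> 0 the representative is 0 but the entropy of 0 is in general not.
      The integrand vanishes there because the test function is 0 up to the positive time
      \<open>e\<close>, together with its derivatives.\<close>
    have neg: "\<phi>x P = 0 \<and> \<phi>t P = 0" if "snd P \<le> 0" for P
    proof -
      obtain x t where P: "P = (x, t)" by (cases P)
      have t: "t < e" using that e P by simp
      have z: "((\<lambda>_. 0) has_real_derivative 0) (at r)" for r :: real by simp
      have "((\<lambda>y. \<phi> (y, t)) has_real_derivative 0) (at x)"
        by (rule has_field_derivative_transform_within_open[OF z, of UNIV]) (use 0 t in auto)
      moreover have "((\<lambda>s. \<phi> (x, s)) has_real_derivative 0) (at t)"
        by (rule has_field_derivative_transform_within_open[OF z, of "{..<e}"]) (use 0 t in auto)
      ultimately show ?thesis using C1 DERIV_unique unfolding C1_test_def P by blast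
    qed
    let ?\<eta> = "\<lambda>s. (s - k)\<^sup>2 / 2 + l" and ?q = "\<lambda>s. (s - k)^3 / 3 + k * (s - k)\<^sup>2 / 2"
    define Z where "Z = A + \<bar>k\<bar>"
    define K where "K = Z\<^sup>2 / 2 + \<bar>l\<bar> + (Z^3 / 3 + \<bar>k\<bar> * (Z\<^sup>2 / 2))"
    have Z0: "0 \<le> Z" using A0 by (simp add: Z_def)
    have zl: "\<bar>w P - k\<bar> \<le> Z" for P using w(2)[of P] by (simp add: Z_def)
    have z2: "\<bar>(w P - k)\<^sup>2\<bar> \<le> Z\<^sup>2" for P unfolding power_abs by (rule power_mono[OF zl]) simp
    have z3: "\<bar>(w P - k)^3\<bar> \<le> Z^3" for P unfolding power_abs by (rule power_mono[OF zl]) simp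
    have kz: "\<bar>k * (w P - k)\<^sup>2 / 2\<bar> \<le> \<bar>k\<bar> * (Z\<^sup>2 / 2)" for P using z2[of P] by (simp add: abs_mult mult_left_mono)
    have pos: "0 \<le> Z\<^sup>2 / 2" "0 \<le> Z^3 / 3" "0 \<le> \<bar>k\<bar> * (Z\<^sup>2 / 2)" using Z0 by auto
    have \<eta>K: "\<bar>?\<eta> (w P)\<bar> \<le> K" for P using z2[of P] pos unfolding K_def by linarith
    have qK: "\<bar>?q (w P)\<bar> \<le> K" for P using z3[of P] kz[of P] pos unfolding K_def by linarith
    have K0: "0 \<le> K" using \<eta>K abs_ge_zero order_trans by blast
    have "(LBINT t:{0<..}. LBINT x. (\<lambda>P. ?\<eta> (u P) * \<phi>t P + ?q (u P) * \<phi>x P) (x, t))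
        = (\<integral>P. ?\<eta> (w P) * \<phi>t P + ?q (w P) * \<phi>x P \<partial>lborel)"
    proof (rule half_plane_integral)
      have "(\<lambda>P. indicator open_half_plane P * (?\<eta> (indicator open_half_plane P * u P) * \<phi>t P + ?q (indicator open_half_plane P * u P) * \<phi>x P)) \<in> borel_measurable borel"
        by measurable
      moreover have "(\<lambda>P. indicator open_half_plane P * (?\<eta> (indicator open_half_plane P * u P) * \<phi>t P + ?q (indicator open_half_plane P * u P) * \<phi>x P))
        = (\<lambda>P. indicator open_half_plane P * (?\<eta> (u P) * \<phi>t P + ?q (u P) * \<phi>x P))"
        by (auto simp: indicator_def)
      ultimately show "(\<lambda>P. indicator open_half_plane P * (?\<eta> (u P) * \<phi>t P + ?q (u P) * \<phi>x P)) \<in> borel_measurable borel" by simp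
      show mG: "(\<lambda>P. ?\<eta> (w P) * \<phi>t P + ?q (w P) * \<phi>x P) \<in> borel_measurable borel" by measurable
      show "integrable lborel (\<lambda>P. ?\<eta> (w P) * \<phi>t P + ?q (w P) * \<phi>x P)"
      proof (rule integrable_rect[OF mG, of "K * M + K * M" "- R" R 0 R])
        show "\<bar>?\<eta> (w P) * \<phi>t P + ?q (w P) * \<phi>x P\<bar> \<le> K * M + K * M" for P
        proof (cases "0 < snd P")
          case True
          have "\<bar>?\<eta> (w P) * \<phi>t P\<bar> \<le> K * M" "\<bar>?q (w P) * \<phi>x P\<bar> \<le> K * M"
            unfolding abs_mult[of "?\<eta> (w P)"] abs_mult[of "?q (w P)"]
            by (intro mult_mono \<eta>K qK M True K0 abs_ge_zero)+
          then show ?thesis by (rule order_trans[OF abs_triangle_ineq add_mono])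
        qed (use neg[of P] K0 M(1) in simp)
        show "?\<eta> (w P) * \<phi>t P + ?q (w P) * \<phi>x P = 0" if "P \<notin> {- R..R} \<times> {0..R}" for P
          using M(4)[OF _ that] neg[of P] by (cases "0 < snd P") auto
      qed
      show "AE P in lborel. P \<in> open_half_plane \<longrightarrow> ?\<eta> (u P) * \<phi>t P + ?q (u P) * \<phi>x P = ?\<eta> (w P) * \<phi>t P + ?q (w P) * \<phi>x P"
        using w(4) by eventually_elim auto
    qed (use neg in simp)
    moreover have "0 \<le> (LBINT t:{0<..}. LBINT x. ?\<eta> (u (x, t)) * dt \<phi> x t + ?q (u (x, t)) * dx \<phi> x t)
          + (LBINT x. ?\<eta> (u0 x) * \<phi> (x, 0))"
      using sol convex_quadratic[of k l] entropy_flux_quadratic[of k l] C1_test_imp_test_function(1)[OF C1] nn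
      unfolding entropy_solution_def by blast
    moreover have "\<phi> (x, 0) = 0" for x using 0[of 0 x] e by simp
    ultimately show "0 \<le> (\<integral>P. ?\<eta> (w P) * \<phi>t P + ?q (w P) * \<phi>x P \<partial>lborel)"
      by (simp add: C1_test_imp_test_function(2,3)[OF C1])
  qed
  ultimately have "burgers_transport w u0 B z v0 C"
    by (intro burgers_transport.intro burgers_entropy.intro)
  then show thesis by (rule that)
qed

text \<open>For |w| \<le> 1/8 the speeds of the first equation lie in [-1/8, 1/8], those of the
  second in [-9/8, -7/8].\<close>

lemma hyperbolic_if_small:
  assumes "M \<le> ereal (1 / 8)"
  shows "uniformly_strictly_hyperbolic (\<lambda>w. w\<^sup>2 / 2) (\<lambda>w. w - 1) M"
proof -
  have w: "\<bar>w\<bar> \<le> 1 / 8" if "ereal \<bar>w\<bar> \<le> M" for w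
    using order_trans[OF that assms] by simp
  have "(SUP w\<in>{w. ereal \<bar>w\<bar> \<le> M}. ereal (w - 1)) \<le> ereal (- 7 / 8)"
    by (rule SUP_least) (use w in force)
  moreover have "ereal (- 1 / 8) \<le> (INF w\<in>{w. ereal \<bar>w\<bar> \<le> M}. ereal (deriv (\<lambda>w. w\<^sup>2 / 2) w))"
    by (rule INF_greatest) (use w in \<open>force simp: deriv_burgers\<close>)
  moreover have "ereal (- 7 / 8) < ereal (- 1 / 8)" by simp
  ultimately show ?thesis unfolding uniformly_strictly_hyperbolic_def by (meson le_less_trans less_le_trans)
qed

theorem theorem2p2:
  fixes f a :: "real \<Rightarrow> real"
  assumes "f = (\<lambda>w. w\<^sup>2 / 2)" and "a = (\<lambda>w. w - 1)"
  shows "\<exists>u0 v0. u0 \<in> BV_minus (1 / 3) \<and> v0 \<in> Linf lborel \<and>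
    uniformly_strictly_hyperbolic f a (Linf_norm lborel u0) \<and>
    \<not> (\<exists>u v. u \<in> Linf (restrict_space lborel open_half_plane) \<and>
            v \<in> Linf (restrict_space lborel open_half_plane) \<and>
            entropy_solution f a u0 v0 u v)"
proof (rule exI[of _ sawtooth], rule exI[of _ "\<lambda>_. 1"], intro conjI)
  show "sawtooth \<in> BV_minus (1 / 3)" unfolding BV_minus_def using sawtooth_in_BV by auto
  have "esssup lborel (\<lambda>_::real. ereal \<bar>1\<bar>) \<le> ereal 1" by (rule esssup_I) auto
  then have "Linf_norm lborel (\<lambda>_::real. 1) < \<infinity>" unfolding Linf_norm_def by (rule le_less_trans) simp
  then show "(\<lambda>_::real. 1) \<in> Linf lborel" unfolding Linf_def by (intro CollectI conjI) auto
  have "Linf_norm lborel sawtooth \<le> ereal (1 / 8)"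
    unfolding Linf_norm_def by (rule esssup_I) (use sawtooth_abs_le in auto)
  then show "uniformly_strictly_hyperbolic f a (Linf_norm lborel sawtooth)"
    unfolding assms by (rule hyperbolic_if_small)
  show "\<not> (\<exists>u v. u \<in> Linf (restrict_space lborel open_half_plane) \<and>
            v \<in> Linf (restrict_space lborel open_half_plane) \<and>
            entropy_solution f a sawtooth (\<lambda>_. 1) u v)"
  proof (clarify, unfold assms)
    fix u v assume u: "u \<in> Linf (restrict_space lborel open_half_plane)" and v: "v \<in> Linf (restrict_space lborel open_half_plane)"
      and sol: "entropy_solution (\<lambda>w. w\<^sup>2 / 2) (\<lambda>w. w - 1) sawtooth (\<lambda>_. 1) u v"
    have "\<bar>sawtooth x\<bar> \<le> 1" for x using sawtooth_abs_le[of x] by simp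
    then show False
      using entropy_solution_imp_transport[OF borel_sawtooth _ _ _ u v sol] no_bounded_transport by auto
  qed
qed

end
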